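(* For every $n\ge1$, the superization $\Pi E$ of an $n$-vector bundle $E$ is a $\mathbb{Z}_2^n$-supermanifold.
   Context: For $i,j\in\mathbb{Z}_2^n$ put $\langle i,j\rangle=\sum_k i_kj_k$. A $\mathbb{Z}_2^n$-commutative associative unital $\mathbb{R}$-algebra is a $\mathbb{Z}_2^n$-graded associative unital $\mathbb{R}$-algebra with $ab=(-1)^{\langle\deg a,\deg b\rangle}ba$ for homogeneous $a,b$. Supermanifolds. Let $\xi^1,\dots,\xi^q$ be formal variables with degrees in $\mathbb{Z}_2^n\setminus\{0\}$. For $U\subset\mathbb{R}^p$ open, $C^\infty_U[[\xi^1,\dots,\xi^q]]$ denotes the sheaf $V\mapsto C^\infty(V)[[\xi^1,\dots,\xi^q]]$ of formal power series $\sum_\mu f_\mu(x)\xi^\mu$ with smooth coefficients, functions of $x$ having degree $0$ and being central, with $\xi^a\xi^b=(-1)^{\langle\deg\xi^a,\deg\xi^b\rangle}\xi^b\xi^a$ (variables with odd $\langle\deg\xi^a,\deg\xi^a\rangle$ thus occur with exponent at most 1). A $\mathbb{Z}_2^n$-supermanifold (atlas definition) is a second-countable Hausdorff topological space $M$ with an atlas: a covering of $M$ by charts, each being a locally $\mathbb{Z}_2^n$-ringed space $\mathcal{U}_\alpha=(U_\alpha,C^\infty_{U_\alpha}[[\xi^1,\dots,\xi^q]])$, $U_\alpha\subset\mathbb{R}^p$ open, with a homeomorphism $\psi_\alpha$ of $U_\alpha$ onto an open subset of $M$, together with, for each pair of charts, a coordinate transformation, i.e. an isomorphism $\Psi_{\beta\alpha}$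 of locally $\mathbb{Z}_2^n$-ringed spaces over $\psi_\beta^{-1}\psi_\alpha$ between the restrictions of $\mathcal{U}_\alpha$ and $\mathcal{U}_\beta$ to the overlap, satisfying the cocycle condition $\Psi_{\beta\gamma}\Psi_{\gamma\alpha}=\Psi_{\beta\alpha}$. (In particular coordinate transformations preserve the $\mathbb{Z}_2^n$-degree.) $n$-vector bundles. An $n$-vector bundle ($n$-tuple vector bundle) $E$ over a smooth manifold $M$ is given by $n$ pairwise commuting Euler vector fields $\nabla_1,\dots,\nabla_n$ (i.e. $n$ compatible vector bundle structures) on the manifold $E$. It has an atlas of multihomogeneous local coordinates: coordinates $x$ of weight $0$ on open subsets of $M$, and further coordinates $y^A$ of weights $w_A\in\{0,1\}^n\setminus\{0\}$ (the $k$-th component of $w_A$ being the weight with respect to $\nabla_k$). Coordinate changes preserve weights: $x'=\varphi(x)$, and $y'^A$ is a finite sum of terms $c(x)\,y^{B_1}\cdots y^{B_r}$ with $w_{B_1}+\dots+w_{B_r}=w_A$ in $\mathbb{N}^n$, $c$ smooth. For instance for $n=2$, with coordinates $(x,\xi,\eta,\theta)$ of bidegrees $(0,0),(0,1),(1,0),(1,1)$: $x'=\varphi(x)$, $\xi'=a(x)\xi$, $\eta'=b(x)\eta$, $\theta'=c(x)\theta+d(x)\xi\eta$. Superization. The superization $\Pi E$ is obtained by assuming that the coordinates satisfy the $\mathbb{Z}_2^n$ sign rule: each coordinate $y^A$ of nonzero weight $w_A$ is replaced by a formal variable of $\mathbb{Z}_2^n$-degree $w_A$ (mod 2), subject to $y^Ay^B=(-1)^{\langle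 w_A,w_B\rangle}y^By^A$, and the same formulas for the coordinate changes are kept (with the products written in a fixed order, using a lexicographic ordering in $\mathbb{Z}_2^n$ relative to an ordering of the Euler vector fields). *)

theory Defs
  imports
    "HOL-Analysis.Analysis"
    "HOL-Algebra.Ring"
    "HOL-Library.Z2"
begin

section \<open>Smooth functions on open subsets of \<open>\<real>\<^sup>p\<close>\<close>

text \<open>
  \<open>\<real>\<^sup>p\<close> is \<open>Euclidean_space p\<close>, the sequences vanishing from index \<open>p\<close> on; in this way \<open>p\<close> is an
  arbitrary natural number, \<open>p = 0\<close> included.
\<close>

definition pderivative :: "nat \<Rightarrow> ((nat \<Rightarrow> real) \<Rightarrow> real) \<Rightarrow> (nat \<Rightarrow> real) \<Rightarrow> real" where
  "pderivative i f x = deriv (\<lambda>t. f (x(i := t))) (x i)"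

definition smooth_on :: "nat \<Rightarrow> (nat \<Rightarrow> real) set \<Rightarrow> ((nat \<Rightarrow> real) \<Rightarrow> real) \<Rightarrow> bool" where
  "smooth_on p W f \<longleftrightarrow>
     (\<forall>js. set js \<subseteq> {..<p} \<longrightarrow>
        continuous_map (subtopology (Euclidean_space p) W) euclideanreal (foldr pderivative js f) \<and>
        (\<forall>x\<in>W. \<forall>i<p. (\<lambda>t. foldr pderivative js f (x(i := t))) differentiable (at (x i))))"


section \<open>\<open>\<int>\<^sub>2\<^sup>n\<close>-commutative algebras\<close>

text \<open>
  \<open>\<int>\<^sub>2\<^sup>n\<close> is \<open>bit ^ 'n\<close> with \<open>n = CARD('n)\<close>, which ranges over all \<open>n \<ge> 1\<close>. The pairing is only needed modulo 2.
\<close>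

definition pairing :: "bit ^ 'n \<Rightarrow> bit ^ 'n \<Rightarrow> bit" where
  "pairing i j = (\<Sum>k\<in>UNIV. i $ k * j $ k)"

definition comm_sign :: "bit ^ 'n \<Rightarrow> bit ^ 'n \<Rightarrow> real" where
  "comm_sign i j = (if pairing i j = 1 then - 1 else 1)"

record ('a, 'n::finite) graded_algebra = "'a ring" +
  scale :: "real \<Rightarrow> 'a \<Rightarrow> 'a"
  component :: "bit ^ 'n \<Rightarrow> 'a set"

definition real_algebra :: "('a, 'n::finite) graded_algebra \<Rightarrow> bool" where
  "real_algebra A \<longleftrightarrow> ring A \<and>
     (\<forall>r. \<forall>a\<in>carrier A. scale A r a \<in> carrier A) \<and>
     (\<forall>a\<in>carrier A. scale A 1 a = a) \<and>
     (\<forall>r s. \<forall>a\<in>carrier A. scale A (r * s) a = scale A r (scale A s a)) \<and>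
     (\<forall>r s. \<forall>a\<in>carrier A. scale A (r + s) a = scale A r a \<oplus>\<^bsub>A\<^esub> scale A s a) \<and>
     (\<forall>r. \<forall>a\<in>carrier A. \<forall>b\<in>carrier A.
        scale A r (a \<oplus>\<^bsub>A\<^esub> b) = scale A r a \<oplus>\<^bsub>A\<^esub> scale A r b \<and>
        scale A r (a \<otimes>\<^bsub>A\<^esub> b) = scale A r a \<otimes>\<^bsub>A\<^esub> b \<and>
        scale A r (a \<otimes>\<^bsub>A\<^esub> b) = a \<otimes>\<^bsub>A\<^esub> scale A r b)"

definition Z2n_graded :: "('a, 'n::finite) graded_algebra \<Rightarrow> bool" where
  "Z2n_graded A \<longleftrightarrow>
     (\<forall>i. component A i \<subseteq> carrier A \<and> \<zero>\<^bsub>A\<^esub> \<in> component A i) \<and>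
     (\<forall>i r. \<forall>a\<in>component A i. \<forall>b\<in>component A i.
        a \<oplus>\<^bsub>A\<^esub> b \<in> component A i \<and> scale A r a \<in> component A i) \<and>
     (\<forall>a\<in>carrier A. \<exists>!f. (\<forall>i. f i \<in> component A i) \<and> a = (\<Oplus>\<^bsub>A\<^esub>i\<in>UNIV. f i)) \<and>
     \<one>\<^bsub>A\<^esub> \<in> component A 0 \<and>
     (\<forall>i j. \<forall>a\<in>component A i. \<forall>b\<in>component A j. a \<otimes>\<^bsub>A\<^esub> b \<in> component A (i + j))"

definition Z2n_commutative_algebra :: "('a, 'n::finite) graded_algebra \<Rightarrow> bool" where
  "Z2n_commutative_algebra A \<longleftrightarrow> real_algebra A \<and> Z2n_graded A \<and>
     (\<forall>i j. \<forall>a\<in>component A i. \<forall>b\<in>component A j.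
        a \<otimes>\<^bsub>A\<^esub> b = scale A (comm_sign i j) (b \<otimes>\<^bsub>A\<^esub> a))"

definition Z2n_algebra_hom ::
  "('a, 'n::finite) graded_algebra \<Rightarrow> ('b, 'n::finite) graded_algebra \<Rightarrow> ('a \<Rightarrow> 'b) \<Rightarrow> bool" where
  "Z2n_algebra_hom A B h \<longleftrightarrow> h \<in> ring_hom A B \<and>
     (\<forall>r. \<forall>a\<in>carrier A. h (scale A r a) = scale B r (h a)) \<and>
     (\<forall>i. h ` component A i \<subseteq> component B i)"


section \<open>Locally \<open>\<int>\<^sub>2\<^sup>n\<close>-ringed spaces\<close>

record ('x, 'a, 'n::finite) ringed_space =
  points :: "'x topology"
  sections :: "'x set \<Rightarrow> ('a, 'n::finite) graded_algebra"
  restr :: "'x set \<Rightarrow> 'x set \<Rightarrow> 'a \<Rightarrow> 'a"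

definition Z2n_presheaf :: "('x, 'a, 'n::finite) ringed_space \<Rightarrow> bool" where
  "Z2n_presheaf X \<longleftrightarrow>
     (\<forall>V. openin (points X) V \<longrightarrow> Z2n_commutative_algebra (sections X V)) \<and>
     (\<forall>V W. openin (points X) V \<and> openin (points X) W \<and> W \<subseteq> V \<longrightarrow>
        Z2n_algebra_hom (sections X V) (sections X W) (restr X V W)) \<and>
     (\<forall>V. openin (points X) V \<longrightarrow> (\<forall>s\<in>carrier (sections X V). restr X V V s = s)) \<and>
     (\<forall>V W N. openin (points X) V \<and> openin (points X) W \<and> openin (points X) N \<and> N \<subseteq> W \<and> W \<subseteq> V \<longrightarrow>
        (\<forall>s\<in>carrier (sections X V). restr X W N (restr X V W s) = restr X V N s))"

definition Z2n_sheaf :: "('x, 'a, 'n::finite) ringed_space \<Rightarrow> bool" where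
  "Z2n_sheaf X \<longleftrightarrow> Z2n_presheaf X \<and>
     (\<forall>\<V> s. (\<forall>V\<in>\<V>. openin (points X) V \<and> s V \<in> carrier (sections X V)) \<and>
            (\<forall>V\<in>\<V>. \<forall>W\<in>\<V>. restr X V (V \<inter> W) (s V) = restr X W (V \<inter> W) (s W)) \<longrightarrow>
        (\<exists>!t. t \<in> carrier (sections X (\<Union>\<V>)) \<and> (\<forall>V\<in>\<V>. restr X (\<Union>\<V>) V t = s V)))"

text \<open>The germ at \<open>x\<close> of the section \<open>s\<close> over \<open>V\<close> is a unit of the stalk.\<close>

definition unit_germ :: "('x, 'a, 'n::finite) ringed_space \<Rightarrow> 'x \<Rightarrow> 'x set \<Rightarrow> 'a \<Rightarrow> bool" where
  "unit_germ X x V s \<longleftrightarrow>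
     (\<exists>N. openin (points X) N \<and> x \<in> N \<and> N \<subseteq> V \<and> restr X V N s \<in> Units (sections X N))"

text \<open>
  The stalk at \<open>x\<close> is a local ring: it is not the zero ring, and the non-units are closed under
  addition. Two germs always have representatives over a common neighbourhood of \<open>x\<close>.
\<close>

definition local_stalk :: "('x, 'a, 'n::finite) ringed_space \<Rightarrow> 'x \<Rightarrow> bool" where
  "local_stalk X x \<longleftrightarrow>
     (\<forall>V. openin (points X) V \<and> x \<in> V \<longrightarrow>
        \<one>\<^bsub>sections X V\<^esub> \<noteq> \<zero>\<^bsub>sections X V\<^esub> \<and>
        (\<forall>s\<in>carrier (sections X V). \<forall>t\<in>carrier (sections X V).
           \<not> unit_germ X x V s \<and> \<not> unit_germ X x V t \<longrightarrow>
           \<not> unit_germ X x V (s \<oplus>\<^bsub>sections X V\<^esub> t)))"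

definition locally_Z2n_ringed_space :: "('x, 'a, 'n::finite) ringed_space \<Rightarrow> bool" where
  "locally_Z2n_ringed_space X \<longleftrightarrow> Z2n_sheaf X \<and> (\<forall>x\<in>topspace (points X). local_stalk X x)"

definition open_subspace ::
  "('x, 'a, 'n::finite) ringed_space \<Rightarrow> 'x set \<Rightarrow> ('x, 'a, 'n::finite) ringed_space" where
  "open_subspace X W = X\<lparr>points := subtopology (points X) W\<rparr>"

definition preimage_in :: "('x, 'a, 'n::finite) ringed_space \<Rightarrow> ('x \<Rightarrow> 'y) \<Rightarrow> 'y set \<Rightarrow> 'x set" where
  "preimage_in X \<phi> W = {x \<in> topspace (points X). \<phi> x \<in> W}"

text \<open>
  A morphism \<open>X \<rightarrow> Y\<close> consists of a continuous map \<open>\<phi>\<close> and, for every open set \<open>W\<close> of \<open>Y\<close>, a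
  pullback \<open>\<Phi> W\<close> from the sections of \<open>Y\<close> over \<open>W\<close> to the sections of \<open>X\<close> over \<open>\<phi>\<^sup>-\<^sup>1 W\<close>. The last
  clause says that the induced homomorphisms of stalks are local.
\<close>

definition Z2n_morphism ::
  "('x, 'a, 'n::finite) ringed_space \<Rightarrow> ('y, 'b, 'n::finite) ringed_space \<Rightarrow>
   ('x \<Rightarrow> 'y) \<Rightarrow> ('y set \<Rightarrow> 'b \<Rightarrow> 'a) \<Rightarrow> bool" where
  "Z2n_morphism X Y \<phi> \<Phi> \<longleftrightarrow>
     locally_Z2n_ringed_space X \<and> locally_Z2n_ringed_space Y \<and>
     continuous_map (points X) (points Y) \<phi> \<and>
     (\<forall>W. openin (points Y) W \<longrightarrow>
        Z2n_algebra_hom (sections Y W) (sections X (preimage_in X \<phi> W)) (\<Phi> W)) \<and>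
     (\<forall>W N. openin (points Y) W \<and> openin (points Y) N \<and> N \<subseteq> W \<longrightarrow>
        (\<forall>s\<in>carrier (sections Y W).
           \<Phi> N (restr Y W N s) = restr X (preimage_in X \<phi> W) (preimage_in X \<phi> N) (\<Phi> W s))) \<and>
     (\<forall>x\<in>topspace (points X). \<forall>W. openin (points Y) W \<and> \<phi> x \<in> W \<longrightarrow>
        (\<forall>s\<in>carrier (sections Y W).
           unit_germ X x (preimage_in X \<phi> W) (\<Phi> W s) \<longrightarrow> unit_germ Y (\<phi> x) W s))"

definition Z2n_isomorphism ::
  "('x, 'a, 'n::finite) ringed_space \<Rightarrow> ('y, 'b, 'n::finite) ringed_space \<Rightarrow>
   ('x \<Rightarrow> 'y) \<Rightarrow> ('y set \<Rightarrow> 'b \<Rightarrow> 'a) \<Rightarrow> bool" where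
  "Z2n_isomorphism X Y \<phi> \<Phi> \<longleftrightarrow> Z2n_morphism X Y \<phi> \<Phi> \<and>
     (\<exists>\<psi> \<Psi>. Z2n_morphism Y X \<psi> \<Psi> \<and>
        (\<forall>x\<in>topspace (points X). \<psi> (\<phi> x) = x) \<and>
        (\<forall>y\<in>topspace (points Y). \<phi> (\<psi> y) = y) \<and>
        (\<forall>V. openin (points X) V \<longrightarrow>
           (\<forall>s\<in>carrier (sections X V). \<Phi> (preimage_in Y \<psi> V) (\<Psi> V s) = s)) \<and>
        (\<forall>W. openin (points Y) W \<longrightarrow>
           (\<forall>s\<in>carrier (sections Y W). \<Psi> (preimage_in X \<phi> W) (\<Phi> W s) = s)))"


section \<open>Formal power series with smooth coefficients\<close>

text \<open>
  The formal variables are \<open>\<xi> 0, \<dots>, \<xi> (q - 1)\<close>, of degrees \<open>deg 0, \<dots>, deg (q - 1)\<close>. A series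
  \<open>\<Sum>\<^sub>\<mu> f\<^sub>\<mu>(x) \<xi>\<^sup>\<mu>\<close> is the function taking \<open>\<mu>\<close> and \<open>x\<close> to \<open>f\<^sub>\<mu>(x)\<close>, where \<open>\<xi>\<^sup>\<mu>\<close> is the product of the
  \<open>\<xi> a ^ \<mu> a\<close> in increasing order of \<open>a\<close>. Coefficients are set to \<open>0\<close> outside their domain
  and at exponents that do not occur, so that equality of series is equality of functions.
\<close>

type_synonym series = "(nat \<Rightarrow> nat) \<Rightarrow> (nat \<Rightarrow> real) \<Rightarrow> real"

definition exponents :: "nat \<Rightarrow> (nat \<Rightarrow> bit ^ 'n) \<Rightarrow> (nat \<Rightarrow> nat) set" where
  "exponents q deg = {\<mu>. (\<forall>a\<ge>q. \<mu> a = 0) \<and> (\<forall>a<q. pairing (deg a) (deg a) = 1 \<longrightarrow> \<mu> a \<le> 1)}"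

definition monomial_degree :: "nat \<Rightarrow> (nat \<Rightarrow> bit ^ 'n) \<Rightarrow> (nat \<Rightarrow> nat) \<Rightarrow> bit ^ 'n::finite" where
  "monomial_degree q deg \<mu> = (\<Sum>a<q. of_nat (\<mu> a) *s deg a)"

text \<open>\<open>\<xi>\<^sup>\<mu> \<xi>\<^sup>\<nu> = monomial_sign q deg \<mu> \<nu> \<cdot> \<xi>\<^sup>\<mu>\<^sup>+\<^sup>\<nu>\<close>: each \<open>\<xi> a\<close> of \<open>\<xi>\<^sup>\<mu>\<close> passes each \<open>\<xi> b\<close> of \<open>\<xi>\<^sup>\<nu>\<close> with \<open>b < a\<close>.\<close>

definition monomial_sign ::
  "nat \<Rightarrow> (nat \<Rightarrow> bit ^ 'n) \<Rightarrow> (nat \<Rightarrow> nat) \<Rightarrow> (nat \<Rightarrow> nat) \<Rightarrow> real" where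
  "monomial_sign q deg \<mu> \<nu> = (\<Prod>a<q. \<Prod>b<a. comm_sign (deg a) (deg b) ^ (\<mu> a * \<nu> b))"

definition series_algebra ::
  "nat \<Rightarrow> nat \<Rightarrow> (nat \<Rightarrow> bit ^ 'n::finite) \<Rightarrow> (nat \<Rightarrow> real) set \<Rightarrow> (series, 'n::finite) graded_algebra" where
  "series_algebra p q deg W =
     (let S = {f. (\<forall>\<mu>\<in>exponents q deg. smooth_on p W (f \<mu>)) \<and>
                  (\<forall>\<mu> x. \<mu> \<notin> exponents q deg \<or> x \<notin> W \<longrightarrow> f \<mu> x = 0)}
      in \<lparr>carrier = S,
          mult = (\<lambda>f g \<mu> x. if \<mu> \<in> exponents q deg
                   then \<Sum>\<nu> | \<nu> \<le> \<mu>. monomial_sign q deg \<nu> (\<lambda>a. \<mu> a - \<nu> a) * f \<nu> x * g (\<lambda>a. \<mu> a - \<nu> a) x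
                   else 0),
          one = (\<lambda>\<mu> x. if \<mu> = (\<lambda>_. 0) \<and> x \<in> W then 1 else 0),
          zero = (\<lambda>\<mu> x. 0),
          add = (\<lambda>f g \<mu> x. f \<mu> x + g \<mu> x),
          scale = (\<lambda>r f \<mu> x. r * f \<mu> x),
          component = (\<lambda>i. {f \<in> S. \<forall>\<mu>. monomial_degree q deg \<mu> \<noteq> i \<longrightarrow> f \<mu> = (\<lambda>x. 0)})\<rparr>)"

definition series_space ::
  "nat \<Rightarrow> nat \<Rightarrow> (nat \<Rightarrow> bit ^ 'n::finite) \<Rightarrow> (nat \<Rightarrow> real) set \<Rightarrow>
   (nat \<Rightarrow> real, series, 'n::finite) ringed_space" where
  "series_space p q deg U =
     \<lparr>points = subtopology (Euclidean_space p) U,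
      sections = series_algebra p q deg,
      restr = (\<lambda>V W f \<mu> x. if x \<in> W then f \<mu> x else 0)\<rparr>"

definition variable_section :: "(nat \<Rightarrow> real) set \<Rightarrow> nat \<Rightarrow> series" where
  "variable_section W a = (\<lambda>\<mu> x. if \<mu> = (\<lambda>b. if b = a then 1 else 0) \<and> x \<in> W then 1 else 0)"

definition function_section :: "(nat \<Rightarrow> real) set \<Rightarrow> ((nat \<Rightarrow> real) \<Rightarrow> real) \<Rightarrow> series" where
  "function_section W c = (\<lambda>\<mu> x. if \<mu> = (\<lambda>_. 0) \<and> x \<in> W then c x else 0)"

definition ordered_product :: "('a, 'm) monoid_scheme \<Rightarrow> 'a list \<Rightarrow> 'a" where
  "ordered_product A ss = foldr (\<lambda>s t. s \<otimes>\<^bsub>A\<^esub> t) ss \<one>\<^bsub>A\<^esub>"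

text \<open>
  Substitution of \<open>x' = \<phi>(x)\<close> and \<open>\<xi>'\<^sup>a = Y a\<close> in a series, with result over \<open>W\<close>. It is meant for
  series \<open>Y a\<close> without term of degree \<open>0\<close> in \<open>\<xi>\<close>; then a monomial \<open>\<xi>'\<^sup>\<mu>\<close> contributes to the
  coefficient at \<open>\<nu>\<close> only if \<open>|\<mu>| \<le> |\<nu>|\<close>, so that the sum below is the full, infinite one.
\<close>

definition substitute ::
  "nat \<Rightarrow> nat \<Rightarrow> (nat \<Rightarrow> bit ^ 'n::finite) \<Rightarrow> (nat \<Rightarrow> real) set \<Rightarrow>
   ((nat \<Rightarrow> real) \<Rightarrow> (nat \<Rightarrow> real)) \<Rightarrow> (nat \<Rightarrow> series) \<Rightarrow> series \<Rightarrow> series" where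
  "substitute p q deg W \<phi> Y s =
     (let A = series_algebra p q deg W
      in (\<lambda>\<nu> x. \<Sum>\<mu> | \<mu> \<in> exponents q deg \<and> (\<Sum>a<q. \<mu> a) \<le> (\<Sum>a<q. \<nu> a).
            s \<mu> (\<phi> x) * ordered_product A (map (\<lambda>a. Y a [^]\<^bsub>A\<^esub> \<mu> a) [0..<q]) \<nu> x))"


section \<open>\<open>\<int>\<^sub>2\<^sup>n\<close>-supermanifolds\<close>

text \<open>
  \<open>transition S \<beta> \<alpha>\<close> is the family of pullbacks, from sections over open sets in the chart \<open>\<beta>\<close> to
  sections in the chart \<open>\<alpha>\<close>, of the coordinate transformation \<open>\<Psi>\<^sub>\<beta>\<^sub>\<alpha>\<close>.
\<close>

record ('m, 'i, 'n::finite) super_atlas =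
  body :: "'m topology"
  body_dim :: nat
  formal_dim :: nat
  formal_degree :: "nat \<Rightarrow> bit ^ 'n"
  charts :: "'i set"
  chart_domain :: "'i \<Rightarrow> (nat \<Rightarrow> real) set"
  chart_map :: "'i \<Rightarrow> (nat \<Rightarrow> real) \<Rightarrow> 'm"
  transition :: "'i \<Rightarrow> 'i \<Rightarrow> (nat \<Rightarrow> real) set \<Rightarrow> series \<Rightarrow> series"

definition chart_space ::
  "('m, 'i, 'n::finite) super_atlas \<Rightarrow> 'i \<Rightarrow> (nat \<Rightarrow> real, series, 'n::finite) ringed_space" where
  "chart_space S \<alpha> =
     series_space (body_dim S) (formal_dim S) (formal_degree S) (chart_domain S \<alpha>)"

text \<open>The part of the domain of the chart \<open>\<alpha>\<close> whose image lies in the images of all charts in \<open>J\<close>.\<close>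

definition overlap_in ::
  "('i \<Rightarrow> (nat \<Rightarrow> real) set) \<Rightarrow> ('i \<Rightarrow> (nat \<Rightarrow> real) \<Rightarrow> 'm) \<Rightarrow> 'i set \<Rightarrow> 'i \<Rightarrow> (nat \<Rightarrow> real) set" where
  "overlap_in U \<psi> J \<alpha> = {x \<in> U \<alpha>. \<forall>\<beta>\<in>J. \<psi> \<alpha> x \<in> \<psi> \<beta> ` U \<beta>}"

text \<open>\<open>\<psi>\<^sub>\<beta>\<^sup>-\<^sup>1 \<psi>\<^sub>\<alpha>\<close>\<close>

definition coordinate_change ::
  "('i \<Rightarrow> 'x set) \<Rightarrow> ('i \<Rightarrow> 'x \<Rightarrow> 'm) \<Rightarrow> 'i \<Rightarrow> 'i \<Rightarrow> 'x \<Rightarrow> 'x" where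
  "coordinate_change U \<psi> \<beta> \<alpha> x = inv_into (U \<beta>) (\<psi> \<beta>) (\<psi> \<alpha> x)"

definition open_chart :: "nat \<Rightarrow> 'm topology \<Rightarrow> (nat \<Rightarrow> real) set \<Rightarrow> ((nat \<Rightarrow> real) \<Rightarrow> 'm) \<Rightarrow> bool" where
  "open_chart p M U \<psi> \<longleftrightarrow>
     openin (Euclidean_space p) U \<and> openin M (\<psi> ` U) \<and>
     homeomorphic_map (subtopology (Euclidean_space p) U) (subtopology M (\<psi> ` U)) \<psi>"

definition Z2n_supermanifold :: "('m, 'i, 'n::finite) super_atlas \<Rightarrow> bool" where
  "Z2n_supermanifold S \<longleftrightarrow>
     (let U = chart_domain S; \<psi> = chart_map S; I = charts S;
          ov = overlap_in U \<psi>; \<phi> = coordinate_change U \<psi>; \<Psi> = transition S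
      in Hausdorff_space (body S) \<and> second_countable (body S) \<and>
         (\<forall>a<formal_dim S. formal_degree S a \<noteq> 0) \<and>
         (\<forall>\<alpha>\<in>I. open_chart (body_dim S) (body S) (U \<alpha>) (\<psi> \<alpha>) \<and>
                 locally_Z2n_ringed_space (chart_space S \<alpha>)) \<and>
         topspace (body S) = (\<Union>\<alpha>\<in>I. \<psi> \<alpha> ` U \<alpha>) \<and>
         (\<forall>\<alpha>\<in>I. \<forall>\<beta>\<in>I.
            Z2n_isomorphism (open_subspace (chart_space S \<alpha>) (ov {\<beta>} \<alpha>))
              (open_subspace (chart_space S \<beta>) (ov {\<alpha>} \<beta>)) (\<phi> \<beta> \<alpha>) (\<Psi> \<beta> \<alpha>)) \<and>
         (\<forall>\<alpha>\<in>I. \<forall>\<beta>\<in>I. \<forall>\<gamma>\<in>I. \<forall>W. openin (Euclidean_space (body_dim S)) W \<and> W \<subseteq> ov {\<alpha>, \<gamma>} \<beta> \<longrightarrow>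
            (\<forall>s\<in>carrier (sections (chart_space S \<beta>) W).
               \<Psi> \<gamma> \<alpha> {y \<in> ov {\<beta>} \<gamma>. \<phi> \<beta> \<gamma> y \<in> W} (\<Psi> \<beta> \<gamma> W s) = \<Psi> \<beta> \<alpha> W s)))"


section \<open>\<open>n\<close>-vector bundles\<close>

text \<open>
  The Euler vector fields are indexed by \<open>'n\<close> and act as derivations on the smooth functions
  on the total space. The chart \<open>\<alpha>\<close> of the total space is defined on
  \<open>{(x, y). x \<in> base_domain E \<alpha>, y \<in> \<real>\<^sup>q}\<close>, an open subset of \<open>\<real>\<^sup>p\<^sup>+\<^sup>q\<close>: coordinates \<open>0, \<dots>, p - 1\<close> are
  the \<open>x\<close>, and coordinate \<open>p + a\<close> is \<open>y\<^sup>a\<close>, of weight \<open>weight E a\<close>.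
\<close>

record ('e, 'm, 'i, 'n::finite) bundle_atlas =
  total_space :: "'e topology"
  base_space :: "'m topology"
  projection :: "'e \<Rightarrow> 'm"
  euler :: "'n \<Rightarrow> ('e \<Rightarrow> real) \<Rightarrow> 'e \<Rightarrow> real"
  base_dim :: nat
  fibre_dim :: nat
  weight :: "nat \<Rightarrow> nat ^ 'n"
  bundle_charts :: "'i set"
  base_domain :: "'i \<Rightarrow> (nat \<Rightarrow> real) set"
  base_map :: "'i \<Rightarrow> (nat \<Rightarrow> real) \<Rightarrow> 'm"
  total_map :: "'i \<Rightarrow> (nat \<Rightarrow> real) \<Rightarrow> 'e"

definition base_part :: "nat \<Rightarrow> (nat \<Rightarrow> real) \<Rightarrow> nat \<Rightarrow> real" where
  "base_part p z = (\<lambda>i. if i < p then z i else 0)"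

definition total_domain :: "('e, 'm, 'i, 'n::finite) bundle_atlas \<Rightarrow> 'i \<Rightarrow> (nat \<Rightarrow> real) set" where
  "total_domain E \<alpha> =
     {z \<in> topspace (Euclidean_space (base_dim E + fibre_dim E)).
        base_part (base_dim E) z \<in> base_domain E \<alpha>}"

definition smooth_functions :: "('e, 'm, 'i, 'n::finite) bundle_atlas \<Rightarrow> ('e \<Rightarrow> real) set" where
  "smooth_functions E =
     {f. (\<forall>e. e \<notin> topspace (total_space E) \<longrightarrow> f e = 0) \<and>
         (\<forall>\<alpha>\<in>bundle_charts E.
            smooth_on (base_dim E + fibre_dim E) (total_domain E \<alpha>) (\<lambda>z. f (total_map E \<alpha> z)))}"

definition vector_field ::
  "('e, 'm, 'i, 'n::finite) bundle_atlas \<Rightarrow> (('e \<Rightarrow> real) \<Rightarrow> 'e \<Rightarrow> real) \<Rightarrow> bool" where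
  "vector_field E D \<longleftrightarrow>
     (\<forall>f\<in>smooth_functions E. D f \<in> smooth_functions E) \<and>
     (\<forall>f\<in>smooth_functions E. \<forall>g\<in>smooth_functions E. \<forall>r s.
        D (\<lambda>e. r * f e + s * g e) = (\<lambda>e. r * D f e + s * D g e)) \<and>
     (\<forall>f\<in>smooth_functions E. \<forall>g\<in>smooth_functions E.
        D (\<lambda>e. f e * g e) = (\<lambda>e. D f e * g e + f e * D g e))"

text \<open>The coordinates of the chart \<open>\<alpha>\<close> are multihomogeneous: \<open>\<nabla>\<^sub>k = \<Sum>\<^sub>a w\<^sub>a(k) y\<^sup>a \<partial>/\<partial>y\<^sup>a\<close>.\<close>

definition multihomogeneous :: "('e, 'm, 'i, 'n::finite) bundle_atlas \<Rightarrow> 'i \<Rightarrow> bool" where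
  "multihomogeneous E \<alpha> \<longleftrightarrow>
     (\<forall>k. \<forall>f\<in>smooth_functions E. \<forall>z\<in>total_domain E \<alpha>.
        euler E k f (total_map E \<alpha> z) =
          (\<Sum>a<fibre_dim E. real (weight E a $ k) * z (base_dim E + a) *
             pderivative (base_dim E + a) (\<lambda>z. f (total_map E \<alpha> z)) z))"

text \<open>
  The products \<open>y\<^sup>B\<^sup>1 \<cdots> y\<^sup>B\<^sup>r\<close> of total weight \<open>w\<^sub>a\<close>. As \<open>w\<^sub>a\<close> has entries in \<open>{0,1}\<close> and no \<open>w\<^sub>B\<close>
  vanishes, no index can occur twice; terms with the same factors are collected, so
  that products are indexed by sets of indices.
\<close>

definition weight_terms :: "('e, 'm, 'i, 'n::finite) bundle_atlas \<Rightarrow> nat \<Rightarrow> nat set set" where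
  "weight_terms E a = {B. B \<subseteq> {..<fibre_dim E} \<and> (\<Sum>b\<in>B. weight E b) = weight E a}"

abbreviation base_overlap :: "('e, 'm, 'i, 'n::finite) bundle_atlas \<Rightarrow> 'i \<Rightarrow> 'i \<Rightarrow> (nat \<Rightarrow> real) set" where
  "base_overlap E \<beta> \<alpha> \<equiv> overlap_in (base_domain E) (base_map E) {\<beta>} \<alpha>"

abbreviation base_change ::
  "('e, 'm, 'i, 'n::finite) bundle_atlas \<Rightarrow> 'i \<Rightarrow> 'i \<Rightarrow> (nat \<Rightarrow> real) \<Rightarrow> nat \<Rightarrow> real" where
  "base_change E \<equiv> coordinate_change (base_domain E) (base_map E)"

abbreviation total_change ::
  "('e, 'm, 'i, 'n::finite) bundle_atlas \<Rightarrow> 'i \<Rightarrow> 'i \<Rightarrow> (nat \<Rightarrow> real) \<Rightarrow> nat \<Rightarrow> real" where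
  "total_change E \<equiv> coordinate_change (total_domain E) (total_map E)"

text \<open>The change of fibre coordinates from \<open>\<alpha>\<close> to \<open>\<beta>\<close> is \<open>y'\<^sup>a = \<Sum>\<^sub>B c a B (x) \<Prod>\<^sub>b\<^sub>\<in>\<^sub>B y\<^sup>b\<close>.\<close>

definition fibre_change_coefficients ::
  "('e, 'm, 'i, 'n::finite) bundle_atlas \<Rightarrow> 'i \<Rightarrow> 'i \<Rightarrow>
   (nat \<Rightarrow> nat set \<Rightarrow> (nat \<Rightarrow> real) \<Rightarrow> real) \<Rightarrow> bool" where
  "fibre_change_coefficients E \<beta> \<alpha> c \<longleftrightarrow>
     (\<forall>a<fibre_dim E. \<forall>B\<in>weight_terms E a. smooth_on (base_dim E) (base_overlap E \<beta> \<alpha>) (c a B)) \<and>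
     (\<forall>z\<in>total_domain E \<alpha>. base_part (base_dim E) z \<in> base_overlap E \<beta> \<alpha> \<longrightarrow>
        (\<forall>a<fibre_dim E. total_change E \<beta> \<alpha> z (base_dim E + a) =
           (\<Sum>B\<in>weight_terms E a. c a B (base_part (base_dim E) z) * (\<Prod>b\<in>B. z (base_dim E + b)))))"

definition n_vector_bundle :: "('e, 'm, 'i, 'n::finite) bundle_atlas \<Rightarrow> bool" where
  "n_vector_bundle E \<longleftrightarrow>
     (let I = bundle_charts E; p = base_dim E; q = fibre_dim E; M = base_space E; T = total_space E
      in \<comment> \<open>the base manifold\<close>
         Hausdorff_space M \<and> second_countable M \<and>
         (\<forall>\<alpha>\<in>I. open_chart p M (base_domain E \<alpha>) (base_map E \<alpha>)) \<and>
         topspace M = (\<Union>\<alpha>\<in>I. base_map E \<alpha> ` base_domain E \<alpha>) \<and>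
         (\<forall>\<alpha>\<in>I. \<forall>\<beta>\<in>I. \<forall>i<p. smooth_on p (base_overlap E \<beta> \<alpha>) (\<lambda>x. base_change E \<beta> \<alpha> x i)) \<and>
         \<comment> \<open>the total space and its atlas\<close>
         Hausdorff_space T \<and> second_countable T \<and> continuous_map T M (projection E) \<and>
         (\<forall>\<alpha>\<in>I. open_chart (p + q) T (total_domain E \<alpha>) (total_map E \<alpha>) \<and>
            total_map E \<alpha> ` total_domain E \<alpha> =
              {e \<in> topspace T. projection E e \<in> base_map E \<alpha> ` base_domain E \<alpha>} \<and>
            (\<forall>z\<in>total_domain E \<alpha>. projection E (total_map E \<alpha> z) = base_map E \<alpha> (base_part p z))) \<and>
         (\<forall>\<alpha>\<in>I. \<forall>\<beta>\<in>I. \<exists>c. fibre_change_coefficients E \<beta> \<alpha> c) \<and>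
         \<comment> \<open>the Euler vector fields\<close>
         (\<forall>a<q. weight E a \<noteq> 0 \<and> (\<forall>k. weight E a $ k \<in> {0, 1})) \<and>
         (\<forall>k. vector_field E (euler E k)) \<and>
         (\<forall>k l. \<forall>f\<in>smooth_functions E. euler E k (euler E l f) = euler E l (euler E k f)) \<and>
         (\<forall>\<alpha>\<in>I. multihomogeneous E \<alpha>))"


section \<open>Superization\<close>

definition lex_less :: "(nat, 'n::{finite,linorder}) vec \<Rightarrow> (nat, 'n) vec \<Rightarrow> bool" where
  "lex_less v w \<longleftrightarrow> (\<exists>k. v $ k < w $ k \<and> (\<forall>j<k. v $ j = w $ j))"

text \<open>
  The elements of \<open>B\<close> in lexicographic order of their weights, relative to the order of \<open>'n\<close>.
  The list is unique for \<open>B \<in> weight_terms E a\<close>, where the weights are pairwise distinct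
  because their supports are disjoint.
\<close>

definition lex_list ::
  "('e, 'm, 'i, 'n::{finite,linorder}) bundle_atlas \<Rightarrow> nat set \<Rightarrow> nat list" where
  "lex_list E B =
     (THE bs. set bs = B \<and> distinct bs \<and> sorted_wrt (\<lambda>a b. lex_less (weight E a) (weight E b)) bs)"

definition weight_degree :: "('e, 'm, 'i, 'n::finite) bundle_atlas \<Rightarrow> nat \<Rightarrow> bit ^ 'n" where
  "weight_degree E a = (\<chi> k. of_nat (weight E a $ k))"

text \<open>The coefficients are unique on the overlap, and only their values there are used.\<close>

definition fibre_coefficients ::
  "('e, 'm, 'i, 'n::finite) bundle_atlas \<Rightarrow> 'i \<Rightarrow> 'i \<Rightarrow> nat \<Rightarrow> nat set \<Rightarrow> (nat \<Rightarrow> real) \<Rightarrow> real" where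
  "fibre_coefficients E \<beta> \<alpha> = (SOME c. fibre_change_coefficients E \<beta> \<alpha> c)"

text \<open>The formula for \<open>y'\<^sup>a\<close>, read over \<open>W\<close> in the formal variables.\<close>

definition super_coordinate ::
  "('e, 'm, 'i, 'n::{finite,linorder}) bundle_atlas \<Rightarrow> 'i \<Rightarrow> 'i \<Rightarrow>
   (nat \<Rightarrow> real) set \<Rightarrow> nat \<Rightarrow> series" where
  "super_coordinate E \<beta> \<alpha> W a =
     (let A = series_algebra (base_dim E) (fibre_dim E) (weight_degree E) W
      in \<Oplus>\<^bsub>A\<^esub>B\<in>weight_terms E a. function_section W (fibre_coefficients E \<beta> \<alpha> a B) \<otimes>\<^bsub>A\<^esub>
           ordered_product A (map (variable_section W) (lex_list E B)))"

definition superization ::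
  "('e, 'm, 'i, 'n::{finite,linorder}) bundle_atlas \<Rightarrow> ('m, 'i, 'n) super_atlas" where
  "superization E =
     \<lparr>body = base_space E,
      body_dim = base_dim E,
      formal_dim = fibre_dim E,
      formal_degree = weight_degree E,
      charts = bundle_charts E,
      chart_domain = base_domain E,
      chart_map = base_map E,
      transition = (\<lambda>\<beta> \<alpha> W'.
        let W = {x \<in> base_overlap E \<beta> \<alpha>. base_change E \<beta> \<alpha> x \<in> W'}
        in substitute (base_dim E) (fibre_dim E) (weight_degree E) W
             (base_change E \<beta> \<alpha>) (super_coordinate E \<beta> \<alpha> W))\<rparr>"

end

theory Submission
  imports Defs
begin

text \<open>
  All of the structure of a series with smooth coefficients, except smoothness, is pointwise in \<open>x\<close>. At a
  point a coordinate transformation is thus a substitution in \<open>\<int>\<^sub>2\<^sup>n\<close>-commutative power series over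
  \<open>\<real>\<close>; it is a homomorphism because the substituted series are homogeneous of the degrees of the
  variables, and it makes sense because they have no constant term. Stalks are local because series with
  non-vanishing constant term are inverted by a geometric series.

  The cocycle condition has to be transferred from the total space to the superization. In a term of the
  formula for \<open>y'\<^sup>a\<close> the weights of the factors add up to \<open>w\<^sub>a \<in> {0,1}\<^sup>n\<close>, so they have disjoint supports
  and pair to \<open>0\<close>: the factors commute, and expanding a composition of the superized formulas produces no
  signs. It therefore yields the same coefficients as expanding the composition of the polynomial
  coordinate changes, and these coefficients are determined by the composed function as the fibres are
  all of \<open>\<real>\<^sup>q\<close>.
\<close>


section \<open>Smooth functions of several variables\<close>

text \<open>The fibre coefficients are picked by choice, separately for each pair of charts. Nothing
  about them is compatible by construction, not even that the transition of a chart to itself is the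
  identity. Uniqueness of coefficients settles both points, and the inverse of a coordinate
  transformation then comes from the cocycle condition for \<alpha>, \<alpha>, \<beta>. Analysis
  enters through \<open>smooth_on\<close>, which asks for iterated partial derivatives that exist
  and are continuous. Composition with a coordinate change therefore needs a chain rule built from
  the mean value theorem instead of a total derivative. In the algebra no convergence is involved.
  The coefficient at \<nu> of a product uses exponents below \<nu> only, and that of a substituted
  series uses exponents of total size at most that of \<nu>, so every sum can be cut to a finite
  one. Two gradings have to be carried along: degrees mod 2 govern the signs, whereas the
  disjointness of supports is visible only in the integer weights.\<close>

lemma Euclidean_space_eq: "Euclidean_space p = top_of_set (topspace (Euclidean_space p))"
  by (simp add: Euclidean_space_def euclidean_product_topology)

lemma subtopology_Euclidean:
  "W \<subseteq> topspace (Euclidean_space p) \<Longrightarrow> subtopology (Euclidean_space p) W = top_of_set W"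
  by (subst Euclidean_space_eq) (simp add: subtopology_subtopology Int_absorb1)

lemma continuous_map_Euclidean:
  assumes "W \<subseteq> topspace (Euclidean_space p)"
  shows "continuous_map (subtopology (Euclidean_space p) W) euclideanreal f \<longleftrightarrow> continuous_on W f"
  by (simp add: subtopology_Euclidean[OF assms])

lemma continuous_on_coordinates:
  assumes \<phi>: "\<phi> \<in> W \<rightarrow> topspace (Euclidean_space p)"
    and cont: "\<And>j. j < p \<Longrightarrow> continuous_on W (\<lambda>x. \<phi> x j)"
  shows "continuous_on W \<phi>"
proof (rule continuous_on_coordinatewise_then_product)
  fix i show "continuous_on W (\<lambda>x. \<phi> x i)"
  proof (cases "i < p")
    case False
    then have "\<forall>x\<in>W. \<phi> x i = 0" using \<phi> by (auto simp: topspace_Euclidean_space Pi_iff)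
    then show ?thesis using continuous_on_cong[of W W "\<lambda>x. \<phi> x i" "\<lambda>x. 0"] by simp
  qed (rule cont)
qed

text \<open>Product neighbourhoods give a width \<open>d i\<close> for each coordinate separately.
  One width serves for all, because points of \<open>Euclidean_space p\<close> can differ in the
  first p coordinates only.\<close>

lemma open_Euclidean_box:
  assumes "openin (Euclidean_space p) W" "x \<in> W"
  obtains e where "e > 0"
    "\<And>y. y \<in> topspace (Euclidean_space p) \<Longrightarrow> (\<forall>i<p. \<bar>y i - x i\<bar> < e) \<Longrightarrow> y \<in> W"
proof -
  obtain T where T: "openin (powertop_real UNIV) T" "W = T \<inter> {x. \<forall>i\<ge>p. x i = 0}"
    using assms by (auto simp: Euclidean_space_def openin_subtopology)
  with assms have "x \<in> T" by auto
  from product_topology_open_contains_basis[OF T(1) this]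
  obtain X where X: "x \<in> (\<Pi>\<^sub>E i\<in>UNIV. X i)" "\<And>i. open (X i)" "(\<Pi>\<^sub>E i\<in>UNIV. X i) \<subseteq> T"
    by (metis open_openin)
  have "\<exists>e>0. \<forall>t. \<bar>t - x i\<bar> < e \<longrightarrow> t \<in> X i" for i
    using X(1) X(2)[of i] openE[of "X i" "x i"]
    by (metis PiE_mem UNIV_I abs_minus_commute dist_real_def mem_ball subsetD)
  then obtain d where d: "\<And>i. d i > 0" "\<And>i t. \<bar>t - x i\<bar> < d i \<Longrightarrow> t \<in> X i" by metis
  \<comment> \<open>The inserted 1 keeps the minimum meaningful when p = 0.\<close>
  define e where "e = Min (insert 1 (d ` {..<p}))"
  show thesis
  proof
    show "e > 0" using d(1) by (auto simp: e_def)
    fix y assume y: "y \<in> topspace (Euclidean_space p)" "\<forall>i<p. \<bar>y i - x i\<bar> < e"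
    have "y i \<in> X i" for i
    proof (cases "i < p")
      case True
      then have "e \<le> d i" by (auto simp: e_def)
      with y(2) True show ?thesis by (intro d(2)) force
    next
      case False
      have "x i = 0" using assms(2) T(2) False by auto
      with False y(1) d(1)[of i] show ?thesis by (intro d(2)) (auto simp: topspace_Euclidean_space)
    qed
    with X(3) have "y \<in> T" by auto
    with y(1) T(2) show "y \<in> W" by (auto simp: topspace_Euclidean_space)
  qed
qed

lemma fun_upd_Euclidean:
  "x \<in> topspace (Euclidean_space p) \<Longrightarrow> i < p \<Longrightarrow> x(i := t) \<in> topspace (Euclidean_space p)"
  by (auto simp: topspace_Euclidean_space)

text \<open>Makes partial derivatives local: a small move of one coordinate stays in W, so functions
  that agree on W have the same partial derivatives there.\<close>

lemma eventually_fun_upd_open: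
  assumes "openin (Euclidean_space p) W" "x \<in> W" "i < p"
  shows "\<forall>\<^sub>F t in nhds (x i). x(i := t) \<in> W"
proof -
  obtain e where e: "e > 0"
    "\<And>y. y \<in> topspace (Euclidean_space p) \<Longrightarrow> (\<forall>i<p. \<bar>y i - x i\<bar> < e) \<Longrightarrow> y \<in> W"
    using open_Euclidean_box[OF assms(1,2)] by blast
  have x: "x \<in> topspace (Euclidean_space p)"
    using assms openin_subset by blast
  show ?thesis unfolding eventually_nhds_metric
  proof (intro exI[of _ e] conjI allI impI)
    fix t assume t: "dist t (x i) < e"
    show "x(i := t) \<in> W"
      using t e(1) by (intro e(2) fun_upd_Euclidean[OF x assms(3)]) (auto simp: dist_real_def)
  qed (use e in auto)
qed

lemma DERIV_cong_nhds:
  fixes f g :: "real \<Rightarrow> real"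
  assumes "(f has_field_derivative D) (at a)" "\<forall>\<^sub>F t in nhds a. f t = g t"
  shows "(g has_field_derivative D) (at a)"
  using assms DERIV_cong_ev[of a a f g D D] by simp

section \<open>Partial derivatives along coordinate lines\<close>

abbreviation partially_differentiable ::
  "nat \<Rightarrow> (nat \<Rightarrow> real) set \<Rightarrow> ((nat \<Rightarrow> real) \<Rightarrow> real) \<Rightarrow> bool" where
  "partially_differentiable p W f \<equiv>
     \<forall>x\<in>W. \<forall>i<p. (\<lambda>t. f (x(i := t))) differentiable (at (x i))"

lemma pderivativeI:
  "((\<lambda>t. f (x(i := t))) has_field_derivative D) (at (x i)) \<Longrightarrow> pderivative i f x = D"
  by (simp add: pderivative_def DERIV_imp_deriv)

lemma has_pderivative:
  "(\<lambda>t. f (x(i := t))) differentiable (at (x i)) \<Longrightarrow>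
     ((\<lambda>t. f (x(i := t))) has_field_derivative pderivative i f x) (at (x i))"
  by (simp add: pderivative_def DERIV_deriv_iff_real_differentiable)

lemma eventually_line_eq:
  assumes W: "openin (Euclidean_space p) W" and eq: "\<forall>y\<in>W. f y = g y"
    and x: "x \<in> W" "i < p"
  shows "\<forall>\<^sub>F t in nhds (x i). f (x(i := t)) = g (x(i := t))"
  using eventually_fun_upd_open[OF W x] by eventually_elim (use eq in auto)

lemma pderivative_cong_open:
  assumes "openin (Euclidean_space p) W" "\<forall>y\<in>W. f y = g y" "x \<in> W" "i < p"
  shows "pderivative i f x = pderivative i g x"
  unfolding pderivative_def
  using eventually_line_eq[OF assms] by (intro deriv_cong_ev) auto

lemma partially_differentiable_cong_open:
  fixes f g :: "(nat \<Rightarrow> real) \<Rightarrow> real"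
  assumes "openin (Euclidean_space p) W" "\<forall>y\<in>W. f y = g y" "x \<in> W" "i < p"
    and "(\<lambda>t. f (x(i := t))) differentiable (at (x i))"
  shows "(\<lambda>t. g (x(i := t))) differentiable (at (x i))"
  using assms(5) DERIV_cong_nhds[OF _ eventually_line_eq[OF assms(1-4)]]
  unfolding real_differentiable_def by blast

text \<open>C^k through partial derivatives. The lists of indices in \<open>smooth_on\<close> offer
  no convenient induction for the product and chain rules; an order k, with the function left
  arbitrary, does.\<close>

fun C_on :: "nat \<Rightarrow> (nat \<Rightarrow> real) set \<Rightarrow> nat \<Rightarrow> ((nat \<Rightarrow> real) \<Rightarrow> real) \<Rightarrow> bool" where
  "C_on p W 0 f \<longleftrightarrow> continuous_on W f"
| "C_on p W (Suc k) f \<longleftrightarrow> continuous_on W f \<and> partially_differentiable p W f \<and>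
     (\<forall>i<p. C_on p W k (pderivative i f))"

text \<open>The recursion of \<open>C_on\<close> removes the derivative applied first, which is the
  last entry of the list under \<open>foldr\<close>. One direction therefore extends lists at the
  end; the other treats all orders k at once and removes the outermost derivative.\<close>

lemma smooth_on_iff_C_on:
  assumes "W \<subseteq> topspace (Euclidean_space p)"
  shows "smooth_on p W f \<longleftrightarrow> (\<forall>k. C_on p W k f)"
proof
  have base: "continuous_on W f \<and> partially_differentiable p W f" if "smooth_on p W f" for f
    using that[unfolded smooth_on_def, rule_format, of "[]"]
    by (simp only: foldr.simps id_apply continuous_map_Euclidean[OF assms] list.set simp_thms empty_subsetI)
      blast
  have "smooth_on p W f \<Longrightarrow> C_on p W k f" for k
  proof (induction k arbitrary: f)
    case 0
    then show ?case using base by simp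
  next
    case (Suc k)
    have "smooth_on p W (pderivative i f)" if "i < p" for i
      unfolding smooth_on_def
    proof (intro allI impI)
      fix js assume "set js \<subseteq> {..<p}"
      with that Suc.prems[unfolded smooth_on_def, rule_format, of "js @ [i]"]
      show "continuous_map (subtopology (Euclidean_space p) W) euclideanreal
              (foldr pderivative js (pderivative i f)) \<and>
            partially_differentiable p W (foldr pderivative js (pderivative i f))"
        by simp
    qed
    then show ?case unfolding C_on.simps using base[OF Suc.prems] Suc.IH by blast
  qed
  then show "smooth_on p W f \<Longrightarrow> \<forall>k. C_on p W k f" by blast
next
  assume f: "\<forall>k. C_on p W k f"
  have "\<forall>k. C_on p W k (foldr pderivative js f)" if "set js \<subseteq> {..<p}" for js
    using that
  proof (induction js)
    case (Cons j js)
    then have "C_on p W (Suc k) (foldr pderivative js f)" for k by (simp del: C_on.simps)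
    then have "C_on p W k (pderivative j (foldr pderivative js f))" for k
      using Cons.prems C_on.simps(2) by (metis insert_subset lessThan_iff list.simps(15))
    then show ?case by simp
  qed (use f in auto)
  then have "C_on p W (Suc 0) (foldr pderivative js f)" if "set js \<subseteq> {..<p}" for js
    using that by blast
  then show "smooth_on p W f"
    unfolding smooth_on_def continuous_map_Euclidean[OF assms] C_on.simps by blast
qed

lemma C_on_continuous: "C_on p W k f \<Longrightarrow> continuous_on W f"
  by (cases k) auto

lemma C_on_Suc_imp: "C_on p W (Suc k) f \<Longrightarrow> C_on p W k f"
  by (induction k arbitrary: f) auto

text \<open>Outside W the two functions are unrelated, and so are their values of
  \<open>pderivative\<close>. The induction carries equality on W only; openness of W passes it on
  to the derivatives.\<close>

lemma C_on_cong:
  assumes W: "openin (Euclidean_space p) W"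
  shows "(\<And>x. x \<in> W \<Longrightarrow> f x = g x) \<Longrightarrow> C_on p W k f \<Longrightarrow> C_on p W k g"
proof (induction k arbitrary: f g)
  case 0
  then show ?case using continuous_on_cong[of W W f g] by auto
next
  case (Suc k)
  have "C_on p W k (pderivative i g)" if "i < p" for i
  proof (rule Suc.IH)
    show "pderivative i f x = pderivative i g x" if "x \<in> W" for x
      using Suc.prems(1) \<open>i < p\<close> that by (intro pderivative_cong_open[OF W]) auto
  qed (use Suc.prems(2) that in auto)
  moreover have "continuous_on W g"
    using Suc.prems continuous_on_cong[of W W f g] by auto
  moreover have "partially_differentiable p W g"
    using Suc.prems partially_differentiable_cong_open[OF W, of f g] by auto
  ultimately show ?case by auto
qed

text \<open>The derivatives may be given by any formulas valid on W; \<open>C_on_cong\<close>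
  replaces them by \<open>pderivative\<close>.\<close>

lemma C_on_SucI:
  assumes "openin (Euclidean_space p) W" "continuous_on W f"
    and "\<And>x i. x \<in> W \<Longrightarrow> i < p \<Longrightarrow> ((\<lambda>t. f (x(i := t))) has_field_derivative D i x) (at (x i))"
    and "\<And>i. i < p \<Longrightarrow> C_on p W k (D i)"
  shows "C_on p W (Suc k) f"
proof -
  have "partially_differentiable p W f"
    using assms(3) real_differentiable_def by blast
  moreover have "C_on p W k (pderivative i f)" if "i < p" for i
    by (rule C_on_cong[OF assms(1) _ assms(4)[OF that]]) (metis assms(3) pderivativeI that)
  ultimately show ?thesis using assms(2) by auto
qed

lemma C_on_SucD:
  assumes "C_on p W (Suc k) f"
  shows "continuous_on W f"
    and "x \<in> W \<Longrightarrow> i < p \<Longrightarrow> ((\<lambda>t. f (x(i := t))) has_field_derivative pderivative i f x) (at (x i))"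
    and "i < p \<Longrightarrow> C_on p W k (pderivative i f)"
  using assms by (auto intro: has_pderivative)

declare C_on.simps(2) [simp del]

section \<open>Sums, products, inverses and composites of C^k functions\<close>

lemma C_on_const: "openin (Euclidean_space p) W \<Longrightarrow> C_on p W k (\<lambda>x. c)"
  by (induction k arbitrary: c) (auto intro!: C_on_SucI[where D = "\<lambda>i x. 0"] derivative_eq_intros)

lemma C_on_add:
  assumes "openin (Euclidean_space p) W"
  shows "C_on p W k f \<Longrightarrow> C_on p W k g \<Longrightarrow> C_on p W k (\<lambda>x. f x + g x)"
proof (induction k arbitrary: f g)
  case (Suc k)
  note f = C_on_SucD[OF Suc.prems(1)] and g = C_on_SucD[OF Suc.prems(2)]
  show ?case
  proof (rule C_on_SucI[OF assms, where D = "\<lambda>i x. pderivative i f x + pderivative i g x"])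
    show "((\<lambda>t. f (x(i := t)) + g (x(i := t))) has_field_derivative
        pderivative i f x + pderivative i g x) (at (x i))" if "x \<in> W" "i < p" for x i
      by (rule DERIV_add[OF f(2) g(2)]) (use that in simp_all)
  qed (use f(1,3) g(1,3) Suc.IH in \<open>auto intro!: continuous_intros\<close>)
qed (auto intro: continuous_intros)

lemma C_on_mult:
  assumes "openin (Euclidean_space p) W"
  shows "C_on p W k f \<Longrightarrow> C_on p W k g \<Longrightarrow> C_on p W k (\<lambda>x. f x * g x)"
proof (induction k arbitrary: f g)
  case (Suc k)
  note f = C_on_SucD[OF Suc.prems(1)] and g = C_on_SucD[OF Suc.prems(2)]
  \<comment> \<open>The derivative of the product contains f and g themselves, which must therefore
    be available at order k as well.\<close>
  note f' = C_on_Suc_imp[OF Suc.prems(1)] and g' = C_on_Suc_imp[OF Suc.prems(2)]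
  show ?case
  proof (rule C_on_SucI[OF assms, where D = "\<lambda>i x. pderivative i f x * g x + f x * pderivative i g x"])
    fix x i assume "x \<in> W" "i < p"
    then show "((\<lambda>t. f (x(i := t)) * g (x(i := t))) has_field_derivative
        pderivative i f x * g x + f x * pderivative i g x) (at (x i))"
      by (intro DERIV_cong[OF DERIV_mult[OF f(2) g(2)]]) simp_all
  qed (use f(1,3) g(1,3) f' g' Suc.IH C_on_add[OF assms] in \<open>auto intro!: continuous_intros\<close>)
qed (auto intro: continuous_intros)

text \<open>The derivative of 1/f is a polynomial in 1/f and the derivative of f, so the induction
  hypothesis for 1/f itself is what is needed.\<close>

lemma C_on_inverse:
  assumes "openin (Euclidean_space p) W" "\<And>x. x \<in> W \<Longrightarrow> f x \<noteq> 0"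
  shows "C_on p W k f \<Longrightarrow> C_on p W k (\<lambda>x. inverse (f x))"
proof (induction k)
  case (Suc k)
  note f = C_on_SucD[OF Suc.prems]
  have inv: "C_on p W k (\<lambda>x. inverse (f x))"
    using Suc C_on_Suc_imp by blast
  show ?case
  proof (rule C_on_SucI[OF assms(1), where
        D = "\<lambda>i x. (- 1) * (pderivative i f x * (inverse (f x) * inverse (f x)))"])
    show "((\<lambda>t. inverse (f (x(i := t)))) has_field_derivative
        (- 1) * (pderivative i f x * (inverse (f x) * inverse (f x)))) (at (x i))"
      if "x \<in> W" "i < p" for x i
      using that by (intro DERIV_cong[OF DERIV_inverse'[OF f(2)]]) (simp_all add: assms(2))
    show "C_on p W k (\<lambda>x. (- 1) * (pderivative i f x * (inverse (f x) * inverse (f x))))"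
      if "i < p" for i
      using that by (intro C_on_mult C_on_const assms(1) f(3) inv)
  qed (use f(1) assms(2) in \<open>auto intro!: continuous_intros\<close>)
qed (use assms in \<open>auto intro: continuous_intros\<close>)

lemma C_on_sum:
  assumes "openin (Euclidean_space p) W" "\<And>j. j \<in> J \<Longrightarrow> C_on p W k (f j)"
  shows "C_on p W k (\<lambda>x. \<Sum>j\<in>J. f j x)"
  using assms(2) by (induction J rule: infinite_finite_induct)
    (auto intro: C_on_const[OF assms(1)] C_on_add[OF assms(1)])

text \<open>The coordinates of \<gamma> are moved one at a time, and the mean value theorem turns
  each move into one summand. The intermediate points are close to \<gamma> t0, where continuity of
  \<open>G k\<close> gives the limit.\<close>

lemma chain_rule_line:
  assumes W: "openin (Euclidean_space p) W"
    and g: "\<And>y j. y \<in> W \<Longrightarrow> j < p \<Longrightarrow>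
        ((\<lambda>t. g (y(j := t))) has_field_derivative G j y) (at (y j))"
    and cont: "\<And>j. j < p \<Longrightarrow> continuous_on W (G j)"
    and \<gamma>: "\<gamma> t0 \<in> W" "\<And>t. \<gamma> t \<in> topspace (Euclidean_space p)"
    and \<gamma>': "\<And>j. j < p \<Longrightarrow> ((\<lambda>t. \<gamma> t j) has_field_derivative d j) (at t0)"
  shows "((\<lambda>t. g (\<gamma> t)) has_field_derivative (\<Sum>j<p. G j (\<gamma> t0) * d j)) (at t0)"
proof -
  \<comment> \<open>Intermediate points: the first k coordinates at time t, the others still at time
    t0.\<close>
  define h where "h k t = (\<lambda>j. if j < k then \<gamma> t j else \<gamma> t0 j)" for k t
  have top: "h k t \<in> topspace (Euclidean_space p)" for k t
    using \<gamma>(2) by (auto simp: h_def topspace_Euclidean_space)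
  have "((\<lambda>t. g (h k t)) has_field_derivative (\<Sum>j<k. G j (\<gamma> t0) * d j)) (at t0)" if "k \<le> p" for k
    using that
  proof (induction k)
    case 0
    then show ?case by (simp add: h_def)
  next
    case (Suc k)
    then have k: "k < p" by simp
    \<comment> \<open>The difference quotient of g in coordinate k, completed by its expected limit
      where that coordinate has not moved. The factorization \<open>split\<close> then holds for
      every t, without a division by zero.\<close>
    define D where "D t = (if \<gamma> t k = \<gamma> t0 k then G k (\<gamma> t0)
      else (g (h (Suc k) t) - g (h k t)) / (\<gamma> t k - \<gamma> t0 k))" for t
    have h_Suc: "h (Suc k) t = (h k t)(k := \<gamma> t k)" "h k t = (h k t)(k := \<gamma> t0 k)" for t
      by (auto simp: h_def fun_eq_iff)
    have split: "g (h (Suc k) t) = g (h k t) + D t * (\<gamma> t k - \<gamma> t0 k)" for t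
      using h_Suc[of t] by (auto simp: D_def)
    have "(D \<longlongrightarrow> G k (\<gamma> t0)) (at t0)"
    proof (rule tendstoI)
      fix r :: real assume r: "r > 0"
      have "openin (top_of_set W) {y \<in> W. G k y \<in> ball (G k (\<gamma> t0)) r}"
        using continuous_openin_preimage_gen[OF cont[OF k], of "ball (G k (\<gamma> t0)) r"]
        by (simp add: vimage_def Int_def)
      moreover have "subtopology (Euclidean_space p) W = top_of_set W"
        by (rule subtopology_Euclidean[OF openin_subset[OF W]])
      ultimately have "openin (Euclidean_space p) {y \<in> W. G k y \<in> ball (G k (\<gamma> t0)) r}"
        using openin_trans_full[OF _ W] by metis
      then obtain e where e: "e > 0" "\<And>y. y \<in> topspace (Euclidean_space p) \<Longrightarrow>
          (\<forall>i<p. \<bar>y i - \<gamma> t0 i\<bar> < e) \<Longrightarrow> y \<in> W \<and> \<bar>G k y - G k (\<gamma> t0)\<bar> < r"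
        using open_Euclidean_box[of p "{y \<in> W. G k y \<in> ball (G k (\<gamma> t0)) r}" "\<gamma> t0"] \<gamma>(1) r
        by (auto simp: dist_real_def abs_minus_commute)
      have "\<forall>\<^sub>F t in at t0. \<bar>\<gamma> t j - \<gamma> t0 j\<bar> < e" if "j < p" for j
        using DERIV_isCont[OF \<gamma>'[OF that]] e(1)
        by (auto simp: isCont_def tendsto_iff dist_real_def)
      then have "\<forall>\<^sub>F t in at t0. \<forall>j\<in>{..<p}. \<bar>\<gamma> t j - \<gamma> t0 j\<bar> < e"
        by (intro eventually_ball_finite) auto
      then show "\<forall>\<^sub>F t in at t0. dist (D t) (G k (\<gamma> t0)) < r"
      proof eventually_elim
        case (elim t)
        \<comment> \<open>The mean value theorem wants ordered endpoints, while the coordinate may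
          have moved either way.\<close>
        define a b where "a = min (\<gamma> t0 k) (\<gamma> t k)" and "b = max (\<gamma> t0 k) (\<gamma> t k)"
        show ?case
        proof (cases "\<gamma> t k = \<gamma> t0 k")
          case False
          have near: "(h k t)(k := s) \<in> W \<and> \<bar>G k ((h k t)(k := s)) - G k (\<gamma> t0)\<bar> < r"
            if "a \<le> s" "s \<le> b" for s
          proof (rule e(2))
            show "(h k t)(k := s) \<in> topspace (Euclidean_space p)"
              by (intro fun_upd_Euclidean top k)
            show "\<forall>i<p. \<bar>((h k t)(k := s)) i - \<gamma> t0 i\<bar> < e"
              using elim k that e(1) by (auto simp: h_def a_def b_def min_def max_def split: if_splits)
                force+
          qed
          have "((\<lambda>s. g ((h k t)(k := s))) has_field_derivative G k ((h k t)(k := s))) (at s)"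
            if "a \<le> s" "s \<le> b" for s
            using g[OF conjunct1[OF near[OF that]] k] by simp
          moreover have "a < b" using False by (auto simp: a_def b_def)
          ultimately obtain s where s: "a < s" "s < b"
            "g ((h k t)(k := b)) - g ((h k t)(k := a)) = (b - a) * G k ((h k t)(k := s))"
            using MVT2[of a b "\<lambda>s. g ((h k t)(k := s))" "\<lambda>s. G k ((h k t)(k := s))"] by auto
          then have "g (h (Suc k) t) - g (h k t) = (\<gamma> t k - \<gamma> t0 k) * G k ((h k t)(k := s))"
            using h_Suc[of t] by (auto simp: a_def b_def min_def max_def algebra_simps split: if_splits)
          then have "D t = G k ((h k t)(k := s))" using False by (simp add: D_def)
          with near[of s] s show ?thesis by (simp add: dist_real_def)
        qed (use r in \<open>simp add: D_def\<close>)
      qed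
    qed
    moreover have "((\<lambda>t. (\<gamma> t k - \<gamma> t0 k) / (t - t0)) \<longlongrightarrow> d k) (at t0)"
      using \<gamma>'[OF k] by (simp add: has_field_derivative_iff)
    \<comment> \<open>The subtracted product is zero; it gives the expression the shape of a
      difference quotient at t0.\<close>
    ultimately have "((\<lambda>t. (D t * (\<gamma> t k - \<gamma> t0 k) - D t0 * (\<gamma> t0 k - \<gamma> t0 k)) / (t - t0))
        \<longlongrightarrow> G k (\<gamma> t0) * d k) (at t0)"
      using tendsto_mult by fastforce
    then have "((\<lambda>t. D t * (\<gamma> t k - \<gamma> t0 k)) has_field_derivative G k (\<gamma> t0) * d k) (at t0)"
      by (simp add: has_field_derivative_iff)
    with Suc k show ?case unfolding split by (auto intro: derivative_eq_intros)
  qed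
  moreover have "h p t = \<gamma> t" for t
    using \<gamma>(2)[of t] \<gamma>(2)[of t0] by (auto simp: h_def fun_eq_iff topspace_Euclidean_space)
  ultimately show ?thesis by force
qed

text \<open>By the chain rule the derivatives of the composite consist of
  \<open>pderivative j g\<close> composed with \<phi>, to which the induction applies, and of
  derivatives of \<phi>, which is smooth to all orders.\<close>

lemma C_on_compose:
  assumes W: "openin (Euclidean_space p) W" and W': "openin (Euclidean_space p) W'"
    and \<phi>: "\<phi> \<in> W \<rightarrow> W'" and sm: "\<And>j k. j < p \<Longrightarrow> C_on p W k (\<lambda>x. \<phi> x j)"
  shows "C_on p W' k g \<Longrightarrow> C_on p W k (\<lambda>x. g (\<phi> x))"
proof -
  have top: "\<phi> x \<in> topspace (Euclidean_space p)" if "x \<in> W" for x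
    using \<phi> that openin_subset[OF W'] by auto
  have cont: "continuous_on W \<phi>"
    using top C_on_continuous[OF sm] by (intro continuous_on_coordinates[of \<phi> W p]) auto
  have cont_comp: "continuous_on W (\<lambda>x. g (\<phi> x))" if "continuous_on W' g" for g :: "_ \<Rightarrow> real"
    using continuous_on_compose2[OF that cont] \<phi> by blast
  show "C_on p W' k g \<Longrightarrow> C_on p W k (\<lambda>x. g (\<phi> x))"
  proof (induction k arbitrary: g)
    case (Suc k)
    note g = C_on_SucD[OF Suc.prems]
    show ?case
    proof (rule C_on_SucI[OF W, where
          D = "\<lambda>i x. \<Sum>j<p. pderivative j g (\<phi> x) * pderivative i (\<lambda>x. \<phi> x j) x"])
      show "continuous_on W (\<lambda>x. g (\<phi> x))" using g(1) by (rule cont_comp)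
      show "C_on p W k (\<lambda>x. \<Sum>j<p. pderivative j g (\<phi> x) * pderivative i (\<lambda>x. \<phi> x j) x)"
        if "i < p" for i
        using that Suc.IH[OF g(3)] C_on_SucD(3)[OF sm] by (intro C_on_sum C_on_mult W) auto
      fix x i assume x: "x \<in> W" "i < p"
      \<comment> \<open>\<open>chain_rule_line\<close> asks for a curve that remains in
        \<open>Euclidean_space p\<close> at all times. Where the line has left W, the curve is
        therefore set to the constant \<phi> x, which changes nothing near
        \<open>x i\<close>.\<close>
      define \<gamma> where "\<gamma> t = (if x(i := t) \<in> W then \<phi> (x(i := t)) else \<phi> x)" for t
      have ev: "\<forall>\<^sub>F t in nhds (x i). \<gamma> t = \<phi> (x(i := t))"
        using eventually_fun_upd_open[OF W x] by eventually_elim (simp add: \<gamma>_def)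
      have "((\<lambda>t. g (\<gamma> t)) has_field_derivative
          (\<Sum>j<p. pderivative j g (\<gamma> (x i)) * pderivative i (\<lambda>x. \<phi> x j) x)) (at (x i))"
      proof (rule chain_rule_line[OF W' g(2)])
        show "continuous_on W' (pderivative j g)" if "j < p" for j
          using C_on_continuous g(3) that by blast
        show "\<gamma> (x i) \<in> W'" using \<phi> x by (auto simp: \<gamma>_def)
        show "\<gamma> t \<in> topspace (Euclidean_space p)" for t
          using top x by (simp add: \<gamma>_def)
        fix j assume "j < p"
        then have "((\<lambda>t. \<phi> (x(i := t)) j) has_field_derivative pderivative i (\<lambda>x. \<phi> x j) x) (at (x i))"
          using C_on_SucD(2)[OF sm x] by blast
        moreover have "\<forall>\<^sub>F t in nhds (x i). \<gamma> t j = \<phi> (x(i := t)) j"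
          using ev by eventually_elim simp
        ultimately show "((\<lambda>t. \<gamma> t j) has_field_derivative pderivative i (\<lambda>x. \<phi> x j) x) (at (x i))"
          using DERIV_cong_nhds[where f = "\<lambda>t. \<phi> (x(i := t)) j" and g = "\<lambda>t. \<gamma> t j"]
          by (simp add: eq_commute)
      qed auto
      moreover have "\<forall>\<^sub>F t in nhds (x i). g (\<gamma> t) = g (\<phi> (x(i := t)))"
        using ev by eventually_elim simp
      moreover have "\<gamma> (x i) = \<phi> x" using x by (simp add: \<gamma>_def)
      ultimately show "((\<lambda>t. g (\<phi> (x(i := t)))) has_field_derivative
          (\<Sum>j<p. pderivative j g (\<phi> x) * pderivative i (\<lambda>x. \<phi> x j) x)) (at (x i))"
        using DERIV_cong_nhds[where f = "\<lambda>t. g (\<gamma> t)" and g = "\<lambda>t. g (\<phi> (x(i := t)))"] by force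
    qed
  qed (use cont_comp in auto)
qed

text \<open>Serves the gluing of sections. Only continuity needs an argument: V is the trace of an
  open set of the ambient space, so limits at its points within the union and within V
  agree.\<close>

lemma C_on_local:
  assumes "\<And>V. V \<in> \<V> \<Longrightarrow> openin (Euclidean_space p) V"
  shows "(\<And>V. V \<in> \<V> \<Longrightarrow> C_on p V k f) \<Longrightarrow> C_on p (\<Union>\<V>) k f"
proof -
  have cont: "continuous_on (\<Union>\<V>) g" if g: "\<And>V. V \<in> \<V> \<Longrightarrow> continuous_on V g" for g :: "_ \<Rightarrow> real"
    unfolding continuous_on_eq_continuous_within
  proof
    fix x assume "x \<in> \<Union>\<V>"
    then obtain V where V: "V \<in> \<V>" "x \<in> V" by blast
    obtain T where T: "open T" "V = T \<inter> topspace (Euclidean_space p)"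
      using assms[OF V(1)] by (subst (asm) Euclidean_space_eq) (auto simp: openin_open)
    have "\<Union>\<V> \<subseteq> topspace (Euclidean_space p)"
      using assms openin_subset by blast
    then have "at x within \<Union>\<V> = at x within V"
      using T V by (intro at_within_nhd[of x T]) auto
    moreover have "continuous (at x within V) g"
      using g[OF V(1)] V(2) by (simp add: continuous_on_eq_continuous_within)
    ultimately show "continuous (at x within \<Union>\<V>) g"
      by (simp add: continuous_within)
  qed
  show "(\<And>V. V \<in> \<V> \<Longrightarrow> C_on p V k f) \<Longrightarrow> C_on p (\<Union>\<V>) k f"
  proof (induction k arbitrary: f)
    case (Suc k)
    then show ?case using cont[of f] unfolding C_on.simps by blast
  qed (use cont in auto)
qed

lemma C_on_subset: "C_on p W k f \<Longrightarrow> V \<subseteq> W \<Longrightarrow> C_on p V k f"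
  by (induction k arbitrary: f) (auto simp: C_on.simps intro: continuous_on_subset)

section \<open>Smooth functions on a fixed open set\<close>

context
  fixes p :: nat and W :: "(nat \<Rightarrow> real) set"
  assumes W: "openin (Euclidean_space p) W"
begin

lemma smooth_on_iff: "smooth_on p W f \<longleftrightarrow> (\<forall>k. C_on p W k f)"
  using smooth_on_iff_C_on[OF openin_subset[OF W]] .

lemma smooth_on_const: "smooth_on p W (\<lambda>x. c)"
  by (simp add: smooth_on_iff C_on_const[OF W])

lemma smooth_on_add: "smooth_on p W f \<Longrightarrow> smooth_on p W g \<Longrightarrow> smooth_on p W (\<lambda>x. f x + g x)"
  by (simp add: smooth_on_iff C_on_add[OF W])

lemma smooth_on_mult: "smooth_on p W f \<Longrightarrow> smooth_on p W g \<Longrightarrow> smooth_on p W (\<lambda>x. f x * g x)"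
  by (simp add: smooth_on_iff C_on_mult[OF W])

lemma smooth_on_inverse:
  "smooth_on p W f \<Longrightarrow> (\<And>x. x \<in> W \<Longrightarrow> f x \<noteq> 0) \<Longrightarrow> smooth_on p W (\<lambda>x. inverse (f x))"
  by (simp add: smooth_on_iff C_on_inverse[OF W])

lemma smooth_on_sum:
  "(\<And>j. j \<in> J \<Longrightarrow> smooth_on p W (f j)) \<Longrightarrow> smooth_on p W (\<lambda>x. \<Sum>j\<in>J. f j x)"
  by (simp add: smooth_on_iff C_on_sum[OF W])

lemma smooth_on_cong:
  assumes "smooth_on p W f" "\<And>x. x \<in> W \<Longrightarrow> f x = g x"
  shows "smooth_on p W g"
  using assms C_on_cong[OF W, of f g] by (simp add: smooth_on_iff)

lemma smooth_on_continuous: "smooth_on p W f \<Longrightarrow> continuous_on W f"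
  using C_on_continuous smooth_on_iff by blast

lemma smooth_on_compose:
  assumes W': "openin (Euclidean_space p) W'" and \<phi>: "\<phi> \<in> W \<rightarrow> W'"
    and "\<And>j. j < p \<Longrightarrow> smooth_on p W (\<lambda>x. \<phi> x j)" and "smooth_on p W' g"
  shows "smooth_on p W (\<lambda>x. g (\<phi> x))"
proof -
  have "C_on p W k (\<lambda>x. g (\<phi> x))" for k
    by (rule C_on_compose[OF W W' \<phi>])
      (use assms(3,4) in \<open>auto simp: smooth_on_iff smooth_on_iff_C_on[OF openin_subset[OF W']]\<close>)
  then show ?thesis by (simp add: smooth_on_iff)
qed

lemma smooth_on_subset:
  assumes "smooth_on p W f" and V: "openin (Euclidean_space p) V" "V \<subseteq> W"
  shows "smooth_on p V f"
  using assms(1) C_on_subset[OF _ V(2)] by (simp add: smooth_on_iff smooth_on_iff_C_on[OF openin_subset[OF V(1)]])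

end

lemma smooth_on_local:
  assumes \<V>: "\<And>V. V \<in> \<V> \<Longrightarrow> openin (Euclidean_space p) V"
    and sm: "\<And>V. V \<in> \<V> \<Longrightarrow> smooth_on p V f"
  shows "smooth_on p (\<Union>\<V>) f"
proof -
  have "C_on p (\<Union>\<V>) k f" for k
    using sm smooth_on_iff[OF \<V>] by (intro C_on_local \<V>) auto
  moreover have "openin (Euclidean_space p) (\<Union>\<V>)" using \<V> by blast
  ultimately show ?thesis by (simp add: smooth_on_iff)
qed


section \<open>Signs\<close>

lemma pairing_add_left: "pairing (i + j) k = pairing i k + pairing j k"
  unfolding pairing_def by (simp only: vector_add_component distrib_right sum.distrib)

lemma pairing_commute: "pairing i j = pairing j i"
  unfolding pairing_def by (simp only: mult.commute)

lemma comm_sign_commute: "comm_sign i j = comm_sign j i"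
  by (simp add: comm_sign_def pairing_commute)

lemma comm_sign_square [simp]: "comm_sign i j * comm_sign i j = 1"
  by (simp add: comm_sign_def)

lemma comm_sign_add_left: "comm_sign (i + j) k = comm_sign i k * comm_sign j k"
  by (cases "pairing i k"; cases "pairing j k") (simp_all add: comm_sign_def pairing_add_left)

lemma comm_sign_0_left [simp]: "comm_sign 0 k = 1"
  by (simp add: comm_sign_def pairing_def)

lemma comm_sign_of_nat_left: "comm_sign (of_nat m *s i) k = comm_sign i k ^ m"
proof (induction m)
  case (Suc m)
  have "of_nat (Suc m) *s i = i + of_nat m *s i"
    by (simp only: of_nat_Suc vector_sadd_rdistrib vector_smult_lid)
  with Suc show ?case by (simp only: comm_sign_add_left power_Suc)
qed simp

lemma comm_sign_sum_left: "comm_sign (\<Sum>a\<in>A. f a) k = (\<Prod>a\<in>A. comm_sign (f a) k)"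
  by (induction A rule: infinite_finite_induct) (simp_all add: comm_sign_add_left)

lemma comm_sign_sum_right: "comm_sign k (\<Sum>a\<in>A. f a) = (\<Prod>a\<in>A. comm_sign k (f a))"
  by (simp add: comm_sign_commute[of k] comm_sign_sum_left)

lemma comm_sign_of_nat_right: "comm_sign k (of_nat m *s i) = comm_sign k i ^ m"
  by (simp add: comm_sign_commute[of k] comm_sign_of_nat_left)

text \<open>Moving one monomial past another involves all pairs of variables, whereas the reordering
  signs of the two products involve the pairs with b < a and those with a < b. The diagonal is what
  remains to be compared.\<close>

lemma prod_square_eq_triangles:
  fixes t :: "nat \<Rightarrow> nat \<Rightarrow> 'a::comm_monoid_mult"
  shows "(\<Prod>a<q. \<Prod>b<q. t a b) =
    (\<Prod>a<q. \<Prod>b<a. t a b) * (\<Prod>a<q. t a a) * (\<Prod>a<q. \<Prod>b<a. t b a)"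
  by (induction q) (simp_all add: prod.distrib ac_simps)


section \<open>Ordered products\<close>

lemma ordered_product_Nil [simp]: "ordered_product A [] = \<one>\<^bsub>A\<^esub>"
  and ordered_product_Cons [simp]: "ordered_product A (s # ss) = s \<otimes>\<^bsub>A\<^esub> ordered_product A ss"
  by (simp_all add: ordered_product_def)

lemma (in monoid) ordered_product_closed:
  "set ss \<subseteq> carrier G \<Longrightarrow> ordered_product G ss \<in> carrier G"
  by (induction ss) auto

text \<open>\<open>ordered_product\<close> recurses at the head of the list, but products over
  \<open>[0..<k]\<close> grow at the end.\<close>

lemma (in monoid) ordered_product_snoc:
  assumes "set ss \<subseteq> carrier G" "s \<in> carrier G"
  shows "ordered_product G (ss @ [s]) = ordered_product G ss \<otimes> s"
  using assms(1) by (induction ss) (auto simp: assms(2) m_assoc ordered_product_closed)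

lemma ring_hom_nat_pow:
  fixes n :: nat
  assumes "ring R" "h \<in> ring_hom R S" "x \<in> carrier R"
  shows "h (x [^]\<^bsub>R\<^esub> n) = h x [^]\<^bsub>S\<^esub> n"
proof -
  interpret R: ring R by fact
  show ?thesis
    using assms by (induction n) (auto simp: ring_hom_one ring_hom_mult)
qed

lemma ring_hom_ordered_product:
  assumes "ring R" "h \<in> ring_hom R S" "set ss \<subseteq> carrier R"
  shows "h (ordered_product R ss) = ordered_product S (map h ss)"
proof -
  interpret R: ring R by fact
  show ?thesis using assms(3)
    by (induction ss)
      (auto simp: ring_hom_one[OF assms(2)] ring_hom_mult[OF assms(2)] R.ordered_product_closed)
qed


section \<open>Formal power series over the reals\<close>

locale graded_variables =
  fixes q :: nat and deg :: "nat \<Rightarrow> bit ^ 'n::finite"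
begin

abbreviation "Exps \<equiv> exponents q deg"
abbreviation "dg \<equiv> monomial_degree q deg"
abbreviation "sg \<equiv> monomial_sign q deg"
abbreviation sz :: "(nat \<Rightarrow> nat) \<Rightarrow> nat" where "sz \<mu> \<equiv> \<Sum>a<q. \<mu> a"

section \<open>Exponents, their degrees and the reordering sign\<close>

lemma zero_exponents [simp]: "(\<lambda>_. 0) \<in> Exps"
  by (simp add: exponents_def)

lemma exponents_le: "\<mu> \<in> Exps \<Longrightarrow> \<nu> \<le> \<mu> \<Longrightarrow> \<nu> \<in> Exps"
  unfolding exponents_def le_fun_def by (auto intro: order_trans) (metis le_zero_eq)

lemma exponents_diff: "\<mu> \<in> Exps \<Longrightarrow> (\<lambda>a. \<mu> a - \<nu> a) \<in> Exps"
  by (erule exponents_le) (simp add: le_fun_def)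

lemma exponents_add_left: "(\<lambda>a. \<mu> a + \<nu> a) \<in> Exps \<Longrightarrow> \<mu> \<in> Exps"
  by (erule exponents_le) (simp add: le_fun_def)

lemma finite_le_exponent:
  assumes \<mu>: "\<mu> \<in> Exps"
  shows "finite {\<nu>. \<nu> \<le> \<mu>}"
proof (rule finite_subset)
  show "{\<nu>. \<nu> \<le> \<mu>} \<subseteq> {\<nu>. \<forall>a. (a \<in> {..<q} \<longrightarrow> \<nu> a \<in> {..Max (\<mu> ` {..<q})}) \<and> (a \<notin> {..<q} \<longrightarrow> \<nu> a = 0)}"
  proof (intro subsetI CollectI allI conjI impI)
    fix \<nu> a assume "\<nu> \<in> {\<nu>. \<nu> \<le> \<mu>}"
    then have \<nu>: "\<nu> \<le> \<mu>" by simp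
    show "\<nu> a \<in> {..Max (\<mu> ` {..<q})}" if "a \<in> {..<q}"
      using order_trans[OF le_funD[OF \<nu>] Max_ge] that by auto
    show "\<nu> a = 0" if "a \<notin> {..<q}"
      using le_funD[OF \<nu>, of a] that \<mu> by (auto simp: exponents_def)
  qed
qed (intro finite_set_of_finite_funs; simp)

text \<open>The index set of the sum in \<open>substitute\<close>. A variable with even self-pairing
  has unbounded exponents, so \<open>Exps\<close> itself may be infinite.\<close>

definition Exps_upto :: "nat \<Rightarrow> (nat \<Rightarrow> nat) set" where
  "Exps_upto N = {\<mu> \<in> Exps. sz \<mu> \<le> N}"

lemma finite_Exps_upto [simp]: "finite (Exps_upto N)"
proof (rule finite_subset)
  show "Exps_upto N \<subseteq> {\<mu>. \<forall>a. (a \<in> {..<q} \<longrightarrow> \<mu> a \<in> {..N}) \<and> (a \<notin> {..<q} \<longrightarrow> \<mu> a = 0)}"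
  proof (intro subsetI CollectI allI conjI impI)
    fix \<mu> a assume \<mu>: "\<mu> \<in> Exps_upto N"
    show "\<mu> a \<in> {..N}" if "a \<in> {..<q}"
      using \<mu> member_le_sum[of a "{..<q}" \<mu>] that by (simp add: Exps_upto_def)
    show "\<mu> a = 0" if "a \<notin> {..<q}"
      using \<mu> that by (simp add: Exps_upto_def exponents_def)
  qed
qed (intro finite_set_of_finite_funs; simp)

lemma monomial_degree_add: "dg (\<lambda>a. \<mu> a + \<nu> a) = dg \<mu> + dg \<nu>"
  unfolding monomial_degree_def by (simp only: of_nat_add vector_sadd_rdistrib sum.distrib)

lemma monomial_degree_zero [simp]: "dg (\<lambda>_. 0) = 0"
  by (simp add: monomial_degree_def)

lemma monomial_sign_add_left: "sg (\<lambda>a. \<mu> a + \<mu>' a) \<nu> = sg \<mu> \<nu> * sg \<mu>' \<nu>"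
  by (simp add: monomial_sign_def distrib_right power_add prod.distrib)

lemma monomial_sign_add_right: "sg \<mu> (\<lambda>a. \<nu> a + \<nu>' a) = sg \<mu> \<nu> * sg \<mu> \<nu>'"
  by (simp add: monomial_sign_def distrib_left power_add prod.distrib)

lemma monomial_sign_zero [simp]: "sg (\<lambda>_. 0) \<nu> = 1" "sg \<nu> (\<lambda>_. 0) = 1"
  by (simp_all add: monomial_sign_def)

lemma monomial_sign_square [simp]: "sg \<mu> \<nu> * sg \<mu> \<nu> = 1"
  by (simp add: monomial_sign_def prod.distrib[symmetric] power_mult_distrib[symmetric])

text \<open>The sign between the degrees is a product over all pairs of variables. Its two triangles
  are the signs of the two products, and its diagonal is trivial.\<close>

lemma monomial_sign_commute:
  assumes "(\<lambda>a. \<mu> a + \<nu> a) \<in> Exps"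
  shows "sg \<mu> \<nu> = comm_sign (dg \<mu>) (dg \<nu>) * sg \<nu> \<mu>"
proof -
  define t where "t a b = comm_sign (deg a) (deg b) ^ (\<mu> a * \<nu> b)" for a b
  \<comment> \<open>A variable with odd self-pairing occurs at most once in the product, hence in at
    most one of the two factors.\<close>
  have diag: "t a a = 1" if "a < q" for a
  proof (cases "pairing (deg a) (deg a) = 1")
    case True
    then have "\<mu> a + \<nu> a \<le> 1" using assms that by (auto simp: exponents_def)
    then have "\<mu> a = 0 \<or> \<nu> a = 0" by linarith
    then show ?thesis by (auto simp: t_def)
  qed (simp add: t_def comm_sign_def)
  have "comm_sign (dg \<mu>) (dg \<nu>) = (\<Prod>a<q. \<Prod>b<q. t a b)"
    unfolding monomial_degree_def comm_sign_sum_left[where f = "\<lambda>a. of_nat (\<mu> a) *s deg a"]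
    by (simp only: comm_sign_sum_right comm_sign_of_nat_left comm_sign_of_nat_right t_def
        power_mult[symmetric] mult.commute[of "\<nu> _"])
  also have "\<dots> = sg \<mu> \<nu> * (\<Prod>a<q. t a a) * sg \<nu> \<mu>"
    unfolding prod_square_eq_triangles
    by (simp add: monomial_sign_def t_def comm_sign_commute mult.commute)
  also have "\<dots> = sg \<mu> \<nu> * sg \<nu> \<mu>" using diag by simp
  finally show ?thesis by (simp add: mult.assoc)
qed

text \<open>The values of sections at one point. Only the ring is recorded: scalars are handled by
  lemmas on linear combinations, degrees by \<open>homogeneous\<close>.\<close>

definition real_series :: "((nat \<Rightarrow> nat) \<Rightarrow> real) ring" where
  "real_series =
     \<lparr>carrier = {f. \<forall>\<mu>. \<mu> \<notin> Exps \<longrightarrow> f \<mu> = 0},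
      mult = (\<lambda>f g \<mu>. if \<mu> \<in> Exps
        then \<Sum>\<nu> | \<nu> \<le> \<mu>. sg \<nu> (\<lambda>a. \<mu> a - \<nu> a) * f \<nu> * g (\<lambda>a. \<mu> a - \<nu> a) else 0),
      one = (\<lambda>\<mu>. if \<mu> = (\<lambda>_. 0) then 1 else 0),
      zero = (\<lambda>\<mu>. 0),
      add = (\<lambda>f g \<mu>. f \<mu> + g \<mu>)\<rparr>"

abbreviation "R \<equiv> real_series"

abbreviation mult_R (infixl "\<odot>" 70) where "f \<odot> g \<equiv> f \<otimes>\<^bsub>R\<^esub> g"

lemma carrier_real_series: "f \<in> carrier R \<longleftrightarrow> (\<forall>\<mu>. \<mu> \<notin> Exps \<longrightarrow> f \<mu> = 0)"
  and mult_real_series: "(f \<odot> g) \<mu> = (if \<mu> \<in> Exps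
      then \<Sum>\<nu> | \<nu> \<le> \<mu>. sg \<nu> (\<lambda>a. \<mu> a - \<nu> a) * f \<nu> * g (\<lambda>a. \<mu> a - \<nu> a) else 0)"
  and one_real_series: "\<one>\<^bsub>R\<^esub> = (\<lambda>\<mu>. if \<mu> = (\<lambda>_. 0) then 1 else 0)"
  and zero_real_series: "\<zero>\<^bsub>R\<^esub> = (\<lambda>\<mu>. 0)"
  and add_real_series: "f \<oplus>\<^bsub>R\<^esub> g = (\<lambda>\<mu>. f \<mu> + g \<mu>)"
  by (simp_all add: real_series_def)

lemma mult_real_series_closed: "f \<odot> g \<in> carrier R"
  by (simp add: carrier_real_series mult_real_series)

text \<open>Both sides run over the decompositions of \<mu> into three exponents, grouped by the sum
  of the first two on the left and by the first one on the right. All subtractions are exact in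
  these ranges.\<close>

lemma sum_exponents_triple:
  fixes F :: "(nat \<Rightarrow> nat) \<Rightarrow> (nat \<Rightarrow> nat) \<Rightarrow> (nat \<Rightarrow> nat) \<Rightarrow> real"
  assumes \<mu>: "\<mu> \<in> Exps"
  shows "(\<Sum>\<kappa> | \<kappa> \<le> \<mu>. \<Sum>\<nu> | \<nu> \<le> \<kappa>. F \<nu> (\<lambda>a. \<kappa> a - \<nu> a) (\<lambda>a. \<mu> a - \<kappa> a)) =
    (\<Sum>\<nu> | \<nu> \<le> \<mu>. \<Sum>\<rho> | \<rho> \<le> (\<lambda>a. \<mu> a - \<nu> a). F \<nu> \<rho> (\<lambda>a. \<mu> a - \<nu> a - \<rho> a))"
    (is "?l = ?r")
proof -
  have "?l = (\<Sum>x \<in> Sigma {\<kappa>. \<kappa> \<le> \<mu>} (\<lambda>\<kappa>. {\<nu>. \<nu> \<le> \<kappa>}).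
      F (snd x) (\<lambda>a. fst x a - snd x a) (\<lambda>a. \<mu> a - fst x a))"
    using finite_le_exponent[OF exponents_le[OF \<mu>]] finite_le_exponent[OF \<mu>]
    by (subst sum.Sigma) (auto simp: case_prod_unfold)
  also have "\<dots> = (\<Sum>x \<in> Sigma {\<nu>. \<nu> \<le> \<mu>} (\<lambda>\<nu>. {\<rho>. \<rho> \<le> (\<lambda>a. \<mu> a - \<nu> a)}).
      F (fst x) (snd x) (\<lambda>a. \<mu> a - fst x a - snd x a))"
  proof (rule sum.reindex_bij_witness[where
        i = "\<lambda>x. (\<lambda>a. fst x a + snd x a, fst x)" and j = "\<lambda>x. (snd x, \<lambda>a. fst x a - snd x a)"])
    fix x assume "x \<in> Sigma {\<kappa>. \<kappa> \<le> \<mu>} (\<lambda>\<kappa>. {\<nu>. \<nu> \<le> \<kappa>})"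
    then obtain \<kappa> \<nu> where x: "x = (\<kappa>, \<nu>)" "\<And>a. \<nu> a \<le> \<kappa> a" "\<And>a. \<kappa> a \<le> \<mu> a"
      by (cases x) (auto simp: le_fun_def)
    then show "(snd x, \<lambda>a. fst x a - snd x a) \<in>
        Sigma {\<nu>. \<nu> \<le> \<mu>} (\<lambda>\<nu>. {\<rho>. \<rho> \<le> (\<lambda>a. \<mu> a - \<nu> a)})"
      by (auto simp: le_fun_def intro: order_trans diff_le_mono)
  next
    fix x assume "x \<in> Sigma {\<nu>. \<nu> \<le> \<mu>} (\<lambda>\<nu>. {\<rho>. \<rho> \<le> (\<lambda>a. \<mu> a - \<nu> a)})"
    then obtain \<nu> \<rho> where x: "x = (\<nu>, \<rho>)" "\<And>a. \<nu> a \<le> \<mu> a" "\<And>a. \<rho> a \<le> \<mu> a - \<nu> a"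
      by (cases x) (auto simp: le_fun_def)
    have "\<nu> a + \<rho> a \<le> \<mu> a" for a using x(2,3)[of a] by linarith
    then show "(\<lambda>a. fst x a + snd x a, fst x) \<in> Sigma {\<kappa>. \<kappa> \<le> \<mu>} (\<lambda>\<kappa>. {\<nu>. \<nu> \<le> \<kappa>})"
      using x by (auto simp: le_fun_def)
  qed (auto simp: le_fun_def)
  also have "\<dots> = ?r"
    using finite_le_exponent[OF exponents_diff[OF \<mu>]] finite_le_exponent[OF \<mu>]
    by (subst sum.Sigma) (auto simp: case_prod_unfold)
  finally show ?thesis .
qed

lemma mult_real_series_assoc: "f \<odot> g \<odot> h = f \<odot> (g \<odot> h)"
proof
  fix \<mu> show "(f \<odot> g \<odot> h) \<mu> = (f \<odot> (g \<odot> h)) \<mu>"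
  proof (cases "\<mu> \<in> Exps")
    case True
    \<comment> \<open>Both bracketings give this sign, with one factor for each pair, because
      \<open>sg\<close> is multiplicative in either argument.\<close>
    define F where "F \<alpha> \<beta> \<gamma> = sg \<alpha> \<beta> * sg \<alpha> \<gamma> * sg \<beta> \<gamma> * (f \<alpha> * g \<beta> * h \<gamma>)" for \<alpha> \<beta> \<gamma>
    have "sg \<kappa> (\<lambda>a. \<mu> a - \<kappa> a) * (f \<odot> g) \<kappa> * h (\<lambda>a. \<mu> a - \<kappa> a) =
        (\<Sum>\<nu> | \<nu> \<le> \<kappa>. F \<nu> (\<lambda>a. \<kappa> a - \<nu> a) (\<lambda>a. \<mu> a - \<kappa> a))" if \<kappa>: "\<kappa> \<le> \<mu>" for \<kappa>
      unfolding mult_real_series if_P[OF exponents_le[OF True \<kappa>]] sum_distrib_left sum_distrib_right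
    proof (rule sum.cong)
      fix \<nu> assume "\<nu> \<in> {\<nu>. \<nu> \<le> \<kappa>}"
      then have "sg \<kappa> (\<lambda>a. \<mu> a - \<kappa> a) =
          sg \<nu> (\<lambda>a. \<mu> a - \<kappa> a) * sg (\<lambda>a. \<kappa> a - \<nu> a) (\<lambda>a. \<mu> a - \<kappa> a)"
        using monomial_sign_add_left[of \<nu> "\<lambda>a. \<kappa> a - \<nu> a" "\<lambda>a. \<mu> a - \<kappa> a"]
        by (simp add: le_fun_def)
      then show "sg \<kappa> (\<lambda>a. \<mu> a - \<kappa> a) *
            (sg \<nu> (\<lambda>a. \<kappa> a - \<nu> a) * f \<nu> * g (\<lambda>a. \<kappa> a - \<nu> a)) * h (\<lambda>a. \<mu> a - \<kappa> a) =
          F \<nu> (\<lambda>a. \<kappa> a - \<nu> a) (\<lambda>a. \<mu> a - \<kappa> a)"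
        by (simp add: F_def ac_simps)
    qed simp
    then have "(f \<odot> g \<odot> h) \<mu> =
        (\<Sum>\<kappa> | \<kappa> \<le> \<mu>. \<Sum>\<nu> | \<nu> \<le> \<kappa>. F \<nu> (\<lambda>a. \<kappa> a - \<nu> a) (\<lambda>a. \<mu> a - \<kappa> a))"
      using True by (simp add: mult_real_series[of "f \<odot> g"])
    moreover have "sg \<nu> (\<lambda>a. \<mu> a - \<nu> a) * f \<nu> * (g \<odot> h) (\<lambda>a. \<mu> a - \<nu> a) =
        (\<Sum>\<rho> | \<rho> \<le> (\<lambda>a. \<mu> a - \<nu> a). F \<nu> \<rho> (\<lambda>a. \<mu> a - \<nu> a - \<rho> a))" for \<nu>
      unfolding mult_real_series if_P[OF exponents_diff[OF True]] sum_distrib_left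
    proof (rule sum.cong)
      fix \<rho> assume "\<rho> \<in> {\<rho>. \<rho> \<le> (\<lambda>a. \<mu> a - \<nu> a)}"
      then have "(\<lambda>a. \<rho> a + (\<mu> a - \<nu> a - \<rho> a)) = (\<lambda>a. \<mu> a - \<nu> a)"
        by (auto simp: le_fun_def simp del: diff_diff_left)
      then have "sg \<nu> (\<lambda>a. \<mu> a - \<nu> a) = sg \<nu> \<rho> * sg \<nu> (\<lambda>a. \<mu> a - \<nu> a - \<rho> a)"
        using monomial_sign_add_right[of \<nu> \<rho> "\<lambda>a. \<mu> a - \<nu> a - \<rho> a"] by simp
      then show "sg \<nu> (\<lambda>a. \<mu> a - \<nu> a) * f \<nu> *
            (sg \<rho> (\<lambda>a. \<mu> a - \<nu> a - \<rho> a) * g \<rho> * h (\<lambda>a. \<mu> a - \<nu> a - \<rho> a)) =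
          F \<nu> \<rho> (\<lambda>a. \<mu> a - \<nu> a - \<rho> a)"
        by (simp add: F_def ac_simps)
    qed simp
    ultimately show ?thesis
      using True by (simp add: mult_real_series[of f] sum_exponents_triple)
  qed (simp add: mult_real_series)
qed

lemma one_mult_real_series:
  assumes "f \<in> carrier R"
  shows "\<one>\<^bsub>R\<^esub> \<odot> f = f" "f \<odot> \<one>\<^bsub>R\<^esub> = f"
proof -
  have "(\<one>\<^bsub>R\<^esub> \<odot> f) \<mu> = f \<mu> \<and> (f \<odot> \<one>\<^bsub>R\<^esub>) \<mu> = f \<mu>" for \<mu>
  proof (cases "\<mu> \<in> Exps")
    case True
    have "(\<one>\<^bsub>R\<^esub> \<odot> f) \<mu> = (\<Sum>\<nu> | \<nu> \<le> \<mu>. if \<nu> = (\<lambda>_. 0) then f \<mu> else 0)"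
      using True by (auto simp: mult_real_series one_real_series intro!: sum.cong)
    moreover have "(f \<odot> \<one>\<^bsub>R\<^esub>) \<mu> = (\<Sum>\<nu> | \<nu> \<le> \<mu>. if \<nu> = \<mu> then f \<mu> else 0)"
    proof -
      have "\<nu> = \<mu>" if "(\<lambda>a. \<mu> a - \<nu> a) = (\<lambda>_. 0)" "\<nu> \<le> \<mu>" for \<nu>
        using that by (auto simp: fun_eq_iff le_fun_def intro: antisym)
      then show ?thesis
        using True by (auto simp: mult_real_series one_real_series intro!: sum.cong)
    qed
    ultimately show ?thesis
      using finite_le_exponent[OF True] by (simp add: le_fun_def)
  qed (use assms in \<open>simp add: mult_real_series carrier_real_series\<close>)
  then show "\<one>\<^bsub>R\<^esub> \<odot> f = f" "f \<odot> \<one>\<^bsub>R\<^esub> = f" by auto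
qed

lemma mult_real_series_sum_left:
  "(\<lambda>\<nu>. \<Sum>i\<in>I. c i * f i \<nu>) \<odot> g = (\<lambda>\<nu>. \<Sum>i\<in>I. c i * (f i \<odot> g) \<nu>)"
proof
  fix \<mu> show "((\<lambda>\<nu>. \<Sum>i\<in>I. c i * f i \<nu>) \<odot> g) \<mu> = (\<Sum>i\<in>I. c i * (f i \<odot> g) \<mu>)"
    unfolding mult_real_series sum_distrib_left sum_distrib_right
    by (subst sum.swap) (simp add: sum_distrib_left ac_simps)
qed

lemma mult_real_series_sum_right:
  "g \<odot> (\<lambda>\<nu>. \<Sum>i\<in>I. c i * f i \<nu>) = (\<lambda>\<nu>. \<Sum>i\<in>I. c i * (g \<odot> f i) \<nu>)"
proof
  fix \<mu> show "(g \<odot> (\<lambda>\<nu>. \<Sum>i\<in>I. c i * f i \<nu>)) \<mu> = (\<Sum>i\<in>I. c i * (g \<odot> f i) \<mu>)"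
    unfolding mult_real_series sum_distrib_left sum_distrib_right
    by (subst sum.swap) (simp add: sum_distrib_left ac_simps)
qed

lemma mult_real_series_scale_left:
  "(\<lambda>\<nu>. c * f \<nu>) \<odot> g = (\<lambda>\<nu>. c * (f \<odot> g) \<nu>)"
  using mult_real_series_sum_left[of "\<lambda>_. c" "\<lambda>_. f" "{0::nat}" g] by simp

lemma mult_real_series_scale_right:
  "g \<odot> (\<lambda>\<nu>. c * f \<nu>) = (\<lambda>\<nu>. c * (g \<odot> f) \<nu>)"
  using mult_real_series_sum_right[of g "\<lambda>_. c" "\<lambda>_. f" "{0::nat}"] by simp

lemma one_real_series_closed: "\<one>\<^bsub>R\<^esub> \<in> carrier R"
  by (auto simp: carrier_real_series one_real_series)

lemma ring_real_series: "ring R"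
proof (rule ringI)
  show "abelian_group R"
  proof (rule abelian_groupI)
    fix f assume "f \<in> carrier R"
    then show "\<exists>g\<in>carrier R. g \<oplus>\<^bsub>R\<^esub> f = \<zero>\<^bsub>R\<^esub>"
      by (intro bexI[of _ "\<lambda>\<mu>. - f \<mu>"]) (simp_all add: add_real_series zero_real_series carrier_real_series)
  qed (simp_all add: add_real_series zero_real_series carrier_real_series ac_simps)
  show "monoid R"
    by (rule monoidI)
      (simp_all add: mult_real_series_closed mult_real_series_assoc one_mult_real_series
        one_real_series_closed)
  fix f g h
  show "(f \<oplus>\<^bsub>R\<^esub> g) \<odot> h = f \<odot> h \<oplus>\<^bsub>R\<^esub> g \<odot> h"
    by (rule ext) (simp add: mult_real_series add_real_series distrib_left distrib_right sum.distrib)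
  show "h \<odot> (f \<oplus>\<^bsub>R\<^esub> g) = h \<odot> f \<oplus>\<^bsub>R\<^esub> h \<odot> g"
    by (rule ext) (simp add: mult_real_series add_real_series distrib_left sum.distrib)
qed

sublocale ring R
  by (rule ring_real_series)

text \<open>This is what allows series to be truncated before they are multiplied.\<close>

lemma mult_real_series_cong:
  assumes "\<And>\<nu>. \<nu> \<le> \<mu> \<Longrightarrow> f \<nu> = f' \<nu>" "\<And>\<nu>. \<nu> \<le> \<mu> \<Longrightarrow> g \<nu> = g' \<nu>"
  shows "(f \<odot> g) \<mu> = (f' \<odot> g') \<mu>"
  unfolding mult_real_series using assms by (auto simp: le_fun_def intro!: sum.cong)

section \<open>Homogeneous series and the order of vanishing\<close>

definition homogeneous :: "bit ^ 'n \<Rightarrow> ((nat \<Rightarrow> nat) \<Rightarrow> real) \<Rightarrow> bool" where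
  "homogeneous i f \<longleftrightarrow> f \<in> carrier R \<and> (\<forall>\<mu>. dg \<mu> \<noteq> i \<longrightarrow> f \<mu> = 0)"

lemma homogeneous_one: "homogeneous 0 \<one>\<^bsub>R\<^esub>"
  by (auto simp: homogeneous_def one_real_series carrier_real_series)

lemma homogeneous_mult:
  assumes "homogeneous i f" "homogeneous j g"
  shows "homogeneous (i + j) (f \<odot> g)"
proof -
  have "(f \<odot> g) \<mu> = 0" if \<mu>: "dg \<mu> \<noteq> i + j" for \<mu>
  proof -
    have "f \<nu> * g (\<lambda>a. \<mu> a - \<nu> a) = 0" if "\<nu> \<le> \<mu>" for \<nu>
      using \<mu> assms monomial_degree_add[of \<nu> "\<lambda>a. \<mu> a - \<nu> a"] that
      by (auto simp: homogeneous_def le_fun_def)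
    then show ?thesis by (auto simp: mult_real_series intro!: sum.neutral)
  qed
  then show ?thesis by (simp add: homogeneous_def mult_real_series_closed)
qed

lemma homogeneous_commute:
  assumes "homogeneous i f" "homogeneous j g"
  shows "f \<odot> g = (\<lambda>\<mu>. comm_sign i j * (g \<odot> f) \<mu>)"
proof
  fix \<mu> show "(f \<odot> g) \<mu> = comm_sign i j * (g \<odot> f) \<mu>"
  proof (cases "\<mu> \<in> Exps")
    case True
    \<comment> \<open>Reflecting the index, \<nu> to \<mu> - \<nu>, lets the splittings of \<mu> be
      compared with those in the opposite product. Terms in which the two degrees are not i and j
      vanish on both sides.\<close>
    have "(f \<odot> g) \<mu> =
        (\<Sum>\<nu> | \<nu> \<le> \<mu>. sg (\<lambda>a. \<mu> a - \<nu> a) \<nu> * f (\<lambda>a. \<mu> a - \<nu> a) * g \<nu>)"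
      unfolding mult_real_series if_P[OF True]
      by (rule sum.reindex_bij_witness[where
            i = "\<lambda>\<nu> a. \<mu> a - \<nu> a" and j = "\<lambda>\<nu> a. \<mu> a - \<nu> a"]) (auto simp: le_fun_def)
    also have "\<dots> = (\<Sum>\<nu> | \<nu> \<le> \<mu>.
        comm_sign i j * (sg \<nu> (\<lambda>a. \<mu> a - \<nu> a) * g \<nu> * f (\<lambda>a. \<mu> a - \<nu> a)))"
    proof (rule sum.cong[OF refl])
      fix \<nu> assume "\<nu> \<in> {\<nu>. \<nu> \<le> \<mu>}"
      then have eq: "(\<lambda>a. (\<mu> a - \<nu> a) + \<nu> a) = \<mu>" by (auto simp: le_fun_def)
      show "sg (\<lambda>a. \<mu> a - \<nu> a) \<nu> * f (\<lambda>a. \<mu> a - \<nu> a) * g \<nu> =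
          comm_sign i j * (sg \<nu> (\<lambda>a. \<mu> a - \<nu> a) * g \<nu> * f (\<lambda>a. \<mu> a - \<nu> a))"
      proof (cases "dg (\<lambda>a. \<mu> a - \<nu> a) = i \<and> dg \<nu> = j")
        case deg: True
        have "sg (\<lambda>a. \<mu> a - \<nu> a) \<nu> = comm_sign i j * sg \<nu> (\<lambda>a. \<mu> a - \<nu> a)"
          using monomial_sign_commute[of "\<lambda>a. \<mu> a - \<nu> a" \<nu>] True deg by (simp only: eq)
        then show ?thesis by (simp add: ac_simps)
      qed (use assms in \<open>auto simp: homogeneous_def\<close>)
    qed
    also have "\<dots> = comm_sign i j * (g \<odot> f) \<mu>"
      using True by (simp add: mult_real_series sum_distrib_left)
    finally show ?thesis .
  qed (simp add: mult_real_series)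
qed

text \<open>The order of a series in the formal variables. Estimates for it take the place of
  convergence, both in substitution and in the geometric series.\<close>

definition vanishes_below :: "nat \<Rightarrow> ((nat \<Rightarrow> nat) \<Rightarrow> real) \<Rightarrow> bool" where
  "vanishes_below n f \<longleftrightarrow> (\<forall>\<mu>. sz \<mu> < n \<longrightarrow> f \<mu> = 0)"

lemma vanishes_below_mult:
  assumes "vanishes_below m f" "vanishes_below n g"
  shows "vanishes_below (m + n) (f \<odot> g)"
  unfolding vanishes_below_def
proof (intro allI impI)
  fix \<mu> assume \<mu>: "sz \<mu> < m + n"
  have "f \<nu> * g (\<lambda>a. \<mu> a - \<nu> a) = 0" if "\<nu> \<le> \<mu>" for \<nu>
  proof -
    have "sz \<mu> = sz \<nu> + sz (\<lambda>a. \<mu> a - \<nu> a)"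
      using that by (simp add: sum.distrib[symmetric] le_fun_def)
    then have "sz \<nu> < m \<or> sz (\<lambda>a. \<mu> a - \<nu> a) < n" using \<mu> by linarith
    then show ?thesis using assms by (auto simp: vanishes_below_def)
  qed
  then show "(f \<odot> g) \<mu> = 0" by (auto simp: mult_real_series intro!: sum.neutral)
qed

lemma vanishes_below_0 [simp]: "vanishes_below 0 f"
  by (simp add: vanishes_below_def)

definition monomial :: "(nat \<Rightarrow> nat) \<Rightarrow> (nat \<Rightarrow> nat) \<Rightarrow> real" where
  "monomial \<mu> = (\<lambda>\<nu>. if \<nu> = \<mu> then 1 else 0)"

lemma monomial_zero: "monomial (\<lambda>_. 0) = \<one>\<^bsub>R\<^esub>"
  by (simp add: monomial_def one_real_series)

lemma monomial_closed: "\<mu> \<in> Exps \<Longrightarrow> monomial \<mu> \<in> carrier R"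
  by (auto simp: monomial_def carrier_real_series)

lemma monomial_mult:
  assumes "(\<lambda>a. \<mu> a + \<nu> a) \<in> Exps"
  shows "monomial \<mu> \<odot> monomial \<nu> = (\<lambda>\<kappa>. sg \<mu> \<nu> * monomial (\<lambda>a. \<mu> a + \<nu> a) \<kappa>)"
proof
  fix \<kappa>
  show "(monomial \<mu> \<odot> monomial \<nu>) \<kappa> = sg \<mu> \<nu> * monomial (\<lambda>a. \<mu> a + \<nu> a) \<kappa>"
  proof (cases "\<kappa> = (\<lambda>a. \<mu> a + \<nu> a)")
    case True
    have "(monomial \<mu> \<odot> monomial \<nu>) \<kappa> =
        (\<Sum>\<rho> | \<rho> \<le> \<kappa>. if \<rho> = \<mu> then sg \<mu> \<nu> else 0)"
      using assms True by (auto simp: mult_real_series monomial_def intro!: sum.cong)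
    then show ?thesis
      using finite_le_exponent[OF assms] True by (simp add: monomial_def le_fun_def)
  next
    case False
    have "monomial \<mu> \<rho> * monomial \<nu> (\<lambda>a. \<kappa> a - \<rho> a) = 0" if "\<rho> \<le> \<kappa>" for \<rho>
      using False that by (auto simp: monomial_def fun_eq_iff le_fun_def) (metis le_add_diff_inverse)
    then have "(monomial \<mu> \<odot> monomial \<nu>) \<kappa> = 0"
      by (auto simp: mult_real_series intro!: sum.neutral)
    then show ?thesis using False by (simp add: monomial_def)
  qed
qed


subsection \<open>Products of powers\<close>

text \<open>The cut-off k serves induction over the variables. At k = q this is the ordered monomial
  of exponent \<mu> with each variable replaced by \<open>Y a\<close>.\<close>

definition powers :: "(nat \<Rightarrow> (nat \<Rightarrow> nat) \<Rightarrow> real) \<Rightarrow> nat \<Rightarrow> (nat \<Rightarrow> nat) \<Rightarrow> (nat \<Rightarrow> nat) \<Rightarrow> real" where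
  "powers Y k \<mu> = ordered_product R (map (\<lambda>a. Y a [^]\<^bsub>R\<^esub> \<mu> a) [0..<k])"

lemma powers_0: "powers Y 0 \<mu> = \<one>\<^bsub>R\<^esub>"
  by (simp add: powers_def)

lemma powers_cong:
  assumes "\<And>a. a < k \<Longrightarrow> Y a = Z a" "\<And>a. a < k \<Longrightarrow> \<mu> a = \<nu> a"
  shows "powers Y k \<mu> = powers Z k \<nu>"
  unfolding powers_def using assms by (intro arg_cong[where f = "ordered_product R"] map_cong) auto

definition substitutable :: "(nat \<Rightarrow> (nat \<Rightarrow> nat) \<Rightarrow> real) \<Rightarrow> bool" where
  "substitutable Y \<longleftrightarrow> (\<forall>a<q. homogeneous (deg a) (Y a) \<and> vanishes_below 1 (Y a))"

context
  fixes Y :: "nat \<Rightarrow> (nat \<Rightarrow> nat) \<Rightarrow> real"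
  assumes Y: "substitutable Y"
begin

lemma Y_homogeneous: "a < q \<Longrightarrow> homogeneous (deg a) (Y a)"
  and Y_vanishes_below: "a < q \<Longrightarrow> vanishes_below 1 (Y a)"
  and Y_closed: "a < q \<Longrightarrow> Y a \<in> carrier R"
  using Y by (auto simp: substitutable_def homogeneous_def)

lemma powers_Suc:
  assumes "k < q"
  shows "powers Y (Suc k) \<mu> = powers Y k \<mu> \<odot> Y k [^]\<^bsub>R\<^esub> \<mu> k"
proof -
  have "set (map (\<lambda>a. Y a [^]\<^bsub>R\<^esub> \<mu> a) [0..<k]) \<subseteq> carrier R"
    using assms by (auto intro!: nat_pow_closed Y_closed)
  from ordered_product_snoc[OF this nat_pow_closed[OF Y_closed[OF assms]]]
  show ?thesis by (simp add: powers_def)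
qed

lemma powers_closed: "k \<le> q \<Longrightarrow> powers Y k \<mu> \<in> carrier R"
  unfolding powers_def using Y_closed by (auto intro!: ordered_product_closed)

lemma power_homogeneous:
  fixes m :: nat
  assumes "a < q"
  shows "homogeneous (of_nat m *s deg a) (Y a [^]\<^bsub>R\<^esub> m)"
proof (induction m)
  case (Suc m)
  have "of_nat (Suc m) *s deg a = of_nat m *s deg a + deg a"
    by (simp only: of_nat_Suc vector_sadd_rdistrib vector_smult_lid add.commute)
  with homogeneous_mult[OF Suc Y_homogeneous[OF assms]] show ?case by simp
qed (simp add: homogeneous_one)

lemma powers_homogeneous:
  "k \<le> q \<Longrightarrow> homogeneous (\<Sum>a<k. of_nat (\<mu> a) *s deg a) (powers Y k \<mu>)"
  by (induction k) (simp_all add: powers_0 homogeneous_one powers_Suc homogeneous_mult power_homogeneous)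

lemma power_vanishes_below:
  fixes m :: nat
  assumes "a < q"
  shows "vanishes_below m (Y a [^]\<^bsub>R\<^esub> m)"
proof (induction m)
  case (Suc m)
  then show ?case using vanishes_below_mult[OF Suc Y_vanishes_below[OF assms]] by simp
qed simp

lemma powers_vanishes_below: "k \<le> q \<Longrightarrow> vanishes_below (\<Sum>a<k. \<mu> a) (powers Y k \<mu>)"
  by (induction k) (simp_all add: powers_Suc vanishes_below_mult power_vanishes_below)

text \<open>The sign arises from moving powers past each other and depends on their degrees alone.
  As \<open>Y a\<close> has the degree of the variable it replaces, the sign is that of the formal
  monomials.\<close>

lemma powers_mult:
  "k \<le> q \<Longrightarrow> powers Y k \<mu> \<odot> powers Y k \<nu> =
     (\<lambda>\<kappa>. (\<Prod>a<k. \<Prod>b<a. comm_sign (deg a) (deg b) ^ (\<mu> a * \<nu> b)) * powers Y k (\<lambda>a. \<mu> a + \<nu> a) \<kappa>)"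
proof (induction k)
  case 0
  then show ?case by (simp add: powers_0)
next
  case (Suc k)
  \<comment> \<open>The sign for moving the last power of the first product past all earlier powers
    of the second.\<close>
  define c where "c = comm_sign (of_nat (\<mu> k) *s deg k) (\<Sum>b<k. of_nat (\<nu> b) *s deg b)"
  have k: "k < q" "k \<le> q" using Suc.prems by auto
  have c: "c = (\<Prod>b<k. comm_sign (deg k) (deg b) ^ (\<mu> k * \<nu> b))"
    by (simp only: c_def comm_sign_sum_right comm_sign_of_nat_left comm_sign_of_nat_right
        power_mult[symmetric])
  let ?y = "\<lambda>m::nat. Y k [^]\<^bsub>R\<^esub> m"
  have cl: "?y m \<in> carrier R" "powers Y k \<rho> \<in> carrier R" for m \<rho>
    using k by (auto intro: Y_closed powers_closed)
  have "powers Y (Suc k) \<mu> \<odot> powers Y (Suc k) \<nu> =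
      powers Y k \<mu> \<odot> ((?y (\<mu> k) \<odot> powers Y k \<nu>) \<odot> ?y (\<nu> k))"
    using k cl by (simp add: powers_Suc m_assoc)
  also have "?y (\<mu> k) \<odot> powers Y k \<nu> = (\<lambda>\<kappa>. c * (powers Y k \<nu> \<odot> ?y (\<mu> k)) \<kappa>)"
    unfolding c_def using k by (intro homogeneous_commute power_homogeneous powers_homogeneous)
  also have "powers Y k \<mu> \<odot> ((\<lambda>\<kappa>. c * (powers Y k \<nu> \<odot> ?y (\<mu> k)) \<kappa>) \<odot> ?y (\<nu> k)) =
      (\<lambda>\<kappa>. c * ((powers Y k \<mu> \<odot> powers Y k \<nu>) \<odot> (?y (\<mu> k) \<odot> ?y (\<nu> k))) \<kappa>)"
    using cl by (simp add: mult_real_series_scale_left mult_real_series_scale_right m_assoc)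
  also have "?y (\<mu> k) \<odot> ?y (\<nu> k) = ?y (\<mu> k + \<nu> k)"
    using k by (simp add: nat_pow_mult Y_closed)
  finally show ?case
    using Suc.IH[OF k(2)] k c
    by (simp add: mult_real_series_scale_left powers_Suc mult.assoc mult.left_commute)
qed

text \<open>The sum of two exponents leaves \<open>Exps\<close> when a variable with odd
  self-pairing would occur twice. Its image anticommutes with itself, hence has square zero over the
  reals, and the whole product vanishes as the formal monomial does.\<close>

lemma powers_not_exponent:
  assumes \<mu>: "\<mu> \<notin> Exps" "\<forall>a\<ge>q. \<mu> a = 0"
  shows "powers Y q \<mu> = \<zero>\<^bsub>R\<^esub>"
proof -
  obtain a where a: "a < q" "pairing (deg a) (deg a) = 1" "\<not> \<mu> a \<le> 1"
    using \<mu> unfolding exponents_def by blast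
  have "Y a \<odot> Y a = (\<lambda>\<kappa>. - (Y a \<odot> Y a) \<kappa>)"
    using homogeneous_commute[OF Y_homogeneous Y_homogeneous, of a a] a by (simp add: comm_sign_def)
  then have "(Y a \<odot> Y a) \<kappa> = - (Y a \<odot> Y a) \<kappa>" for \<kappa> by (rule fun_cong)
  then have "(Y a \<odot> Y a) \<kappa> = 0" for \<kappa> by (metis neg_equal_zero)
  then have "Y a \<odot> Y a = \<zero>\<^bsub>R\<^esub>" by (auto simp: zero_real_series)
  then have "Y a [^]\<^bsub>R\<^esub> (2::nat) = \<zero>\<^bsub>R\<^esub>"
    using Y_closed[OF a(1)] by (simp add: numeral_2_eq_2)
  moreover have "Y a [^]\<^bsub>R\<^esub> \<mu> a = Y a [^]\<^bsub>R\<^esub> (2::nat) \<odot> Y a [^]\<^bsub>R\<^esub> (\<mu> a - 2)"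
  proof -
    have "2 + (\<mu> a - 2) = \<mu> a" using a(3) by simp
    then show ?thesis by (simp only: nat_pow_mult[OF Y_closed[OF a(1)]])
  qed
  ultimately have zero: "Y a [^]\<^bsub>R\<^esub> \<mu> a = \<zero>\<^bsub>R\<^esub>" using a Y_closed by simp
  have "powers Y k \<mu> = \<zero>\<^bsub>R\<^esub>" if "a < k" "k \<le> q" for k
    using that
  proof (induction k)
    case (Suc k)
    then show ?case
      using zero Y_closed powers_closed by (cases "a = k") (auto simp: powers_Suc)
  qed simp
  with a(1) show ?thesis by simp
qed

lemma powers_exponents_mult:
  "powers Y q \<mu> \<odot> powers Y q \<nu> = (\<lambda>\<kappa>. sg \<mu> \<nu> * powers Y q (\<lambda>a. \<mu> a + \<nu> a) \<kappa>)"
  using powers_mult[of q] by (simp add: monomial_sign_def)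

lemma powers_small: "sz \<nu> < sz \<mu> \<Longrightarrow> powers Y q \<mu> \<nu> = 0"
  using powers_vanishes_below[of q \<mu>] by (simp add: vanishes_below_def)


subsection \<open>Substitution\<close>

definition subst_series :: "((nat \<Rightarrow> nat) \<Rightarrow> real) \<Rightarrow> (nat \<Rightarrow> nat) \<Rightarrow> real" where
  "subst_series s \<nu> = (\<Sum>\<mu>\<in>Exps_upto (sz \<nu>). s \<mu> * powers Y q \<mu> \<nu>)"

text \<open>Products of powers of larger total exponent have no coefficient at \<nu>. Hence one
  bound N can serve for all coefficients that enter a product.\<close>

lemma subst_series_upto:
  assumes "sz \<nu> \<le> N"
  shows "subst_series s \<nu> = (\<Sum>\<mu>\<in>Exps_upto N. s \<mu> * powers Y q \<mu> \<nu>)"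
  unfolding subst_series_def
proof (rule sum.mono_neutral_left)
  show "Exps_upto (sz \<nu>) \<subseteq> Exps_upto N" using assms by (auto simp: Exps_upto_def)
  show "\<forall>\<mu>\<in>Exps_upto N - Exps_upto (sz \<nu>). s \<mu> * powers Y q \<mu> \<nu> = 0"
    by (intro ballI) (subst powers_small, auto simp: Exps_upto_def)
qed simp

lemma subst_series_closed: "subst_series s \<in> carrier R"
  using powers_closed[of q] by (simp add: carrier_real_series subst_series_def)

lemma powers_zero: "powers Y q (\<lambda>_. 0) = \<one>\<^bsub>R\<^esub>"
proof -
  have "powers Y k (\<lambda>_. 0) = \<one>\<^bsub>R\<^esub>" if "k \<le> q" for k
    using that by (induction k) (auto simp: powers_0 powers_Suc)
  then show ?thesis by simp
qed

lemma subst_series_monomial: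
  assumes "\<mu> \<in> Exps"
  shows "subst_series (monomial \<mu>) = powers Y q \<mu>"
proof
  fix \<nu>
  \<comment> \<open>The bound is raised by \<open>sz \<mu>\<close> so that \<mu> lies in the index
    set whatever \<nu> is.\<close>
  have "subst_series (monomial \<mu>) \<nu> =
      (\<Sum>\<rho>\<in>Exps_upto (sz \<nu> + sz \<mu>). if \<rho> = \<mu> then powers Y q \<mu> \<nu> else 0)"
    unfolding subst_series_upto[OF le_add1[of "sz \<nu>" "sz \<mu>"]] by (intro sum.cong) (auto simp: monomial_def)
  moreover have "\<mu> \<in> Exps_upto (sz \<nu> + sz \<mu>)" using assms by (simp add: Exps_upto_def)
  ultimately show "subst_series (monomial \<mu>) \<nu> = powers Y q \<mu> \<nu>" by simp
qed

lemma subst_series_sum: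
  "subst_series (\<lambda>\<mu>. \<Sum>i\<in>I. c i * f i \<mu>) = (\<lambda>\<nu>. \<Sum>i\<in>I. c i * subst_series (f i) \<nu>)"
  unfolding subst_series_def
  by (rule ext, simp only: sum_distrib_right sum_distrib_left mult.assoc) (rule sum.swap)

lemma subst_series_add:
  "subst_series (s \<oplus>\<^bsub>R\<^esub> t) = subst_series s \<oplus>\<^bsub>R\<^esub> subst_series t"
  by (rule ext) (simp add: subst_series_def add_real_series distrib_right sum.distrib)

lemma subst_series_scale: "subst_series (\<lambda>\<mu>. r * s \<mu>) = (\<lambda>\<nu>. r * subst_series s \<nu>)"
  by (rule ext) (simp add: subst_series_def sum_distrib_left mult.assoc)

text \<open>With everything truncated at the size of \<nu>, the right-hand side is a finite sum over
  pairs of exponents. \<open>powers_exponents_mult\<close> merges the two products of powers with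
  exactly the sign of formal multiplication, so it remains to group the pairs by their sum.\<close>

lemma subst_series_mult:
  "subst_series (s \<odot> t) = subst_series s \<odot> subst_series t"
proof
  fix \<nu> :: "nat \<Rightarrow> nat"
  define N where "N = sz \<nu>"
  let ?E = "Exps_upto N"
  let ?P = "powers Y q"
  let ?F = "\<lambda>x. sg (fst x) (snd x) * s (fst x) * t (snd x) * ?P (\<lambda>a. fst x a + snd x a) \<nu>"
  let ?S = "Sigma ?E (\<lambda>\<kappa>. {\<rho>. \<rho> \<le> \<kappa>})"
  have fin: "finite {\<rho>. \<rho> \<le> \<kappa>}" if "\<kappa> \<in> ?E" for \<kappa>
    using that finite_le_exponent by (auto simp: Exps_upto_def)
  have "(subst_series s \<odot> subst_series t) \<nu> =
      ((\<lambda>\<kappa>. \<Sum>\<mu>\<in>?E. s \<mu> * ?P \<mu> \<kappa>) \<odot> (\<lambda>\<kappa>. \<Sum>\<mu>\<in>?E. t \<mu> * ?P \<mu> \<kappa>)) \<nu>"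
    by (rule mult_real_series_cong)
      (auto simp: N_def le_fun_def intro!: subst_series_upto sum_mono)
  also have "\<dots> = (\<Sum>\<mu>\<in>?E. \<Sum>\<rho>\<in>?E. ?F (\<mu>, \<rho>))"
    by (simp add: mult_real_series_sum_left mult_real_series_sum_right powers_exponents_mult
        sum_distrib_left ac_simps)
  also have "\<dots> = (\<Sum>x\<in>?E \<times> ?E. ?F x)"
    by (simp add: sum.cartesian_product case_prod_unfold)
  \<comment> \<open>Pairs whose sum leaves the index set contribute nothing: the sum is too large to
    reach \<nu>, or it repeats a variable with odd self-pairing.\<close>
  also have "\<dots> = (\<Sum>x\<in>{x \<in> ?E \<times> ?E. (\<lambda>a. fst x a + snd x a) \<in> ?E}. ?F x)"
  proof (rule sum.mono_neutral_right)
    show "\<forall>x\<in>?E \<times> ?E - {x \<in> ?E \<times> ?E. (\<lambda>a. fst x a + snd x a) \<in> ?E}. ?F x = 0"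
    proof
      fix x assume x: "x \<in> ?E \<times> ?E - {x \<in> ?E \<times> ?E. (\<lambda>a. fst x a + snd x a) \<in> ?E}"
      show "?F x = 0"
      proof (cases "(\<lambda>a. fst x a + snd x a) \<in> Exps")
        case True
        with x have "sz \<nu> < sz (\<lambda>a. fst x a + snd x a)" by (auto simp: Exps_upto_def N_def)
        then show ?thesis by (simp only: powers_small mult_zero_right)
      next
        case False
        moreover have "\<forall>a\<ge>q. fst x a + snd x a = 0"
          using x by (auto simp: Exps_upto_def exponents_def)
        ultimately show ?thesis by (simp add: powers_not_exponent zero_real_series)
      qed
    qed
  qed auto
  \<comment> \<open>Now the pairs are listed by their sum \<kappa>, which is how the coefficients of
    s \<odot> t are formed.\<close>
  also have "\<dots> = (\<Sum>x\<in>?S. ?F (snd x, \<lambda>a. fst x a - snd x a))"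
  proof (rule sum.reindex_bij_witness[where
        i = "\<lambda>x. (snd x, \<lambda>a. fst x a - snd x a)" and j = "\<lambda>x. (\<lambda>a. fst x a + snd x a, fst x)"])
    fix x assume "x \<in> ?S"
    then obtain \<kappa> \<mu> where x: "x = (\<kappa>, \<mu>)" "\<kappa> \<in> ?E" "\<And>a. \<mu> a \<le> \<kappa> a"
      by (cases x) (auto simp: le_fun_def)
    have "sz \<mu> \<le> sz \<kappa>" "sz (\<lambda>a. \<kappa> a - \<mu> a) \<le> sz \<kappa>" using x(3) by (auto intro!: sum_mono)
    moreover have "\<mu> \<in> Exps" "(\<lambda>a. \<kappa> a - \<mu> a) \<in> Exps"
      using x exponents_le[of \<kappa> \<mu>] exponents_diff[of \<kappa> \<mu>] by (auto simp: Exps_upto_def le_fun_def)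
    ultimately show "(snd x, \<lambda>a. fst x a - snd x a) \<in>
        {x \<in> ?E \<times> ?E. (\<lambda>a. fst x a + snd x a) \<in> ?E}"
      using x by (auto simp: Exps_upto_def)
  qed (auto simp: le_fun_def)
  also have "\<dots> = (\<Sum>\<kappa>\<in>?E. \<Sum>\<rho> | \<rho> \<le> \<kappa>. ?F (\<rho>, \<lambda>a. \<kappa> a - \<rho> a))"
    using fin by (subst sum.Sigma) (auto simp: case_prod_unfold)
  also have "\<dots> = (\<Sum>\<kappa>\<in>?E. (s \<odot> t) \<kappa> * ?P \<kappa> \<nu>)"
  proof (rule sum.cong[OF refl])
    fix \<kappa> assume "\<kappa> \<in> ?E"
    then have \<kappa>: "\<kappa> \<in> Exps" by (simp add: Exps_upto_def)
    show "(\<Sum>\<rho> | \<rho> \<le> \<kappa>. ?F (\<rho>, \<lambda>a. \<kappa> a - \<rho> a)) = (s \<odot> t) \<kappa> * ?P \<kappa> \<nu>"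
      unfolding mult_real_series if_P[OF \<kappa>] sum_distrib_right
      by (rule sum.cong) (auto simp: le_fun_def)
  qed
  finally show "subst_series (s \<odot> t) \<nu> = (subst_series s \<odot> subst_series t) \<nu>"
    by (simp add: subst_series_def N_def)
qed

lemma subst_series_one: "subst_series \<one>\<^bsub>R\<^esub> = \<one>\<^bsub>R\<^esub>"
  using subst_series_monomial[of "\<lambda>_. 0"] by (simp add: monomial_zero powers_zero)

lemma subst_series_hom: "subst_series \<in> ring_hom R R"
  by (rule ring_hom_memI)
    (simp_all add: subst_series_closed subst_series_mult subst_series_add subst_series_one)

lemma subst_series_homogeneous:
  assumes "homogeneous i s"
  shows "homogeneous i (subst_series s)"
proof -
  have "s \<mu> * powers Y q \<mu> \<nu> = 0" if "dg \<nu> \<noteq> i" for \<mu> \<nu>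
    using assms powers_homogeneous[of q \<mu>] that
    by (auto simp: homogeneous_def monomial_degree_def)
  then have "subst_series s \<nu> = 0" if "dg \<nu> \<noteq> i" for \<nu>
    unfolding subst_series_def using that by (intro sum.neutral) blast
  then show ?thesis by (simp add: homogeneous_def subst_series_closed)
qed

text \<open>Units are recognized by their constant terms, so this makes the induced maps of stalks
  local. At size 0 the zero exponent is the only one in the sum.\<close>

lemma subst_series_at_zero: "subst_series s (\<lambda>_. 0) = s (\<lambda>_. 0)"
proof -
  have "Exps_upto 0 = {\<lambda>_. 0}"
    by (auto simp: Exps_upto_def exponents_def fun_eq_iff not_less[symmetric])
  then show ?thesis by (simp add: subst_series_def powers_zero one_real_series)
qed

lemma subst_series_vanishes_below:
  assumes "vanishes_below n s"
  shows "vanishes_below n (subst_series s)"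
  using assms by (auto simp: vanishes_below_def subst_series_def Exps_upto_def intro!: sum.neutral)

lemma subst_series_powers:
  assumes "substitutable Z"
  shows "subst_series (powers Z q \<mu>) = powers (\<lambda>a. subst_series (Z a)) q \<mu>"
proof -
  have Z: "Z a \<in> carrier R" if "a < q" for a
    using assms that by (auto simp: substitutable_def homogeneous_def)
  have "subst_series (Z a [^]\<^bsub>R\<^esub> \<mu> a) = subst_series (Z a) [^]\<^bsub>R\<^esub> \<mu> a" if "a < q" for a
    using ring_hom_nat_pow[OF ring_real_series subst_series_hom Z[OF that]] .
  then show ?thesis
    unfolding powers_def using Z
    by (subst ring_hom_ordered_product[OF ring_real_series subst_series_hom])
      (auto intro!: arg_cong[where f = "ordered_product R"])
qed

end

lemma substitutable_subst_series:
  assumes "substitutable Y" "substitutable Z"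
  shows "substitutable (\<lambda>a. subst_series Y (Z a))"
  using assms subst_series_homogeneous subst_series_vanishes_below
  by (auto simp: substitutable_def)

text \<open>The coefficient at \<nu> sees only exponents of size at most \<open>sz \<nu>\<close>, in
  the inner substitution too. Both are cut at that size; interchanging two finite sums reduces the
  claim to products of powers, where the outer substitution is a ring homomorphism.\<close>

lemma subst_series_subst_series:
  assumes Y: "substitutable Y" and Z: "substitutable Z"
  shows "subst_series Y (subst_series Z s) = subst_series (\<lambda>a. subst_series Y (Z a)) s"
proof
  fix \<nu> :: "nat \<Rightarrow> nat"
  let ?E = "Exps_upto (sz \<nu>)"
  have "subst_series Y (subst_series Z s) \<nu> =
      (\<Sum>\<kappa>\<in>?E. (\<Sum>\<mu>\<in>?E. s \<mu> * powers Z q \<mu> \<kappa>) * powers Y q \<kappa> \<nu>)"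
    unfolding subst_series_def[OF Y]
    by (intro sum.cong refl arg_cong2[where f = "(*)"] subst_series_upto[OF Z])
      (simp add: Exps_upto_def)
  also have "\<dots> = (\<Sum>\<mu>\<in>?E. s \<mu> * subst_series Y (powers Z q \<mu>) \<nu>)"
    unfolding subst_series_def[OF Y] sum_distrib_right sum_distrib_left
    by (subst sum.swap) (simp add: mult.assoc)
  also have "\<dots> = subst_series (\<lambda>a. subst_series Y (Z a)) s \<nu>"
    by (simp add: subst_series_powers[OF Y Z] subst_series_def[OF substitutable_subst_series[OF Y Z]])
  finally show "subst_series Y (subst_series Z s) \<nu> = subst_series (\<lambda>a. subst_series Y (Z a)) s \<nu>" .
qed

lemma subst_series_cong:
  assumes "substitutable Y" "substitutable Z" "\<And>a. a < q \<Longrightarrow> Y a = Z a"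
  shows "subst_series Y s = subst_series Z s"
  unfolding subst_series_def[OF assms(1)] subst_series_def[OF assms(2)]
  using powers_cong[OF assms(3), of q] by (simp add: fun_eq_iff)

end


section \<open>Series with smooth coefficients\<close>

text \<open>The decomposition in \<open>Z2n_graded\<close> is a \<open>finsum\<close> over all
  degrees, which has its intended meaning over finite sets.\<close>

lemma finite_UNIV_bit_vec: "finite (UNIV :: (bit ^ 'n::finite) set)"
proof (rule finite_subset)
  show "(UNIV :: (bit ^ 'n) set) \<subseteq> vec_lambda ` (UNIV \<rightarrow>\<^sub>E {0, 1})"
  proof
    fix v :: "bit ^ 'n"
    have "v = vec_lambda (vec_nth v)" by simp
    moreover have "vec_nth v \<in> UNIV \<rightarrow>\<^sub>E {0, 1}" by (auto simp: PiE_iff)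
    ultimately show "v \<in> vec_lambda ` (UNIV \<rightarrow>\<^sub>E {0, 1})" by (rule image_eqI)
  qed
qed (intro finite_imageI finite_PiE; simp)

context graded_variables
begin

section \<open>The algebra of sections, point by point\<close>

lemma carrier_series_algebra:
  "F \<in> carrier (series_algebra p q deg W) \<longleftrightarrow>
     (\<forall>\<mu>\<in>Exps. smooth_on p W (F \<mu>)) \<and> (\<forall>\<mu> x. \<mu> \<notin> Exps \<or> x \<notin> W \<longrightarrow> F \<mu> x = 0)"
  by (simp add: series_algebra_def Let_def)

lemma mult_series_algebra:
  "F \<otimes>\<^bsub>series_algebra p q deg W\<^esub> G = (\<lambda>\<mu> x. ((\<lambda>\<nu>. F \<nu> x) \<odot> (\<lambda>\<nu>. G \<nu> x)) \<mu>)"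
  by (intro ext) (simp add: series_algebra_def Let_def mult_real_series)

lemma one_series_algebra:
  "\<one>\<^bsub>series_algebra p q deg W\<^esub> = (\<lambda>\<mu> x. if x \<in> W then \<one>\<^bsub>R\<^esub> \<mu> else 0)"
  by (intro ext) (simp add: series_algebra_def Let_def one_real_series)

lemma zero_series_algebra: "\<zero>\<^bsub>series_algebra p q deg W\<^esub> = (\<lambda>\<mu> x. 0)"
  and add_series_algebra: "F \<oplus>\<^bsub>series_algebra p q deg W\<^esub> G = (\<lambda>\<mu> x. F \<mu> x + G \<mu> x)"
  and scale_series_algebra: "scale (series_algebra p q deg W) r F = (\<lambda>\<mu> x. r * F \<mu> x)"
  and component_series_algebra: "component (series_algebra p q deg W) i =
    {F \<in> carrier (series_algebra p q deg W). \<forall>\<mu>. dg \<mu> \<noteq> i \<longrightarrow> F \<mu> = (\<lambda>x. 0)}"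
  by (simp_all add: series_algebra_def Let_def)

lemma carrier_at: "F \<in> carrier (series_algebra p q deg W) \<Longrightarrow> (\<lambda>\<mu>. F \<mu> x) \<in> carrier R"
  by (simp add: carrier_series_algebra carrier_real_series)

lemma zero_mult_real_series: "(\<lambda>\<mu>. 0) \<odot> f = (\<lambda>\<mu>. 0)"
  by (rule ext) (simp add: mult_real_series)

lemma component_series_algebra_iff:
  "F \<in> component (series_algebra p q deg W) i \<longleftrightarrow>
     F \<in> carrier (series_algebra p q deg W) \<and> (\<forall>x\<in>W. homogeneous i (\<lambda>\<mu>. F \<mu> x))"
proof -
  have "(\<forall>\<mu>. dg \<mu> \<noteq> i \<longrightarrow> F \<mu> = (\<lambda>x. 0)) \<longleftrightarrow> (\<forall>x\<in>W. \<forall>\<mu>. dg \<mu> \<noteq> i \<longrightarrow> F \<mu> x = 0)"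
    if "F \<in> carrier (series_algebra p q deg W)"
    using that unfolding carrier_series_algebra fun_eq_iff by blast
  then show ?thesis
    by (auto simp: component_series_algebra homogeneous_def intro: carrier_at)
qed

context
  fixes p :: nat and W :: "(nat \<Rightarrow> real) set"
  assumes W: "openin (Euclidean_space p) W"
begin

abbreviation "A \<equiv> series_algebra p q deg W"

lemma series_algebraI:
  assumes "\<And>\<mu>. \<mu> \<in> Exps \<Longrightarrow> smooth_on p W (F \<mu>)"
  shows "(\<lambda>\<mu> x. if \<mu> \<in> Exps \<and> x \<in> W then F \<mu> x else 0) \<in> carrier A"
  unfolding carrier_series_algebra
proof (intro conjI ballI)
  fix \<mu> assume "\<mu> \<in> Exps"
  then show "smooth_on p W (\<lambda>x. if \<mu> \<in> Exps \<and> x \<in> W then F \<mu> x else 0)"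
    by (intro smooth_on_cong[OF W assms]) auto
qed auto

lemma one_series_algebra_closed: "\<one>\<^bsub>A\<^esub> \<in> carrier A"
proof -
  have "(\<lambda>\<mu> x. if \<mu> \<in> Exps \<and> x \<in> W then \<one>\<^bsub>R\<^esub> \<mu> else 0) \<in> carrier A"
    by (intro series_algebraI smooth_on_const[OF W])
  moreover have "(\<lambda>\<mu> x. if \<mu> \<in> Exps \<and> x \<in> W then \<one>\<^bsub>R\<^esub> \<mu> else 0) = \<one>\<^bsub>A\<^esub>"
    using one_real_series_closed by (auto simp: one_series_algebra carrier_real_series fun_eq_iff)
  ultimately show ?thesis by simp
qed

lemma mult_series_algebra_closed:
  assumes F: "F \<in> carrier A" and G: "G \<in> carrier A"
  shows "F \<otimes>\<^bsub>A\<^esub> G \<in> carrier A"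
  unfolding carrier_series_algebra
proof (intro conjI ballI allI impI)
  fix \<mu> assume \<mu>: "\<mu> \<in> Exps"
  have "smooth_on p W (\<lambda>x. \<Sum>\<nu> | \<nu> \<le> \<mu>. sg \<nu> (\<lambda>a. \<mu> a - \<nu> a) * F \<nu> x * G (\<lambda>a. \<mu> a - \<nu> a) x)"
    using F G \<mu> exponents_le exponents_diff
    by (intro smooth_on_sum smooth_on_mult smooth_on_const W) (auto simp: carrier_series_algebra)
  then show "smooth_on p W ((F \<otimes>\<^bsub>A\<^esub> G) \<mu>)"
    using \<mu> by (simp add: mult_series_algebra mult_real_series)
next
  fix \<mu> x assume "\<mu> \<notin> Exps \<or> x \<notin> W"
  then show "(F \<otimes>\<^bsub>A\<^esub> G) \<mu> x = 0"
    using F by (auto simp: mult_series_algebra mult_real_series carrier_series_algebra)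
qed

lemma add_series_algebra_closed: "F \<in> carrier A \<Longrightarrow> G \<in> carrier A \<Longrightarrow> F \<oplus>\<^bsub>A\<^esub> G \<in> carrier A"
  using smooth_on_add[OF W] by (auto simp: carrier_series_algebra add_series_algebra)

lemma scale_series_algebra_closed: "F \<in> carrier A \<Longrightarrow> scale A r F \<in> carrier A"
  using smooth_on_mult[OF W smooth_on_const[OF W]] by (auto simp: carrier_series_algebra scale_series_algebra)

lemma zero_series_algebra_closed: "\<zero>\<^bsub>A\<^esub> \<in> carrier A"
  using smooth_on_const[OF W] by (auto simp: carrier_series_algebra zero_series_algebra)

lemma ring_series_algebra: "ring A"
proof (rule ringI)
  show "abelian_group A"
  proof (rule abelian_groupI)
    fix F assume F: "F \<in> carrier A"
    then have "scale A (- 1) F \<in> carrier A" by (rule scale_series_algebra_closed)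
    moreover have "scale A (- 1) F \<oplus>\<^bsub>A\<^esub> F = \<zero>\<^bsub>A\<^esub>"
      by (simp add: scale_series_algebra add_series_algebra zero_series_algebra)
    ultimately show "\<exists>G\<in>carrier A. G \<oplus>\<^bsub>A\<^esub> F = \<zero>\<^bsub>A\<^esub>" by blast
  qed (simp_all add: add_series_algebra_closed zero_series_algebra_closed,
      simp_all add: add_series_algebra zero_series_algebra ac_simps)
  show "monoid A"
  proof (rule monoidI)
    fix F assume F: "F \<in> carrier A"
    then have off: "F \<mu> x = 0" if "x \<notin> W" for \<mu> x
      using that by (simp add: carrier_series_algebra)
    note one = one_mult_real_series[OF carrier_at[OF F]]
    show "\<one>\<^bsub>A\<^esub> \<otimes>\<^bsub>A\<^esub> F = F"
    proof (intro ext)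
      fix \<mu> x show "(\<one>\<^bsub>A\<^esub> \<otimes>\<^bsub>A\<^esub> F) \<mu> x = F \<mu> x"
        by (cases "x \<in> W") (simp_all add: mult_series_algebra one_series_algebra one off zero_mult_real_series)
    qed
    show "F \<otimes>\<^bsub>A\<^esub> \<one>\<^bsub>A\<^esub> = F"
    proof (intro ext)
      fix \<mu> x show "(F \<otimes>\<^bsub>A\<^esub> \<one>\<^bsub>A\<^esub>) \<mu> x = F \<mu> x"
        by (cases "x \<in> W") (simp_all add: mult_series_algebra one_series_algebra one off zero_mult_real_series)
    qed
  qed (simp_all add: mult_series_algebra_closed one_series_algebra_closed,
      simp add: mult_series_algebra mult_real_series_assoc)
  fix F G H
  show "(F \<oplus>\<^bsub>A\<^esub> G) \<otimes>\<^bsub>A\<^esub> H = F \<otimes>\<^bsub>A\<^esub> H \<oplus>\<^bsub>A\<^esub> G \<otimes>\<^bsub>A\<^esub> H"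
    by (intro ext) (simp add: mult_series_algebra add_series_algebra mult_real_series
        distrib_left distrib_right sum.distrib)
  show "H \<otimes>\<^bsub>A\<^esub> (F \<oplus>\<^bsub>A\<^esub> G) = H \<otimes>\<^bsub>A\<^esub> F \<oplus>\<^bsub>A\<^esub> H \<otimes>\<^bsub>A\<^esub> G"
    by (intro ext) (simp add: mult_series_algebra add_series_algebra mult_real_series
        distrib_left sum.distrib)
qed

text \<open>Powers and ordered products of sections are defined by recursion in the algebra; this
  homomorphism carries them to the ring of real series at x.\<close>

lemma evaluation_hom: "x \<in> W \<Longrightarrow> (\<lambda>F \<mu>. F \<mu> x) \<in> ring_hom A R"
  by (rule ring_hom_memI)
    (simp_all add: carrier_at mult_series_algebra add_series_algebra add_real_series one_series_algebra)

lemma finsum_series_algebra: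
  assumes "finite I" "f \<in> I \<rightarrow> carrier A"
  shows "(\<Oplus>\<^bsub>A\<^esub>i\<in>I. f i) \<mu> x = (\<Sum>i\<in>I. f i \<mu> x)"
proof -
  interpret A: ring A by (rule ring_series_algebra)
  show ?thesis
    using assms
    by (induction I) (auto simp: zero_series_algebra add_series_algebra Pi_iff A.finsum_insert)
qed

lemma Z2n_graded_series_algebra: "Z2n_graded A"
proof -
  interpret A: ring A by (rule ring_series_algebra)
  have dec: "\<exists>!f. (\<forall>i. f i \<in> component A i) \<and> F = (\<Oplus>\<^bsub>A\<^esub>i\<in>UNIV. f i)" if F: "F \<in> carrier A" for F
  proof (rule ex1I)
    \<comment> \<open>Every monomial has one degree, so the part of degree i keeps the coefficients
      at the monomials of that degree.\<close>
    let ?f = "\<lambda>i \<mu> x. if dg \<mu> = i then F \<mu> x else 0"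
    have "smooth_on p W (\<lambda>x. if dg \<mu> = i then F \<mu> x else 0)" if "\<mu> \<in> Exps" for i \<mu>
      using F that smooth_on_const[OF W, of 0] by (cases "dg \<mu> = i") (auto simp: carrier_series_algebra)
    then have cl: "?f i \<in> carrier A" for i
      using F unfolding carrier_series_algebra by auto
    then have "?f i \<in> component A i" for i by (simp add: component_series_algebra)
    moreover have "F = (\<Oplus>\<^bsub>A\<^esub>i\<in>UNIV. ?f i)"
      by (intro ext) (subst finsum_series_algebra; use cl in \<open>auto simp: finite_UNIV_bit_vec\<close>)
    ultimately show "(\<forall>i. ?f i \<in> component A i) \<and> F = (\<Oplus>\<^bsub>A\<^esub>i\<in>UNIV. ?f i)" by blast
  next
    fix g assume g: "(\<forall>i. g i \<in> component A i) \<and> F = (\<Oplus>\<^bsub>A\<^esub>i\<in>UNIV. g i)"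
    then have gc: "g i \<in> carrier A" "dg \<mu> \<noteq> i \<Longrightarrow> g i \<mu> x = 0" for i \<mu> x
      by (auto simp: component_series_algebra)
    \<comment> \<open>Among the given components only the one indexed by the degree of \<mu> can
      have a coefficient at \<mu>, hence uniqueness.\<close>
    have "F \<mu> x = g (dg \<mu>) \<mu> x" for \<mu> x
    proof -
      have "F \<mu> x = (\<Sum>i\<in>UNIV. g i \<mu> x)"
        using g gc(1) finsum_series_algebra[of UNIV g] by (auto simp: finite_UNIV_bit_vec)
      also have "\<dots> = (\<Sum>i\<in>UNIV. if i = dg \<mu> then g (dg \<mu>) \<mu> x else 0)"
        using gc(2) by (intro sum.cong) auto
      finally show ?thesis by (simp add: finite_UNIV_bit_vec)
    qed
    then show "g = (\<lambda>i \<mu> x. if dg \<mu> = i then F \<mu> x else 0)"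
      using gc(2) by (auto simp: fun_eq_iff)
  qed
  have mult: "F \<otimes>\<^bsub>A\<^esub> G \<in> component A (i + j)"
    if "F \<in> component A i" "G \<in> component A j" for F G i j
    using that mult_series_algebra_closed
    by (auto simp: component_series_algebra_iff) (auto simp: mult_series_algebra intro: homogeneous_mult)
  have one: "\<one>\<^bsub>A\<^esub> \<in> component A 0"
    using one_series_algebra_closed
    by (simp add: component_series_algebra_iff) (simp add: one_series_algebra homogeneous_one)
  have sub: "component A i \<subseteq> carrier A \<and> \<zero>\<^bsub>A\<^esub> \<in> component A i" for i
    using zero_series_algebra_closed by (auto simp: component_series_algebra zero_series_algebra)
  have add: "F \<oplus>\<^bsub>A\<^esub> G \<in> component A i \<and> scale A r F \<in> component A i"
    if "F \<in> component A i" "G \<in> component A i" for F G i r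
    using that add_series_algebra_closed scale_series_algebra_closed
    by (auto simp: component_series_algebra) (auto simp: add_series_algebra scale_series_algebra)
  show ?thesis unfolding Z2n_graded_def
    by (intro conjI allI ballI dec one mult; (simp only: sub)?; (rule add[THEN conjunct1] add[THEN conjunct2]; assumption)?)
qed

lemma Z2n_commutative_series_algebra: "Z2n_commutative_algebra A"
proof -
  have "real_algebra A"
    unfolding real_algebra_def
  proof (intro conjI allI ballI)
    fix r and F G assume "F \<in> carrier A" "G \<in> carrier A"
    show "scale A r (F \<otimes>\<^bsub>A\<^esub> G) = scale A r F \<otimes>\<^bsub>A\<^esub> G"
      unfolding scale_series_algebra mult_series_algebra mult_real_series_scale_left ..
    show "scale A r (F \<otimes>\<^bsub>A\<^esub> G) = F \<otimes>\<^bsub>A\<^esub> scale A r G"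
      unfolding scale_series_algebra mult_series_algebra mult_real_series_scale_right ..
  qed (simp_all add: ring_series_algebra scale_series_algebra_closed,
      simp_all add: scale_series_algebra add_series_algebra algebra_simps)
  moreover have "F \<otimes>\<^bsub>A\<^esub> G = scale A (comm_sign i j) (G \<otimes>\<^bsub>A\<^esub> F)"
    if "F \<in> component A i" "G \<in> component A j" for F G i j
  proof (intro ext)
    fix \<mu> x
    show "(F \<otimes>\<^bsub>A\<^esub> G) \<mu> x = scale A (comm_sign i j) (G \<otimes>\<^bsub>A\<^esub> F) \<mu> x"
    proof (cases "x \<in> W")
      case True
      with that show ?thesis
        using homogeneous_commute[of i "\<lambda>\<mu>. F \<mu> x" j "\<lambda>\<mu>. G \<mu> x"]
        by (auto simp: component_series_algebra_iff mult_series_algebra scale_series_algebra)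
    next
      case False
      with that show ?thesis
        by (simp add: mult_series_algebra scale_series_algebra component_series_algebra
            carrier_series_algebra zero_mult_real_series)
    qed
  qed
  ultimately show ?thesis
    unfolding Z2n_commutative_algebra_def using Z2n_graded_series_algebra by blast
qed

end


subsection \<open>Inverses\<close>

text \<open>The geometric sum may stop at \<open>sz \<nu>\<close>: when h has no constant term, its
  higher powers have no coefficient at \<nu>.\<close>

definition series_inverse :: "((nat \<Rightarrow> nat) \<Rightarrow> real) \<Rightarrow> (nat \<Rightarrow> nat) \<Rightarrow> real" where
  "series_inverse f \<nu> = (let h = (\<lambda>\<mu>. \<one>\<^bsub>R\<^esub> \<mu> - inverse (f (\<lambda>_. 0)) * f \<mu>)
     in inverse (f (\<lambda>_. 0)) * (\<Sum>k\<le>sz \<nu>. (h [^]\<^bsub>R\<^esub> k) \<nu>))"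

text \<open>Geometric series: \<open>f = c (1 - h)\<close>, where \<open>h\<close> has no constant term.\<close>

lemma mult_series_inverse:
  assumes f: "f \<in> carrier R" "f (\<lambda>_. 0) \<noteq> 0"
  shows "f \<odot> series_inverse f = \<one>\<^bsub>R\<^esub>"
proof
  fix \<mu>
  define c where "c = f (\<lambda>_. 0)"
  define h where "h = (\<lambda>\<mu>. \<one>\<^bsub>R\<^esub> \<mu> - inverse c * f \<mu>)"
  have c: "c \<noteq> 0" using f by (simp add: c_def)
  have h: "h \<in> carrier R"
    using f one_real_series_closed by (simp add: h_def carrier_real_series)
  show "(f \<odot> series_inverse f) \<mu> = \<one>\<^bsub>R\<^esub> \<mu>"
  proof (cases "\<mu> \<in> Exps")
    case \<mu>: True
    have small: "(h [^]\<^bsub>R\<^esub> k) \<nu> = 0" if "sz \<nu> < k" "\<nu> \<in> Exps" for k :: nat and \<nu>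
    proof -
      have "h \<mu> = 0" if "sz \<mu> < 1" for \<mu>
      proof (cases "\<mu> \<in> Exps")
        case True
        with that have "\<mu> = (\<lambda>_. 0)" by (auto simp: exponents_def fun_eq_iff not_less[symmetric])
        then show ?thesis using c by (simp add: h_def one_real_series c_def)
      qed (use h in \<open>simp add: carrier_real_series\<close>)
      then have "vanishes_below 1 h" by (simp only: vanishes_below_def) blast
      then have "vanishes_below k (h [^]\<^bsub>R\<^esub> k)" for k :: nat
      proof (induction k)
        case (Suc k)
        then show ?case using vanishes_below_mult[of k "h [^]\<^bsub>R\<^esub> k" 1 h] by simp
      qed simp
      with that show ?thesis by (simp add: vanishes_below_def)
    qed
    \<comment> \<open>Multiplication by f turns a power of h into c times a difference of
      consecutive powers, so the sum will telescope.\<close>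
    have step: "f \<odot> (h [^]\<^bsub>R\<^esub> k) = (\<lambda>\<nu>. c * ((h [^]\<^bsub>R\<^esub> k) \<nu> - (h [^]\<^bsub>R\<^esub> Suc k) \<nu>))" for k :: nat
    proof -
      have "\<one>\<^bsub>R\<^esub> = (\<lambda>\<nu>. inverse c * f \<nu>) \<oplus>\<^bsub>R\<^esub> h" by (simp add: h_def add_real_series)
      moreover have "(\<lambda>\<nu>. inverse c * f \<nu>) \<in> carrier R" using f by (simp add: carrier_real_series)
      ultimately have "h [^]\<^bsub>R\<^esub> k =
          (\<lambda>\<nu>. inverse c * f \<nu>) \<odot> h [^]\<^bsub>R\<^esub> k \<oplus>\<^bsub>R\<^esub> h \<odot> h [^]\<^bsub>R\<^esub> k"
        using h by (metis l_distr l_one nat_pow_closed)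
      moreover have "h \<odot> h [^]\<^bsub>R\<^esub> k = h [^]\<^bsub>R\<^esub> Suc k"
        by (rule nat_pow_Suc2[OF h, symmetric])
      ultimately have "(h [^]\<^bsub>R\<^esub> k) \<nu> =
          inverse c * (f \<odot> h [^]\<^bsub>R\<^esub> k) \<nu> + (h [^]\<^bsub>R\<^esub> Suc k) \<nu>" for \<nu>
        by (metis mult_real_series_scale_left add_real_series)
      then show ?thesis using c by (auto simp: fun_eq_iff field_simps)
    qed
    \<comment> \<open>The cut-off in \<open>series_inverse\<close> varies with the exponent. Below
      \<mu> it can be replaced by \<open>sz \<mu>\<close> throughout, which makes the inverse one
      finite sum of series.\<close>
    have "(f \<odot> series_inverse f) \<mu> =
        (f \<odot> (\<lambda>\<nu>. \<Sum>k\<le>sz \<mu>. inverse c * (h [^]\<^bsub>R\<^esub> k) \<nu>)) \<mu>"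
    proof (rule mult_real_series_cong)
      fix \<nu> assume \<nu>: "\<nu> \<le> \<mu>"
      then have "sz \<nu> \<le> sz \<mu>" by (auto simp: le_fun_def intro: sum_mono)
      moreover have "\<nu> \<in> Exps" using exponents_le \<mu> \<nu> by blast
      ultimately have "(\<Sum>k\<le>sz \<nu>. (h [^]\<^bsub>R\<^esub> k) \<nu>) = (\<Sum>k\<le>sz \<mu>. (h [^]\<^bsub>R\<^esub> k) \<nu>)"
        using small by (intro sum.mono_neutral_left) auto
      then show "series_inverse f \<nu> = (\<Sum>k\<le>sz \<mu>. inverse c * (h [^]\<^bsub>R\<^esub> k) \<nu>)"
        by (simp add: series_inverse_def c_def h_def Let_def sum_distrib_left[symmetric])
    qed simp
    also have "\<dots> = (\<Sum>k\<le>sz \<mu>. (h [^]\<^bsub>R\<^esub> k) \<mu> - (h [^]\<^bsub>R\<^esub> Suc k) \<mu>)"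
      by (simp only: mult_real_series_sum_right step mult.assoc[symmetric] left_inverse[OF c] mult_1_left)
    also have "\<dots> = (h [^]\<^bsub>R\<^esub> (0::nat)) \<mu> - (h [^]\<^bsub>R\<^esub> Suc (sz \<mu>)) \<mu>"
      by (rule sum_telescope)
    also have "\<dots> = \<one>\<^bsub>R\<^esub> \<mu>"
      using small[of \<mu> "Suc (sz \<mu>)"] \<mu> by simp
    finally show ?thesis .
  qed (auto simp: mult_real_series one_real_series)
qed

context
  fixes p :: nat and W :: "(nat \<Rightarrow> real) set"
  assumes W: "openin (Euclidean_space p) W"
begin

text \<open>The constant term of G is recorded as non-vanishing so that G in turn has a right
  inverse.\<close>

lemma series_right_inverse:
  assumes F: "F \<in> carrier (series_algebra p q deg W)" and nz: "\<And>x. x \<in> W \<Longrightarrow> F (\<lambda>_. 0) x \<noteq> 0"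
  obtains G where "G \<in> carrier (series_algebra p q deg W)"
    "F \<otimes>\<^bsub>series_algebra p q deg W\<^esub> G = \<one>\<^bsub>series_algebra p q deg W\<^esub>"
    "\<And>x. x \<in> W \<Longrightarrow> G (\<lambda>_. 0) x \<noteq> 0"
proof
  let ?A = "series_algebra p q deg W"
  interpret A: ring ?A by (rule ring_series_algebra[OF W])
  let ?G = "\<lambda>\<mu> x. if \<mu> \<in> Exps \<and> x \<in> W then series_inverse (\<lambda>\<nu>. F \<nu> x) \<mu> else 0"
  \<comment> \<open>The section whose value at each point of W is the h of the geometric series. Its
    powers are formed in the algebra of sections, so smoothness of the inverse follows from
    closedness under products.\<close>
  let ?H = "\<lambda>\<mu> x. if \<mu> \<in> Exps \<and> x \<in> W then \<one>\<^bsub>R\<^esub> \<mu> + (- 1) * (inverse (F (\<lambda>_. 0) x) * F \<mu> x) else 0"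
  have inv: "smooth_on p W (\<lambda>x. inverse (F (\<lambda>_. 0) x))"
    using F nz by (intro smooth_on_inverse[OF W]) (auto simp: carrier_series_algebra)
  have H: "?H \<in> carrier ?A"
    using F by (intro series_algebraI[OF W] smooth_on_add[OF W] smooth_on_mult[OF W] smooth_on_const[OF W] inv)
      (simp add: carrier_series_algebra)
  have H_at: "(\<lambda>\<mu>. ?H \<mu> x) = (\<lambda>\<mu>. \<one>\<^bsub>R\<^esub> \<mu> - inverse (F (\<lambda>_. 0) x) * F \<mu> x)" if "x \<in> W" for x
    using F that one_real_series_closed by (auto simp: fun_eq_iff carrier_series_algebra carrier_real_series)
  have pow: "(?H [^]\<^bsub>?A\<^esub> k) \<mu> x = ((\<lambda>\<mu>. \<one>\<^bsub>R\<^esub> \<mu> - inverse (F (\<lambda>_. 0) x) * F \<mu> x) [^]\<^bsub>R\<^esub> k) \<mu>"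
    if "x \<in> W" for k :: nat and x \<mu>
    using fun_cong[OF ring_hom_nat_pow[OF ring_series_algebra[OF W] evaluation_hom[OF W that] H], of k \<mu>]
    by (simp only: H_at[OF that])
  show G: "?G \<in> carrier ?A"
  proof (rule series_algebraI[OF W])
    fix \<mu> assume "\<mu> \<in> Exps"
    then have "smooth_on p W (\<lambda>x. inverse (F (\<lambda>_. 0) x) * (\<Sum>k\<le>sz \<mu>. (?H [^]\<^bsub>?A\<^esub> k) \<mu> x))"
      using A.nat_pow_closed[OF H]
      by (intro smooth_on_mult[OF W inv] smooth_on_sum[OF W]) (simp add: carrier_series_algebra)
    then show "smooth_on p W (\<lambda>x. series_inverse (\<lambda>\<nu>. F \<nu> x) \<mu>)"
      by (rule smooth_on_cong[OF W]) (simp add: pow series_inverse_def Let_def)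
  qed
  have prod: "(\<lambda>\<mu>. F \<mu> x) \<odot> (\<lambda>\<mu>. ?G \<mu> x) = \<one>\<^bsub>R\<^esub>" if x: "x \<in> W" for x
  proof -
    have "((\<lambda>\<mu>. F \<mu> x) \<odot> (\<lambda>\<mu>. ?G \<mu> x)) \<mu> = \<one>\<^bsub>R\<^esub> \<mu>" for \<mu>
    proof (cases "\<mu> \<in> Exps")
      case True
      have "((\<lambda>\<mu>. F \<mu> x) \<odot> (\<lambda>\<mu>. ?G \<mu> x)) \<mu> =
          ((\<lambda>\<mu>. F \<mu> x) \<odot> series_inverse (\<lambda>\<nu>. F \<nu> x)) \<mu>"
        using True x exponents_le by (intro mult_real_series_cong) auto
      then show ?thesis
        using mult_series_inverse[OF carrier_at[OF F]] nz x by simp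
    qed (auto simp: mult_real_series one_real_series)
    then show ?thesis by blast
  qed
  show "F \<otimes>\<^bsub>?A\<^esub> ?G = \<one>\<^bsub>?A\<^esub>"
  proof (intro ext)
    fix \<mu> x show "(F \<otimes>\<^bsub>?A\<^esub> ?G) \<mu> x = \<one>\<^bsub>?A\<^esub> \<mu> x"
    proof (cases "x \<in> W")
      case True
      then show ?thesis
        using fun_cong[OF prod[OF True], of \<mu>] by (simp add: mult_series_algebra one_series_algebra)
    next
      case False
      then show ?thesis
        using F by (simp add: mult_series_algebra one_series_algebra carrier_series_algebra zero_mult_real_series)
    qed
  qed
  show "?G (\<lambda>_. 0) x \<noteq> 0" if "x \<in> W" for x
    using nz[OF that] that by (simp add: series_inverse_def one_real_series)
qed

lemma Units_series_algebra:
  "F \<in> Units (series_algebra p q deg W) \<longleftrightarrow>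
     F \<in> carrier (series_algebra p q deg W) \<and> (\<forall>x\<in>W. F (\<lambda>_. 0) x \<noteq> 0)" (is "_ \<in> Units ?A \<longleftrightarrow> _")
proof
  interpret A: ring ?A by (rule ring_series_algebra[OF W])
  assume "F \<in> carrier ?A \<and> (\<forall>x\<in>W. F (\<lambda>_. 0) x \<noteq> 0)"
  then have F: "F \<in> carrier ?A" "\<And>x. x \<in> W \<Longrightarrow> F (\<lambda>_. 0) x \<noteq> 0" by auto
  obtain G where G: "G \<in> carrier ?A" "F \<otimes>\<^bsub>?A\<^esub> G = \<one>\<^bsub>?A\<^esub>" "\<And>x. x \<in> W \<Longrightarrow> G (\<lambda>_. 0) x \<noteq> 0"
    using series_right_inverse[OF F] by blast
  obtain H where H: "H \<in> carrier ?A" "G \<otimes>\<^bsub>?A\<^esub> H = \<one>\<^bsub>?A\<^esub>"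
    using series_right_inverse[OF G(1,3)] by blast
  \<comment> \<open>The ring need not be commutative, so a right inverse is not enough. As the right
    inverse of G turns out to be F, the section G is also a left inverse.\<close>
  have "F = H" using F(1) G(1,2) H by (metis A.m_assoc A.l_one A.r_one)
  with F(1) G H show "F \<in> Units ?A" by (auto simp: Units_def)
next
  assume "F \<in> Units ?A"
  then obtain G where G: "F \<in> carrier ?A" "F \<otimes>\<^bsub>?A\<^esub> G = \<one>\<^bsub>?A\<^esub>" by (auto simp: Units_def)
  have "F (\<lambda>_. 0) x \<noteq> 0" if "x \<in> W" for x
  proof
    assume "F (\<lambda>_. 0) x = 0"
    \<comment> \<open>Only the zero exponent lies below the zero exponent, so constant terms
      multiply.\<close>
    then have "(F \<otimes>\<^bsub>?A\<^esub> G) (\<lambda>_. 0) x = 0"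
      unfolding mult_series_algebra mult_real_series
    proof -
      have "\<nu> = (\<lambda>_. 0)" if "\<nu> \<le> (\<lambda>_. 0)" for \<nu> :: "nat \<Rightarrow> nat"
        using le_funD[OF that] by auto
      then have "F \<nu> x = 0" if "\<nu> \<le> (\<lambda>_. 0)" for \<nu>
        using that \<open>F (\<lambda>_. 0) x = 0\<close> by metis
      then show "(if (\<lambda>_. 0) \<in> Exps then \<Sum>\<nu> | \<nu> \<le> (\<lambda>_. 0). sg \<nu> (\<lambda>a. 0 - \<nu> a) * F \<nu> x * G (\<lambda>a. 0 - \<nu> a) x else 0) = 0"
        by (auto intro!: sum.neutral)
    qed
    with G that show False by (simp add: one_series_algebra one_real_series)
  qed
  with G show "F \<in> carrier ?A \<and> (\<forall>x\<in>W. F (\<lambda>_. 0) x \<noteq> 0)" by blast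
qed

end

end


section \<open>The ringed space of series\<close>

context graded_variables
begin

lemma series_space_simps:
  "points (series_space p q deg U) = subtopology (Euclidean_space p) U"
  "sections (series_space p q deg U) = series_algebra p q deg"
  "restr (series_space p q deg U) V W F = (\<lambda>\<mu> x. if x \<in> W then F \<mu> x else 0)"
  by (simp_all add: series_space_def)

lemma open_subspace_series_space:
  "open_subspace (series_space p q deg U) W = series_space p q deg (U \<inter> W)"
  by (simp add: open_subspace_def series_space_def subtopology_subtopology)

lemma restrict_closed:
  assumes V: "openin (Euclidean_space p) V" and W: "openin (Euclidean_space p) W" "W \<subseteq> V"
    and F: "F \<in> carrier (series_algebra p q deg V)"
  shows "(\<lambda>\<mu> x. if x \<in> W then F \<mu> x else 0) \<in> carrier (series_algebra p q deg W)"
proof -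
  have "smooth_on p W (\<lambda>x. if x \<in> W then F \<mu> x else 0)" if "\<mu> \<in> Exps" for \<mu>
    using F that smooth_on_subset[OF V _ W]
    by - (rule smooth_on_cong[OF W(1), of "F \<mu>"]; auto simp: carrier_series_algebra)
  moreover have "F \<mu> x = 0" if "\<mu> \<notin> Exps" for \<mu> x
    using F that by (simp add: carrier_series_algebra)
  ultimately show ?thesis unfolding carrier_series_algebra by auto
qed

lemma restrict_hom:
  assumes V: "openin (Euclidean_space p) V" and W: "openin (Euclidean_space p) W" "W \<subseteq> V"
  shows "Z2n_algebra_hom (series_algebra p q deg V) (series_algebra p q deg W)
           (\<lambda>F \<mu> x. if x \<in> W then F \<mu> x else 0)"
  unfolding Z2n_algebra_hom_def
proof (intro conjI allI ballI subsetI)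
  show "(\<lambda>F \<mu> x. if x \<in> W then F \<mu> x else 0) \<in>
      ring_hom (series_algebra p q deg V) (series_algebra p q deg W)"
  proof (rule ring_hom_memI)
    fix F G
    show "(\<lambda>\<mu> x. if x \<in> W then (F \<otimes>\<^bsub>series_algebra p q deg V\<^esub> G) \<mu> x else 0) =
        (\<lambda>\<mu> x. if x \<in> W then F \<mu> x else 0) \<otimes>\<^bsub>series_algebra p q deg W\<^esub>
        (\<lambda>\<mu> x. if x \<in> W then G \<mu> x else 0)"
      by (auto simp: mult_series_algebra zero_mult_real_series fun_eq_iff)
  qed (use restrict_closed[OF V W] W in
      \<open>auto simp: add_series_algebra one_series_algebra fun_eq_iff\<close>)
  fix i F assume "F \<in> (\<lambda>F \<mu> x. if x \<in> W then F \<mu> x else 0) ` component (series_algebra p q deg V) i"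
  then show "F \<in> component (series_algebra p q deg W) i"
    using restrict_closed[OF V W] by (auto simp: component_series_algebra)
qed (auto simp: scale_series_algebra fun_eq_iff)

context
  fixes p :: nat and U :: "(nat \<Rightarrow> real) set"
  assumes U: "openin (Euclidean_space p) U"
begin

lemma openin_points:
  "openin (points (series_space p q deg U)) V \<longleftrightarrow> openin (Euclidean_space p) V \<and> V \<subseteq> U"
  using openin_open_subtopology[OF U] by (simp add: series_space_simps)

lemma topspace_points: "topspace (points (series_space p q deg U)) = U"
  using openin_subset[OF U] by (auto simp: series_space_simps)

text \<open>Sections are glued pointwise, smoothness being local. Uniqueness rests on the convention
  that coefficients are 0 outside their domain.\<close>

lemma sheaf_series_space: "Z2n_sheaf (series_space p q deg U)"
  unfolding Z2n_sheaf_def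
proof (intro conjI allI impI)
  show "Z2n_presheaf (series_space p q deg U)"
    unfolding Z2n_presheaf_def openin_points
  proof (intro conjI allI impI ballI)
    fix V assume "openin (Euclidean_space p) V \<and> V \<subseteq> U"
    then show "Z2n_commutative_algebra (sections (series_space p q deg U) V)"
      using Z2n_commutative_series_algebra by (simp add: series_space_simps)
  next
    fix V W
    assume "(openin (Euclidean_space p) V \<and> V \<subseteq> U) \<and> (openin (Euclidean_space p) W \<and> W \<subseteq> U) \<and> W \<subseteq> V"
    then show "Z2n_algebra_hom (sections (series_space p q deg U) V)
        (sections (series_space p q deg U) W) (restr (series_space p q deg U) V W)"
      using restrict_hom by (simp add: series_space_def)
  qed (auto simp: series_space_simps carrier_series_algebra fun_eq_iff)
  fix \<V> s
  assume asm: "(\<forall>V\<in>\<V>. openin (points (series_space p q deg U)) V \<and>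
      s V \<in> carrier (sections (series_space p q deg U) V)) \<and>
    (\<forall>V\<in>\<V>. \<forall>W\<in>\<V>. restr (series_space p q deg U) V (V \<inter> W) (s V) =
      restr (series_space p q deg U) W (V \<inter> W) (s W))"
  then have V: "\<And>V. V \<in> \<V> \<Longrightarrow> openin (Euclidean_space p) V"
    and s: "\<And>V. V \<in> \<V> \<Longrightarrow> s V \<in> carrier (series_algebra p q deg V)"
    unfolding openin_points series_space_simps(2) by auto
  have compat: "s V \<mu> x = s W \<mu> x" if "V \<in> \<V>" "W \<in> \<V>" "x \<in> V" "x \<in> W" for V W \<mu> x
  proof -
    have "restr (series_space p q deg U) V (V \<inter> W) (s V) =
        restr (series_space p q deg U) W (V \<inter> W) (s W)"
      using asm that(1,2) by blast
    then have "restr (series_space p q deg U) V (V \<inter> W) (s V) \<mu> x =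
        restr (series_space p q deg U) W (V \<inter> W) (s W) \<mu> x"
      by simp
    then show ?thesis using that(3,4) by (simp add: series_space_simps)
  qed
  \<comment> \<open>Any member of the cover that contains x may supply the value;
    \<open>compat\<close> makes the choice immaterial.\<close>
  define t where "t \<mu> x = (if x \<in> \<Union>\<V> then s (SOME V. V \<in> \<V> \<and> x \<in> V) \<mu> x else 0)" for \<mu> x
  have t: "t \<mu> x = s V \<mu> x" if "V \<in> \<V>" "x \<in> V" for V \<mu> x
  proof -
    have "(SOME V. V \<in> \<V> \<and> x \<in> V) \<in> \<V> \<and> x \<in> (SOME V. V \<in> \<V> \<and> x \<in> V)"
      using that by (intro someI[where P = "\<lambda>V. V \<in> \<V> \<and> x \<in> V"]) auto
    moreover have "x \<in> \<Union>\<V>" using that by blast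
    ultimately show ?thesis
      unfolding t_def using compat[OF _ that(1) _ that(2)] by (simp only: if_True)
  qed
  have t_closed: "t \<in> carrier (series_algebra p q deg (\<Union>\<V>))"
    unfolding carrier_series_algebra
  proof (intro conjI ballI allI impI)
    fix \<mu> assume \<mu>: "\<mu> \<in> Exps"
    show "smooth_on p (\<Union>\<V>) (t \<mu>)"
    proof (rule smooth_on_local[OF V])
      fix V assume V': "V \<in> \<V>"
      have "smooth_on p V (s V \<mu>)" using s[OF V'] \<mu> by (simp add: carrier_series_algebra)
      then show "smooth_on p V (t \<mu>)"
        by (rule smooth_on_cong[OF V[OF V']]) (simp add: t[OF V'])
    qed
  next
    fix \<mu> x assume off: "\<mu> \<notin> Exps \<or> x \<notin> \<Union>\<V>"
    show "t \<mu> x = 0"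
    proof (cases "x \<in> \<Union>\<V>")
      case True
      then obtain V where V': "V \<in> \<V>" "x \<in> V" by blast
      have "\<mu> \<notin> Exps" using off True by blast
      then show ?thesis using t[OF V'] s[OF V'(1)] by (simp add: carrier_series_algebra)
    qed (simp add: t_def)
  qed
  show "\<exists>!t. t \<in> carrier (sections (series_space p q deg U) (\<Union>\<V>)) \<and>
      (\<forall>V\<in>\<V>. restr (series_space p q deg U) (\<Union>\<V>) V t = s V)"
  proof (rule ex1I[of _ t])
    have "(if x \<in> V then t \<mu> x else 0) = s V \<mu> x" if "V \<in> \<V>" for V \<mu> x
      using t[OF that] s[OF that] by (auto simp: carrier_series_algebra)
    then show "t \<in> carrier (sections (series_space p q deg U) (\<Union>\<V>)) \<and>
        (\<forall>V\<in>\<V>. restr (series_space p q deg U) (\<Union>\<V>) V t = s V)"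
      using t_closed by (simp add: series_space_simps)
    fix t' assume t': "t' \<in> carrier (sections (series_space p q deg U) (\<Union>\<V>)) \<and>
        (\<forall>V\<in>\<V>. restr (series_space p q deg U) (\<Union>\<V>) V t' = s V)"
    show "t' = t"
    proof (intro ext)
      fix \<mu> x
      show "t' \<mu> x = t \<mu> x"
      proof (cases "x \<in> \<Union>\<V>")
        case True
        then obtain V where V: "V \<in> \<V>" "x \<in> V" by blast
        with t' have "restr (series_space p q deg U) (\<Union>\<V>) V t' \<mu> x = s V \<mu> x" by simp
        with V show ?thesis by (simp add: series_space_simps t[OF V])
      next
        case False
        with t' show ?thesis by (auto simp: t_def series_space_simps carrier_series_algebra)
      qed
    qed
  qed
qed

text \<open>Being a unit over a neighbourhood means that the constant term has no zero there. By
  continuity, a constant term that does not vanish at x does not vanish near x.\<close>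

lemma unit_germ_series_space:
  assumes V: "openin (Euclidean_space p) V" "V \<subseteq> U" and x: "x \<in> V"
    and F: "F \<in> carrier (series_algebra p q deg V)"
  shows "unit_germ (series_space p q deg U) x V F \<longleftrightarrow> F (\<lambda>_. 0) x \<noteq> 0"
proof
  assume "unit_germ (series_space p q deg U) x V F"
  then obtain N where N: "openin (Euclidean_space p) N" "x \<in> N"
      "(\<lambda>\<mu> x. if x \<in> N then F \<mu> x else 0) \<in> Units (series_algebra p q deg N)"
    unfolding unit_germ_def openin_points series_space_simps(2,3) by blast
  then show "F (\<lambda>_. 0) x \<noteq> 0" by (auto simp: Units_series_algebra[OF N(1)])
next
  assume nz: "F (\<lambda>_. 0) x \<noteq> 0"
  define N where "N = {y \<in> V. F (\<lambda>_. 0) y \<in> - {0}}"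
  have "continuous_on V (F (\<lambda>_. 0))"
    using F by (intro smooth_on_continuous[OF V(1)]) (simp add: carrier_series_algebra)
  then have "continuous_map (subtopology (Euclidean_space p) V) euclideanreal (F (\<lambda>_. 0))"
    by (simp add: continuous_map_Euclidean[OF openin_subset[OF V(1)]])
  then have "openin (subtopology (Euclidean_space p) V)
      {y \<in> topspace (subtopology (Euclidean_space p) V). F (\<lambda>_. 0) y \<in> - {0}}"
    by (rule openin_continuous_map_preimage) auto
  moreover have "topspace (subtopology (Euclidean_space p) V) = V"
    using openin_subset[OF V(1)] by auto
  ultimately have "openin (subtopology (Euclidean_space p) V) N" by (simp only: N_def)
  then have N: "openin (Euclidean_space p) N" "N \<subseteq> V"
    by (simp_all add: openin_open_subtopology[OF V(1)])
  have "(\<lambda>\<mu> x. if x \<in> N then F \<mu> x else 0) \<in> Units (series_algebra p q deg N)"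
    unfolding Units_series_algebra[OF N(1)] using restrict_closed[OF V(1) N F] by (simp add: N_def)
  moreover have "x \<in> N" using x nz by (simp add: N_def)
  ultimately show "unit_germ (series_space p q deg U) x V F"
    using N V unfolding unit_germ_def openin_points series_space_simps(2,3) by blast
qed

text \<open>The non-units at x are the germs whose constant term vanishes at x, a condition stable
  under addition.\<close>

lemma locally_Z2n_ringed_series_space: "locally_Z2n_ringed_space (series_space p q deg U)"
  unfolding locally_Z2n_ringed_space_def
proof (intro conjI ballI)
  fix x assume "x \<in> topspace (points (series_space p q deg U))"
  show "local_stalk (series_space p q deg U) x"
    unfolding local_stalk_def openin_points
  proof (intro allI impI)
    fix V assume V: "(openin (Euclidean_space p) V \<and> V \<subseteq> U) \<and> x \<in> V"
    let ?A = "series_algebra p q deg V"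
    have "\<one>\<^bsub>?A\<^esub> (\<lambda>_. 0) x \<noteq> \<zero>\<^bsub>?A\<^esub> (\<lambda>_. 0) x"
      using V by (simp add: one_series_algebra zero_series_algebra one_real_series)
    then have "\<one>\<^bsub>?A\<^esub> \<noteq> \<zero>\<^bsub>?A\<^esub>" by metis
    moreover have "\<not> unit_germ (series_space p q deg U) x V (F \<oplus>\<^bsub>?A\<^esub> G)"
      if "F \<in> carrier ?A" "G \<in> carrier ?A"
        "\<not> unit_germ (series_space p q deg U) x V F" "\<not> unit_germ (series_space p q deg U) x V G" for F G
    proof -
      have "F \<oplus>\<^bsub>?A\<^esub> G \<in> carrier ?A" using V that by (intro add_series_algebra_closed) auto
      then show ?thesis
        using V that unit_germ_series_space[of V x] by (simp add: add_series_algebra)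
    qed
    ultimately show "\<one>\<^bsub>sections (series_space p q deg U) V\<^esub> \<noteq> \<zero>\<^bsub>sections (series_space p q deg U) V\<^esub> \<and>
      (\<forall>s\<in>carrier (sections (series_space p q deg U) V). \<forall>t\<in>carrier (sections (series_space p q deg U) V).
         \<not> unit_germ (series_space p q deg U) x V s \<and> \<not> unit_germ (series_space p q deg U) x V t \<longrightarrow>
         \<not> unit_germ (series_space p q deg U) x V (s \<oplus>\<^bsub>sections (series_space p q deg U) V\<^esub> t))"
      by (simp add: series_space_simps)
  qed
qed (rule sheaf_series_space)

end


section \<open>Coordinate transformations\<close>

text \<open>The family Y is given once for all points of U, whereas \<open>substitute\<close> takes
  sections over each preimage anew. \<open>substitute_eq_pullback\<close> relates the two.\<close>

definition pullback ::
  "(nat \<Rightarrow> real) set \<Rightarrow> ((nat \<Rightarrow> real) \<Rightarrow> (nat \<Rightarrow> real)) \<Rightarrow>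
   ((nat \<Rightarrow> real) \<Rightarrow> nat \<Rightarrow> (nat \<Rightarrow> nat) \<Rightarrow> real) \<Rightarrow> (nat \<Rightarrow> real) set \<Rightarrow> series \<Rightarrow> series" where
  "pullback U \<phi> Y W s = (\<lambda>\<nu> x. if x \<in> U \<and> \<phi> x \<in> W
     then subst_series (Y x) (\<lambda>\<mu>. s \<mu> (\<phi> x)) \<nu> else 0)"

definition transformation ::
  "nat \<Rightarrow> (nat \<Rightarrow> real) set \<Rightarrow> (nat \<Rightarrow> real) set \<Rightarrow> ((nat \<Rightarrow> real) \<Rightarrow> (nat \<Rightarrow> real)) \<Rightarrow>
   ((nat \<Rightarrow> real) \<Rightarrow> nat \<Rightarrow> (nat \<Rightarrow> nat) \<Rightarrow> real) \<Rightarrow> bool" where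
  "transformation p U U' \<phi> Y \<longleftrightarrow>
     openin (Euclidean_space p) U \<and> openin (Euclidean_space p) U' \<and> \<phi> \<in> U \<rightarrow> U' \<and>
     (\<forall>j<p. smooth_on p U (\<lambda>x. \<phi> x j)) \<and> (\<forall>x\<in>U. substitutable (Y x)) \<and>
     (\<forall>a<q. \<forall>\<mu>\<in>Exps. smooth_on p U (\<lambda>x. Y x a \<mu>))"

context
  fixes p :: nat and U U' :: "(nat \<Rightarrow> real) set" and \<phi> :: "(nat \<Rightarrow> real) \<Rightarrow> (nat \<Rightarrow> real)"
    and Y :: "(nat \<Rightarrow> real) \<Rightarrow> nat \<Rightarrow> (nat \<Rightarrow> nat) \<Rightarrow> real"
  assumes T: "transformation p U U' \<phi> Y"
begin

lemma transformationD:
  "openin (Euclidean_space p) U" "openin (Euclidean_space p) U'" "\<phi> \<in> U \<rightarrow> U'"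
  "j < p \<Longrightarrow> smooth_on p U (\<lambda>x. \<phi> x j)" "x \<in> U \<Longrightarrow> substitutable (Y x)"
  "a < q \<Longrightarrow> \<mu> \<in> Exps \<Longrightarrow> smooth_on p U (\<lambda>x. Y x a \<mu>)"
  using T by (auto simp: transformation_def)

lemma transformation_continuous_on: "continuous_on U \<phi>"
proof (rule continuous_on_coordinates)
  show "\<phi> \<in> U \<rightarrow> topspace (Euclidean_space p)"
    using transformationD(3) openin_subset[OF transformationD(2)] by blast
  show "continuous_on U (\<lambda>x. \<phi> x j)" if "j < p" for j
    by (rule smooth_on_continuous[OF transformationD(1) transformationD(4)[OF that]])
qed

lemma transformation_continuous:
  "continuous_map (subtopology (Euclidean_space p) U) (subtopology (Euclidean_space p) U') \<phi>"
  using transformation_continuous_on transformationD(3)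
  by (simp add: subtopology_Euclidean openin_subset[OF transformationD(1)] openin_subset[OF transformationD(2)]
      continuous_map_in_subtopology image_subset_iff_funcset)

lemma open_preimage:
  assumes "openin (Euclidean_space p) W" "W \<subseteq> U'"
  shows "openin (Euclidean_space p) {x \<in> U. \<phi> x \<in> W}"
proof -
  have "openin (subtopology (Euclidean_space p) U)
      {x \<in> topspace (subtopology (Euclidean_space p) U). \<phi> x \<in> W}"
    using assms openin_open_subtopology[OF transformationD(2)]
    by (intro openin_continuous_map_preimage[OF transformation_continuous]) auto
  moreover have "topspace (subtopology (Euclidean_space p) U) = U"
    using openin_subset[OF transformationD(1)] by auto
  ultimately show ?thesis by (simp only: openin_open_subtopology[OF transformationD(1)])
qed

context
  fixes W :: "(nat \<Rightarrow> real) set" and YW :: "nat \<Rightarrow> series"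
  assumes W: "openin (Euclidean_space p) W" "W \<subseteq> U"
    and YW: "\<And>a \<mu> x. a < q \<Longrightarrow> YW a \<mu> x = (if x \<in> W then Y x a \<mu> else 0)"
begin

lemma YW_closed:
  assumes a: "a < q"
  shows "YW a \<in> carrier (series_algebra p q deg W)"
proof -
  have "smooth_on p W (YW a \<mu>)" if "\<mu> \<in> Exps" for \<mu>
    using smooth_on_subset[OF transformationD(1) transformationD(6)[OF a that] W] YW[OF a]
    by - (rule smooth_on_cong[OF W(1), of "\<lambda>x. Y x a \<mu>"]; auto)
  moreover have "YW a \<mu> x = 0" if "\<mu> \<notin> Exps \<or> x \<notin> W" for \<mu> x
    using that YW[OF a] transformationD(5)[of x] W(2) a
    by (auto simp: substitutable_def homogeneous_def carrier_real_series)
  ultimately show ?thesis by (auto simp: carrier_series_algebra)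
qed

text \<open>Evaluation at a point is a ring homomorphism, so it turns the products occurring in
  \<open>substitute\<close> into \<open>powers\<close> of real series.\<close>

lemma ordered_product_powers:
  "ordered_product (series_algebra p q deg W) (map (\<lambda>a. YW a [^]\<^bsub>series_algebra p q deg W\<^esub> \<mu> a) [0..<q]) =
     (\<lambda>\<nu> x. if x \<in> W then powers (Y x) q \<mu> \<nu> else 0)" (is "ordered_product ?A ?l = _")
  and ordered_product_powers_closed:
  "ordered_product (series_algebra p q deg W) (map (\<lambda>a. YW a [^]\<^bsub>series_algebra p q deg W\<^esub> \<mu> a) [0..<q])
     \<in> carrier (series_algebra p q deg W)"
proof -
  interpret A: ring ?A by (rule ring_series_algebra[OF W(1)])
  have l: "set ?l \<subseteq> carrier ?A" using YW_closed by auto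
  show cl: "ordered_product ?A ?l \<in> carrier ?A" by (rule A.ordered_product_closed[OF l])
  have on: "ordered_product ?A ?l \<nu> x = powers (Y x) q \<mu> \<nu>" if x: "x \<in> W" for \<nu> x
  proof -
    note hom = evaluation_hom[OF W(1) x]
    have "(\<lambda>\<nu>. (YW a [^]\<^bsub>?A\<^esub> \<mu> a) \<nu> x) = Y x a [^]\<^bsub>R\<^esub> \<mu> a" if "a < q" for a
      using ring_hom_nat_pow[OF ring_series_algebra[OF W(1)] hom YW_closed[OF that], of "\<mu> a"] x YW[OF that]
      by simp
    then have "map (\<lambda>F \<nu>. F \<nu> x) ?l = map (\<lambda>a. Y x a [^]\<^bsub>R\<^esub> \<mu> a) [0..<q]" by simp
    then have "(\<lambda>\<nu>. ordered_product ?A ?l \<nu> x) = powers (Y x) q \<mu>"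
      using ring_hom_ordered_product[OF ring_series_algebra[OF W(1)] hom l] by (simp only: powers_def)
    then show ?thesis by (rule fun_cong)
  qed
  show "ordered_product ?A ?l = (\<lambda>\<nu> x. if x \<in> W then powers (Y x) q \<mu> \<nu> else 0)"
    using on cl by (auto simp: fun_eq_iff carrier_series_algebra)
qed

text \<open>Smooth because it is a coefficient of an ordered product of sections, and the algebra of
  sections is closed under products.\<close>

lemma powers_smooth:
  assumes "\<nu> \<in> Exps"
  shows "smooth_on p W (\<lambda>x. powers (Y x) q \<mu> \<nu>)"
proof -
  have "smooth_on p W (\<lambda>x. if x \<in> W then powers (Y x) q \<mu> \<nu> else 0)"
    using ordered_product_powers_closed[of \<mu>] assms
    unfolding ordered_product_powers carrier_series_algebra by blast
  then show ?thesis by (rule smooth_on_cong[OF W(1)]) simp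
qed

lemma substitute_eq_pullback:
  assumes "W = {x \<in> U. \<phi> x \<in> W'}"
  shows "substitute p q deg W \<phi> YW s = pullback U \<phi> Y W' s"
proof (intro ext)
  fix \<nu> x
  have set: "{\<mu>. \<mu> \<in> Exps \<and> sz \<mu> \<le> sz \<nu>} = Exps_upto (sz \<nu>)" by (auto simp: Exps_upto_def)
  show "substitute p q deg W \<phi> YW s \<nu> x = pullback U \<phi> Y W' s \<nu> x"
  proof (cases "x \<in> W")
    case True
    with assms show ?thesis
      unfolding substitute_def Let_def ordered_product_powers set
      by (simp add: pullback_def subst_series_def[OF transformationD(5)])
  next
    case False
    with assms show ?thesis
      unfolding substitute_def Let_def ordered_product_powers set
      by (auto simp: pullback_def)
  qed
qed

end

lemma pullback_closed:
  assumes W': "openin (Euclidean_space p) W'" "W' \<subseteq> U'"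
    and s: "s \<in> carrier (series_algebra p q deg W')"
  shows "pullback U \<phi> Y W' s \<in> carrier (series_algebra p q deg {x \<in> U. \<phi> x \<in> W'})"
    (is "_ \<in> carrier (series_algebra p q deg ?W)")
proof -
  have W: "openin (Euclidean_space p) ?W" "?W \<subseteq> U" using open_preimage[OF W'] by auto
  have "smooth_on p ?W (pullback U \<phi> Y W' s \<nu>)" if \<nu>: "\<nu> \<in> Exps" for \<nu>
  proof (rule smooth_on_cong[OF W(1)])
    show "smooth_on p ?W (\<lambda>x. \<Sum>\<mu>\<in>Exps_upto (sz \<nu>). s \<mu> (\<phi> x) * powers (Y x) q \<mu> \<nu>)"
    proof (rule smooth_on_sum[OF W(1)], rule smooth_on_mult[OF W(1)])
      fix \<mu> assume "\<mu> \<in> Exps_upto (sz \<nu>)"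
      then have "smooth_on p W' (s \<mu>)" using s by (simp add: Exps_upto_def carrier_series_algebra)
      then show "smooth_on p ?W (\<lambda>x. s \<mu> (\<phi> x))"
        by (rule smooth_on_compose[OF W(1) W'(1), rotated 2])
          (auto intro: smooth_on_subset[OF transformationD(1) transformationD(4) W])
      show "smooth_on p ?W (\<lambda>x. powers (Y x) q \<mu> \<nu>)"
        \<comment> \<open>Through \<open>refl\<close> the sections \<open>YW\<close> become the
          family Y cut off to the preimage.\<close>
        by (rule powers_smooth[OF W refl \<nu>])
    qed
  qed (auto simp: pullback_def subst_series_def[OF transformationD(5)])
  moreover have "pullback U \<phi> Y W' s \<nu> x = 0" if "\<nu> \<notin> Exps \<or> x \<notin> ?W" for \<nu> x
    using that subst_series_closed[OF transformationD(5)] by (auto simp: pullback_def carrier_real_series)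
  ultimately show ?thesis by (auto simp: carrier_series_algebra)
qed

lemma pullback_hom:
  assumes W': "openin (Euclidean_space p) W'" "W' \<subseteq> U'"
  shows "Z2n_algebra_hom (series_algebra p q deg W') (series_algebra p q deg {x \<in> U. \<phi> x \<in> W'})
           (pullback U \<phi> Y W')" (is "Z2n_algebra_hom ?B ?A ?h")
  unfolding Z2n_algebra_hom_def
proof (intro conjI allI ballI subsetI)
  show "?h \<in> ring_hom ?B ?A"
  proof (rule ring_hom_memI)
    fix s t assume st: "s \<in> carrier ?B" "t \<in> carrier ?B"
    show "?h s \<in> carrier ?A" by (rule pullback_closed[OF W' st(1)])
    have "?h (s \<otimes>\<^bsub>?B\<^esub> t) \<nu> x = (?h s \<otimes>\<^bsub>?A\<^esub> ?h t) \<nu> x" for \<nu> x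
      using subst_series_mult[OF transformationD(5), of x "\<lambda>\<mu>. s \<mu> (\<phi> x)" "\<lambda>\<mu>. t \<mu> (\<phi> x)"]
      by (auto simp: pullback_def mult_series_algebra zero_mult_real_series)
    then show "?h (s \<otimes>\<^bsub>?B\<^esub> t) = ?h s \<otimes>\<^bsub>?A\<^esub> ?h t" by (intro ext)
    have "?h (s \<oplus>\<^bsub>?B\<^esub> t) \<nu> x = (?h s \<oplus>\<^bsub>?A\<^esub> ?h t) \<nu> x" for \<nu> x
      using subst_series_add[OF transformationD(5), of x "\<lambda>\<mu>. s \<mu> (\<phi> x)" "\<lambda>\<mu>. t \<mu> (\<phi> x)"]
      by (auto simp: pullback_def add_series_algebra add_real_series)
    then show "?h (s \<oplus>\<^bsub>?B\<^esub> t) = ?h s \<oplus>\<^bsub>?A\<^esub> ?h t" by (intro ext)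
  next
    show "?h \<one>\<^bsub>?B\<^esub> = \<one>\<^bsub>?A\<^esub>"
      using subst_series_one[OF transformationD(5)]
      by (auto simp: pullback_def one_series_algebra fun_eq_iff)
  qed
  show "?h (scale ?B r s) = scale ?A r (?h s)" for r s
    using subst_series_scale[OF transformationD(5)]
    by (auto simp: pullback_def scale_series_algebra fun_eq_iff)
  fix i t assume "t \<in> ?h ` component ?B i"
  then obtain s where s: "s \<in> component ?B i" "t = ?h s" by blast
  then show "t \<in> component ?A i"
    using pullback_closed[OF W', of s] subst_series_homogeneous[OF transformationD(5)]
    by (auto simp: component_series_algebra_iff) (auto simp: pullback_def)
qed

text \<open>Agreement with a pullback is asked for on open subsets of U' only, since that is what is
  known of the transitions of the superization. The maps of stalks are local because substitution
  preserves constant terms.\<close>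

lemma pullback_morphism:
  assumes \<Phi>: "\<And>W s. openin (Euclidean_space p) W \<Longrightarrow> W \<subseteq> U' \<Longrightarrow> \<Phi> W s = pullback U \<phi> Y W s"
  shows "Z2n_morphism (series_space p q deg U) (series_space p q deg U') \<phi> \<Phi>"
  unfolding Z2n_morphism_def openin_points[OF transformationD(2)]
proof (intro conjI allI impI ballI)
  have pre: "preimage_in (series_space p q deg U) \<phi> W = {x \<in> U. \<phi> x \<in> W}" for W
    by (simp add: preimage_in_def topspace_points[OF transformationD(1)])
  show "locally_Z2n_ringed_space (series_space p q deg U)"
    "locally_Z2n_ringed_space (series_space p q deg U')"
    by (rule locally_Z2n_ringed_series_space[OF transformationD(1)] locally_Z2n_ringed_series_space[OF transformationD(2)])+
  show "continuous_map (points (series_space p q deg U)) (points (series_space p q deg U')) \<phi>"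
    using transformation_continuous by (simp add: series_space_simps)
  show "Z2n_algebra_hom (sections (series_space p q deg U') W)
      (sections (series_space p q deg U) (preimage_in (series_space p q deg U) \<phi> W)) (\<Phi> W)"
    if W: "openin (Euclidean_space p) W \<and> W \<subseteq> U'" for W
  proof -
    have "\<Phi> W = pullback U \<phi> Y W" using \<Phi> W by blast
    then show ?thesis using pullback_hom W by (simp add: series_space_simps pre)
  qed
  show "\<Phi> N (restr (series_space p q deg U') W N s) =
      restr (series_space p q deg U) (preimage_in (series_space p q deg U) \<phi> W)
        (preimage_in (series_space p q deg U) \<phi> N) (\<Phi> W s)"
    if WN: "(openin (Euclidean_space p) W \<and> W \<subseteq> U') \<and> (openin (Euclidean_space p) N \<and> N \<subseteq> U') \<and> N \<subseteq> W"
    for W N s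
  proof -
    have "\<Phi> W = pullback U \<phi> Y W" "\<Phi> N = pullback U \<phi> Y N" using \<Phi> WN by blast+
    then show ?thesis using WN by (auto simp: series_space_simps pre pullback_def fun_eq_iff)
  qed
  fix x W s
  assume x: "x \<in> topspace (points (series_space p q deg U))"
    and W: "(openin (Euclidean_space p) W \<and> W \<subseteq> U') \<and> \<phi> x \<in> W"
    and s: "s \<in> carrier (sections (series_space p q deg U') W)"
    and unit: "unit_germ (series_space p q deg U) x (preimage_in (series_space p q deg U) \<phi> W) (\<Phi> W s)"
  have xU: "x \<in> U" using x topspace_points[OF transformationD(1)] by simp
  have s': "s \<in> carrier (series_algebra p q deg W)" using s by (simp add: series_space_simps)
  have "pullback U \<phi> Y W s (\<lambda>_. 0) x \<noteq> 0"
    using unit W xU pullback_closed[OF _ _ s'] \<Phi>[of W s] open_preimage[of W]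
    by (auto simp: pre unit_germ_series_space[OF transformationD(1)])
  then have "s (\<lambda>_. 0) (\<phi> x) \<noteq> 0"
    using W xU subst_series_at_zero[OF transformationD(5)] by (simp add: pullback_def)
  then show "unit_germ (series_space p q deg U') (\<phi> x) W s"
    using W s' by (simp add: unit_germ_series_space[OF transformationD(2)])
qed

end

end


section \<open>Lexicographic ordering\<close>

lemma lex_less_irrefl: "\<not> lex_less v v"
  by (simp add: lex_less_def)

lemma lex_less_trans:
  assumes "lex_less u v" "lex_less v w"
  shows "lex_less u w"
proof -
  obtain k where k: "u $ k < v $ k" "\<And>j. j < k \<Longrightarrow> u $ j = v $ j"
    using assms(1) by (auto simp: lex_less_def)
  obtain l where l: "v $ l < w $ l" "\<And>j. j < l \<Longrightarrow> v $ j = w $ j"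
    using assms(2) by (auto simp: lex_less_def)
  have "u $ min k l < w $ min k l"
    using k l by (cases k l rule: linorder_cases) auto
  moreover have "\<forall>j<min k l. u $ j = w $ j" using k l by auto
  ultimately show ?thesis unfolding lex_less_def by blast
qed

lemma lex_less_total:
  assumes "v \<noteq> w"
  shows "lex_less v w \<or> lex_less w v"
proof -
  let ?D = "{k. v $ k \<noteq> w $ k}"
  have D: "?D \<noteq> {}" "finite ?D" using assms by (auto simp: vec_eq_iff)
  define k where "k = Min ?D"
  have "k \<in> ?D" using Min_in[OF D(2,1)] by (simp add: k_def)
  then have "v $ k < w $ k \<or> w $ k < v $ k" by auto
  moreover have "k \<le> j" if "j \<in> ?D" for j
    using Min_le[OF D(2) that] by (simp only: k_def)
  then have "v $ j = w $ j" if "j < k" for j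
    using that by fastforce
  ultimately show ?thesis unfolding lex_less_def by metis
qed

text \<open>If the heads differed, each would precede the other in one of the lists. Together with
  \<open>ex_sorted_wrt\<close> this makes the description in \<open>lex_list\<close>
  meaningful.\<close>

lemma sorted_wrt_unique:
  assumes "\<And>a. \<not> r a a" "\<And>a b. r a b \<Longrightarrow> \<not> r b a"
  shows "sorted_wrt r xs \<Longrightarrow> sorted_wrt r ys \<Longrightarrow> set xs = set ys \<Longrightarrow> xs = ys"
proof (induction xs arbitrary: ys)
  case (Cons x xs)
  then obtain y ys' where ys: "ys = y # ys'" by (cases ys) auto
  have "x = y"
  proof (rule ccontr)
    assume "x \<noteq> y"
    then have "x \<in> set ys'" "y \<in> set xs" using Cons.prems(3) ys by auto
    then have "r y x" "r x y" using Cons.prems(1,2) ys by auto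
    then show False using assms(2) by blast
  qed
  moreover have "x \<notin> set xs" "y \<notin> set ys'" using Cons.prems(1,2) ys assms(1) by auto
  then have "set xs = set ys'" using Cons.prems(3) ys \<open>x = y\<close> by (metis Diff_insert_absorb list.simps(15))
  ultimately show ?case using Cons ys by auto
qed simp

text \<open>A new element is placed between those below and those above it. Totality is required on
  B only: among all indices the lexicographic order of weights can have ties.\<close>

lemma ex_sorted_wrt:
  assumes trans: "\<And>a b c. r a b \<Longrightarrow> r b c \<Longrightarrow> r a c" and irrefl: "\<And>a. \<not> r a a"
  shows "finite B \<Longrightarrow> (\<And>a b. a \<in> B \<Longrightarrow> b \<in> B \<Longrightarrow> a \<noteq> b \<Longrightarrow> r a b \<or> r b a) \<Longrightarrow>
    \<exists>bs. set bs = B \<and> distinct bs \<and> sorted_wrt r bs"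
proof (induction B rule: finite_induct)
  case (insert a B)
  then obtain bs where bs: "set bs = B" "distinct bs" "sorted_wrt r bs" by blast
  let ?bs = "filter (\<lambda>b. r b a) bs @ a # filter (\<lambda>b. r a b) bs"
  have "set ?bs = insert a B" using insert.prems insert.hyps(2) bs(1) by auto
  moreover have "distinct ?bs"
    using bs insert.hyps(2) irrefl trans by auto
  moreover have "sorted_wrt r ?bs"
    using bs(3) trans by (auto simp: sorted_wrt_append sorted_wrt_filter)
  ultimately show ?case by blast
qed simp


section \<open>Polynomials and series of squarefree weight\<close>

text \<open>Weights and degrees are both kept. The signs come from the degrees mod 2, but that the
  factors of a term have disjoint supports can be concluded only from sums in the natural
  numbers.\<close>

locale weighted_variables = graded_variables q deg
  for q :: nat and deg :: "nat \<Rightarrow> bit ^ 'n::finite" +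
  fixes wt :: "nat \<Rightarrow> nat ^ 'n"
  assumes wt_nonzero: "a < q \<Longrightarrow> wt a \<noteq> 0"
    and wt_le_1: "a < q \<Longrightarrow> wt a $ k \<le> 1"
    and deg_eq: "deg a = (\<chi> k. of_nat (wt a $ k))"
begin

definition squarefree_weight :: "nat ^ 'n \<Rightarrow> bool" where
  "squarefree_weight w \<longleftrightarrow> (\<forall>k. w $ k \<le> 1)"

definition terms :: "nat ^ 'n \<Rightarrow> nat set set" where
  "terms w = {B. B \<subseteq> {..<q} \<and> (\<Sum>b\<in>B. wt b) = w}"

definition indicator_exponent :: "nat set \<Rightarrow> nat \<Rightarrow> nat" where
  "indicator_exponent B a = (if a \<in> B then 1 else 0)"

abbreviation "ximon B \<equiv> monomial (indicator_exponent B)"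

section \<open>Sets of indices as monomials without repeated factors\<close>

lemma finite_terms [simp]: "finite (terms w)"
  by (rule finite_subset[of _ "Pow {..<q}"]) (auto simp: terms_def)

lemma terms_subset: "B \<in> terms w \<Longrightarrow> B \<subseteq> {..<q}"
  and terms_weight: "B \<in> terms w \<Longrightarrow> (\<Sum>b\<in>B. wt b) = w"
  by (auto simp: terms_def)

lemma terms_finite: "B \<in> terms w \<Longrightarrow> finite B"
  using finite_subset[OF terms_subset] by blast

lemma indicator_exponent_Exps: "B \<subseteq> {..<q} \<Longrightarrow> indicator_exponent B \<in> Exps"
  by (auto simp: indicator_exponent_def exponents_def)

lemma indicator_exponent_Un:
  "B \<inter> C = {} \<Longrightarrow> (\<lambda>a. indicator_exponent B a + indicator_exponent C a) = indicator_exponent (B \<union> C)"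
  by (auto simp: indicator_exponent_def fun_eq_iff)

lemma wt_component_positive:
  assumes a: "a < q"
  shows "\<exists>k. wt a $ k = 1"
proof -
  obtain k where "wt a $ k \<noteq> 0" using wt_nonzero[OF a] by (auto simp: vec_eq_iff)
  then have "wt a $ k = 1" using wt_le_1[OF a, of k] by simp
  then show ?thesis ..
qed

lemma squarefree_weight_wt: "a < q \<Longrightarrow> squarefree_weight (wt a)"
  using wt_le_1 unfolding squarefree_weight_def by blast

lemma squarefree_weight_add: "squarefree_weight (v + w) \<Longrightarrow> squarefree_weight v \<and> squarefree_weight w"
  by (auto simp: squarefree_weight_def) (metis add_leD1 add_leD2 One_nat_def)+

text \<open>A common index would count twice in a component where its weight is 1, and the total
  weight would reach 2 there.\<close>

lemma terms_disjoint:
  assumes "squarefree_weight (v + w)" "B \<in> terms v" "C \<in> terms w"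
  shows "B \<inter> C = {}"
proof (rule ccontr)
  assume "B \<inter> C \<noteq> {}"
  then obtain a where a: "a \<in> B" "a \<in> C" by blast
  with assms terms_subset have "a < q" by blast
  then obtain k where k: "wt a $ k = 1" using wt_component_positive by blast
  have "1 \<le> u $ k" if "D \<in> terms u" "a \<in> D" for D u
  proof -
    have "wt a $ k \<le> (\<Sum>b\<in>D. wt b $ k)"
      using that terms_finite by (intro member_le_sum) auto
    also have "\<dots> = u $ k" using terms_weight[OF that(1)] by (simp flip: sum_component)
    finally show ?thesis using k by simp
  qed
  from this[OF assms(2) a(1)] this[OF assms(3) a(2)] have "2 \<le> (v + w) $ k" by simp
  moreover have "(v + w) $ k \<le> 1" using assms(1) unfolding squarefree_weight_def ..
  ultimately show False by linarith
qed

lemma terms_Un: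
  assumes "squarefree_weight (v + w)" "B \<in> terms v" "C \<in> terms w"
  shows "B \<union> C \<in> terms (v + w)"
proof -
  have "(\<Sum>b\<in>B \<union> C. wt b) = v + w"
    by (simp add: sum.union_disjoint[OF terms_finite[OF assms(2)] terms_finite[OF assms(3)]
        terms_disjoint[OF assms]] terms_weight[OF assms(2)] terms_weight[OF assms(3)])
  then show ?thesis using terms_subset[OF assms(2)] terms_subset[OF assms(3)] by (simp add: terms_def)
qed

text \<open>Factors with disjoint supports commute, so no signs arise within a term of squarefree weight.\<close>

lemma comm_sign_squarefree:
  assumes w: "squarefree_weight (\<Sum>b\<in>B. wt b)" and B: "B \<subseteq> {..<q}" and ab: "a \<in> B" "b \<in> B" "a \<noteq> b"
  shows "comm_sign (deg a) (deg b) = 1"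
proof -
  have "finite B" using B finite_subset by blast
  have "of_nat (wt a $ k) * of_nat (wt b $ k) = (0 :: bit)" for k
  proof -
    have "(\<Sum>b\<in>{a, b}. wt b $ k) \<le> (\<Sum>b\<in>B. wt b $ k)"
      using ab \<open>finite B\<close> by (intro sum_mono2) auto
    also have "\<dots> \<le> 1" using w by (simp add: squarefree_weight_def sum_component)
    finally have "wt a $ k = 0 \<or> wt b $ k = 0" using ab(3) by auto
    then show ?thesis by auto
  qed
  then have "pairing (deg a) (deg b) = 0"
    unfolding pairing_def deg_eq vec_lambda_beta by (simp only: sum.neutral_const)
  then show ?thesis by (simp add: comm_sign_def)
qed

lemma ximon_mult:
  assumes w: "squarefree_weight (\<Sum>b\<in>B \<union> C. wt b)" and B: "B \<subseteq> {..<q}" "C \<subseteq> {..<q}" "B \<inter> C = {}"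
  shows "ximon B \<odot> ximon C = ximon (B \<union> C)"
proof -
  have "comm_sign (deg a) (deg b) ^ (indicator_exponent B a * indicator_exponent C b) = 1" for a b
  proof (cases "a \<in> B \<and> b \<in> C")
    case True
    then have "comm_sign (deg a) (deg b) = 1"
      using B by (intro comm_sign_squarefree[OF w]) auto
    then show ?thesis by simp
  qed (auto simp: indicator_exponent_def)
  then have "sg (indicator_exponent B) (indicator_exponent C) = 1"
    by (simp add: monomial_sign_def)
  then show ?thesis
    using monomial_mult[of "indicator_exponent B" "indicator_exponent C"]
      indicator_exponent_Exps[of "B \<union> C"] B by (simp add: indicator_exponent_Un)
qed

text \<open>Valid for every enumeration of the set, since the factors commute. The lexicographic
  order in \<open>super_coordinate\<close> therefore does not influence the resulting
  series.\<close>

lemma ordered_product_ximon: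
  "distinct bs \<Longrightarrow> set bs \<subseteq> {..<q} \<Longrightarrow> squarefree_weight (\<Sum>b\<in>set bs. wt b) \<Longrightarrow>
     ordered_product R (map (\<lambda>b. ximon {b}) bs) = ximon (set bs)"
proof (induction bs)
  case Nil
  have "indicator_exponent {} = (\<lambda>_. 0)" by (auto simp: indicator_exponent_def)
  then show ?case by (simp add: monomial_zero)
next
  case (Cons b bs)
  then have "squarefree_weight (\<Sum>b\<in>set bs. wt b)"
    using squarefree_weight_add[of "wt b"] by simp
  with Cons show ?case using ximon_mult[of "{b}" "set bs"] by simp
qed

text \<open>
  A polynomial function on \<open>\<real>\<^sup>q\<close> determines its coefficients, so that identities between the classical
  coordinate changes carry over to the series that \<open>represents\<close> relates to them.
\<close>

definition represents ::
  "nat ^ 'n \<Rightarrow> ((nat \<Rightarrow> real) \<Rightarrow> real) \<Rightarrow> ((nat \<Rightarrow> nat) \<Rightarrow> real) \<Rightarrow> bool" where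
  "represents w F f \<longleftrightarrow> (\<exists>P. (\<forall>y. F y = (\<Sum>B\<in>terms w. P B * (\<Prod>b\<in>B. y b))) \<and>
     f = (\<lambda>\<nu>. \<Sum>B\<in>terms w. P B * ximon B \<nu>))"

lemma representsI:
  "represents w (\<lambda>y. \<Sum>B\<in>terms w. P B * (\<Prod>b\<in>B. y b)) (\<lambda>\<nu>. \<Sum>B\<in>terms w. P B * ximon B \<nu>)"
  unfolding represents_def by blast

lemma represents_term:
  assumes "B \<in> terms w"
  shows "represents w (\<lambda>y. \<Prod>b\<in>B. y b) (ximon B)"
  unfolding represents_def
  by (rule exI[of _ "\<lambda>C. if C = B then 1 else 0"]) (use assms in \<open>simp add: if_distrib[of "\<lambda>x. x * _"] cong: if_cong\<close>)

lemma represents_sum: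
  assumes "\<And>i. i \<in> I \<Longrightarrow> represents w (F i) (f i)"
  shows "represents w (\<lambda>y. \<Sum>i\<in>I. c i * F i y) (\<lambda>\<nu>. \<Sum>i\<in>I. c i * f i \<nu>)"
proof -
  have "\<forall>i\<in>I. \<exists>P. (\<forall>y. F i y = (\<Sum>B\<in>terms w. P B * (\<Prod>b\<in>B. y b))) \<and>
      f i = (\<lambda>\<nu>. \<Sum>B\<in>terms w. P B * ximon B \<nu>)"
    using assms by (simp add: represents_def)
  from bchoice[OF this] obtain P where P: "\<forall>i\<in>I. (\<forall>y. F i y = (\<Sum>B\<in>terms w. P i B * (\<Prod>b\<in>B. y b))) \<and>
      f i = (\<lambda>\<nu>. \<Sum>B\<in>terms w. P i B * ximon B \<nu>)"
    by blast
  have swap: "(\<Sum>i\<in>I. c i * (\<Sum>B\<in>terms w. P i B * g B)) = (\<Sum>B\<in>terms w. (\<Sum>i\<in>I. c i * P i B) * g B)" for g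
    unfolding sum_distrib_left sum_distrib_right by (subst sum.swap) (simp add: mult.assoc)
  have "(\<Sum>i\<in>I. c i * F i y) = (\<Sum>B\<in>terms w. (\<Sum>i\<in>I. c i * P i B) * (\<Prod>b\<in>B. y b))" for y
    unfolding swap[symmetric] using P by (intro sum.cong) auto
  moreover have "(\<Sum>i\<in>I. c i * f i \<nu>) = (\<Sum>B\<in>terms w. (\<Sum>i\<in>I. c i * P i B) * ximon B \<nu>)" for \<nu>
    unfolding swap[symmetric] using P by (intro sum.cong) auto
  ultimately show ?thesis
    unfolding represents_def by (intro exI[of _ "\<lambda>B. \<Sum>i\<in>I. c i * P i B"]) simp
qed

text \<open>The monomials of B and C multiply to that of B \<union> C on both sides: as functions
  because B and C are disjoint, as series because in addition no sign appears.\<close>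

lemma represents_mult:
  assumes vw: "squarefree_weight (v + w)" and F: "represents v F f" and G: "represents w G g"
  shows "represents (v + w) (\<lambda>y. F y * G y) (f \<odot> g)"
proof -
  obtain P where P: "F = (\<lambda>y. \<Sum>B\<in>terms v. P B * (\<Prod>b\<in>B. y b))" "f = (\<lambda>\<nu>. \<Sum>B\<in>terms v. P B * ximon B \<nu>)"
    using F unfolding represents_def fun_eq_iff by blast
  obtain Q where Q: "G = (\<lambda>y. \<Sum>C\<in>terms w. Q C * (\<Prod>b\<in>C. y b))" "g = (\<lambda>\<nu>. \<Sum>C\<in>terms w. Q C * ximon C \<nu>)"
    using G unfolding represents_def fun_eq_iff by blast
  let ?T = "terms v \<times> terms w"
  have "represents (v + w) (\<lambda>y. \<Sum>x\<in>?T. P (fst x) * Q (snd x) * (\<Prod>b\<in>fst x \<union> snd x. y b))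
      (\<lambda>\<nu>. \<Sum>x\<in>?T. P (fst x) * Q (snd x) * ximon (fst x \<union> snd x) \<nu>)"
    by (intro represents_sum represents_term) (auto intro: terms_Un[OF vw])
  moreover have "(\<Sum>x\<in>?T. P (fst x) * Q (snd x) * (\<Prod>b\<in>fst x \<union> snd x. y b)) = F y * G y" for y
  proof -
    have "(\<Sum>x\<in>?T. P (fst x) * Q (snd x) * (\<Prod>b\<in>fst x \<union> snd x. y b)) =
        (\<Sum>x\<in>?T. (P (fst x) * (\<Prod>b\<in>fst x. y b)) * (Q (snd x) * (\<Prod>b\<in>snd x. y b)))"
      using terms_disjoint[OF vw] terms_finite
      by (intro sum.cong refl) (auto simp: prod.union_disjoint)
    then show ?thesis
      by (simp add: P Q sum_product sum.cartesian_product case_prod_unfold)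
  qed
  moreover have "(\<lambda>\<nu>. \<Sum>x\<in>?T. P (fst x) * Q (snd x) * ximon (fst x \<union> snd x) \<nu>) = f \<odot> g"
  proof -
    have "ximon (B \<union> C) = ximon B \<odot> ximon C" if "B \<in> terms v" "C \<in> terms w" for B C
      using that terms_disjoint[OF vw that] terms_weight[OF terms_Un[OF vw that]] vw
      by (intro ximon_mult[symmetric]) (auto simp: terms_def)
    then have "(\<Sum>x\<in>?T. P (fst x) * Q (snd x) * ximon (fst x \<union> snd x) \<nu>) =
        (\<Sum>B\<in>terms v. \<Sum>C\<in>terms w. P B * Q C * (ximon B \<odot> ximon C) \<nu>)" for \<nu>
      unfolding sum.cartesian_product by (intro sum.cong) auto
    then show ?thesis
      by (simp add: P Q mult_real_series_sum_left mult_real_series_sum_right sum_distrib_left mult.assoc)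
  qed
  ultimately show ?thesis by simp
qed

lemma terms_zero: "terms 0 = {{}}"
proof -
  have "B = {}" if B: "B \<in> terms 0" for B
  proof (rule ccontr)
    assume "B \<noteq> {}"
    then obtain b where b: "b \<in> B" by blast
    then obtain k where "wt b $ k = 1" using terms_subset[OF B] wt_component_positive by blast
    moreover have "wt b $ k \<le> (\<Sum>b\<in>B. wt b $ k)"
      using b terms_finite[OF B] by (intro member_le_sum) auto
    moreover have "(\<Sum>b\<in>B. wt b $ k) = 0"
      using terms_weight[OF B] by (simp flip: sum_component)
    ultimately show False by simp
  qed
  then show ?thesis by (auto simp: terms_def)
qed

text \<open>At the point with ones exactly on B, only the products over subsets of B survive. The
  coefficients at proper subsets agree by induction on the cardinality, which isolates the
  coefficient at B.\<close>

lemma multilinear_unique: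
  assumes "finite S" "\<And>B. B \<in> S \<Longrightarrow> finite B"
    and eq: "\<And>y :: nat \<Rightarrow> real. (\<Sum>B\<in>S. P B * (\<Prod>b\<in>B. y b)) = (\<Sum>B\<in>S. Q B * (\<Prod>b\<in>B. y b))"
    and "B \<in> S"
  shows "P B = Q B"
  using assms(4)
proof (induction "card B" arbitrary: B rule: less_induct)
  case less
  have B: "finite B" using assms(2) less.prems .
  define y :: "nat \<Rightarrow> real" where "y b = (if b \<in> B then 1 else 0)" for b
  have y: "(\<Prod>b\<in>C. y b) = (if C \<subseteq> B then 1 else 0)" if "C \<in> S" for C
  proof (cases "C \<subseteq> B")
    case True
    then show ?thesis by (simp only: if_True) (rule prod.neutral, auto simp: y_def)
  next
    case False
    then obtain b where "b \<in> C" "b \<notin> B" by blast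
    then have "b \<in> C" "y b = 0" by (simp_all add: y_def)
    then show ?thesis using False assms(2)[OF that] by (auto intro!: prod_zero)
  qed
  have "(\<Sum>C\<in>S. (P C - Q C) * (\<Prod>b\<in>C. y b)) = 0"
    using eq[of y] by (simp add: left_diff_distrib sum_subtractf)
  moreover have "(\<Sum>C\<in>S. (P C - Q C) * (\<Prod>b\<in>C. y b)) = (\<Sum>C\<in>S. if C = B then P B - Q B else 0)"
  proof (intro sum.cong refl)
    fix C assume C: "C \<in> S"
    show "(P C - Q C) * (\<Prod>b\<in>C. y b) = (if C = B then P B - Q B else 0)"
    proof (cases "C \<subset> B")
      case True
      then have "P C = Q C" using less.hyps psubset_card_mono[OF B] C by blast
      with True show ?thesis by auto
    qed (use y[OF C] in auto)
  qed
  ultimately show ?case using assms(1) less.prems by simp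
qed

lemma represents_unique:
  assumes "represents w F f" "represents w F g"
  shows "f = g"
proof -
  obtain P where P: "\<forall>y. F y = (\<Sum>B\<in>terms w. P B * (\<Prod>b\<in>B. y b))" "f = (\<lambda>\<nu>. \<Sum>B\<in>terms w. P B * ximon B \<nu>)"
    using assms(1) unfolding represents_def by blast
  obtain Q where Q: "\<forall>y. F y = (\<Sum>B\<in>terms w. Q B * (\<Prod>b\<in>B. y b))" "g = (\<lambda>\<nu>. \<Sum>B\<in>terms w. Q B * ximon B \<nu>)"
    using assms(2) unfolding represents_def by blast
  have "P B = Q B" if "B \<in> terms w" for B
    by (rule multilinear_unique[OF finite_terms terms_finite
          trans[OF P(1)[rule_format, symmetric] Q(1)[rule_format]] that])
  then show ?thesis unfolding P(2) Q(2) by simp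
qed

text \<open>The factors are multiplied in one variable at a time. Partial sums of a squarefree
  weight are squarefree, so \<open>represents_mult\<close> applies at every stage.\<close>

lemma represents_powers:
  assumes Z: "substitutable Z" and G: "\<And>b. b < q \<Longrightarrow> represents (wt b) (G b) (Z b)"
    and B: "B \<subseteq> {..<q}" "squarefree_weight (\<Sum>b\<in>B. wt b)"
  shows "represents (\<Sum>b\<in>B. wt b) (\<lambda>y. \<Prod>b\<in>B. G b y) (powers Z q (indicator_exponent B))"
proof -
  have fin: "finite B" using B finite_subset by blast
  have "represents (\<Sum>b\<in>B \<inter> {..<k}. wt b) (\<lambda>y. \<Prod>b\<in>B \<inter> {..<k}. G b y) (powers Z k (indicator_exponent B))"
    if "k \<le> q" for k
    using that
  proof (induction k)
    case 0
    have "indicator_exponent {} = (\<lambda>_. 0)" by (auto simp: indicator_exponent_def)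
    then show ?case
      using represents_term[of "{}" 0] by (simp add: powers_0 terms_zero monomial_zero)
  next
    case (Suc k)
    have zk: "Z k \<in> carrier R" using Z Suc.prems by (auto simp: substitutable_def homogeneous_def)
    show ?case
    proof (cases "k \<in> B")
      case False
      then have "B \<inter> {..<Suc k} = B \<inter> {..<k}" by (auto simp: less_Suc_eq)
      moreover have "powers Z (Suc k) (indicator_exponent B) = powers Z k (indicator_exponent B)"
        using Suc.prems False powers_closed[OF Z, of k]
        by (simp add: powers_Suc[OF Z] indicator_exponent_def)
      ultimately show ?thesis using Suc by simp
    next
      case True
      have split: "B \<inter> {..<Suc k} = insert k (B \<inter> {..<k})" using True by (auto simp: less_Suc_eq)
      have "(\<Sum>b\<in>B. wt b) = (\<Sum>b\<in>B \<inter> {..<Suc k}. wt b) + (\<Sum>b\<in>B - {..<Suc k}. wt b)"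
        using fin by (metis Diff_disjoint Int_Diff_Un Int_Diff_disjoint finite_Diff finite_Int sum.union_disjoint)
      then have "squarefree_weight (\<Sum>b\<in>B \<inter> {..<Suc k}. wt b)"
        using B(2) squarefree_weight_add by metis
      then have "squarefree_weight ((\<Sum>b\<in>B \<inter> {..<k}. wt b) + wt k)"
        using fin by (simp add: split add.commute)
      from represents_mult[OF this Suc.IH G[of k]] Suc.prems
      have "represents ((\<Sum>b\<in>B \<inter> {..<k}. wt b) + wt k) (\<lambda>y. (\<Prod>b\<in>B \<inter> {..<k}. G b y) * G k y)
          (powers Z k (indicator_exponent B) \<odot> Z k)" by simp
      moreover have "powers Z (Suc k) (indicator_exponent B) = powers Z k (indicator_exponent B) \<odot> Z k"
        using Suc.prems True zk by (simp add: powers_Suc[OF Z] indicator_exponent_def)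
      ultimately show ?thesis
        using fin by (simp add: split add.commute mult.commute)
    qed
  qed
  from this[of q] show ?thesis using B(1) by (simp add: Int_absorb2)
qed

text \<open>Both constructions are linear in the coefficients P, which reduces the claim to
  monomials. Composition of polynomial functions thereby corresponds to substitution of
  series.\<close>

lemma represents_subst:
  assumes w: "squarefree_weight w" and F: "represents w F f"
    and Z: "substitutable Z" and G: "\<And>b. b < q \<Longrightarrow> represents (wt b) (G b) (Z b)"
  shows "represents w (\<lambda>y. F (\<lambda>b. G b y)) (subst_series Z f)"
proof -
  obtain P where P: "F = (\<lambda>y. \<Sum>B\<in>terms w. P B * (\<Prod>b\<in>B. y b))" "f = (\<lambda>\<nu>. \<Sum>B\<in>terms w. P B * ximon B \<nu>)"
    using F unfolding represents_def fun_eq_iff by blast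
  have "subst_series Z f = (\<lambda>\<nu>. \<Sum>B\<in>terms w. P B * powers Z q (indicator_exponent B) \<nu>)"
    unfolding P(2) subst_series_sum[OF Z]
    by (intro ext sum.cong refl) (simp add: subst_series_monomial[OF Z] indicator_exponent_Exps terms_subset)
  moreover have "represents w (\<lambda>y. \<Prod>b\<in>B. G b y) (powers Z q (indicator_exponent B))" if "B \<in> terms w" for B
    using represents_powers[OF Z G terms_subset[OF that]] w by (simp add: terms_weight[OF that])
  then have "represents w (\<lambda>y. \<Sum>B\<in>terms w. P B * (\<Prod>b\<in>B. G b y))
      (\<lambda>\<nu>. \<Sum>B\<in>terms w. P B * powers Z q (indicator_exponent B) \<nu>)"
    by (rule represents_sum)
  ultimately show ?thesis by (simp add: P(1))
qed

section \<open>Admissible substitutions and the identity substitution\<close>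

lemma singleton_terms: "a < q \<Longrightarrow> {a} \<in> terms (wt a)"
  by (simp add: terms_def)

lemma represents_variable: "a < q \<Longrightarrow> represents (wt a) (\<lambda>y. y a) (ximon {a})"
  using represents_term[OF singleton_terms] by simp

lemma monomial_degree_indicator:
  assumes "B \<subseteq> {..<q}" "(\<Sum>b\<in>B. wt b) = wt a"
  shows "dg (indicator_exponent B) = deg a"
proof -
  have "dg (indicator_exponent B) = (\<Sum>b<q. if b \<in> B then deg b else 0)"
    unfolding monomial_degree_def by (rule sum.cong) (auto simp: indicator_exponent_def)
  also have "\<dots> = (\<Sum>b\<in>B. deg b)"
    using assms(1) by (simp add: sum.If_cases Int_absorb1)
  also have "(\<Sum>b\<in>B. deg b) = deg a"
  proof (rule vec_eq_iff[THEN iffD2, rule_format])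
    fix k
    have "(\<Sum>b\<in>B. deg b) $ k = (\<Sum>b\<in>B. of_nat (wt b $ k))"
      by (simp only: sum_component deg_eq vec_lambda_beta)
    also have "\<dots> = of_nat (\<Sum>b\<in>B. wt b $ k)" by (simp only: of_nat_sum)
    also have "(\<Sum>b\<in>B. wt b $ k) = wt a $ k" using assms(2) by (simp flip: sum_component)
    finally show "(\<Sum>b\<in>B. deg b) $ k = deg a $ k" by (simp add: deg_eq)
  qed
  finally show ?thesis .
qed

text \<open>The degree is right because reduction mod 2 is additive. There is no constant term
  because the weight of a is non-zero, so every B in the sum is non-empty.\<close>

lemma substitutable_sum_terms:
  "substitutable (\<lambda>a \<nu>. \<Sum>B\<in>terms (wt a). P a B * ximon B \<nu>)"
  unfolding substitutable_def
proof (intro allI impI conjI)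
  fix a assume a: "a < q"
  have "(\<lambda>\<nu>. \<Sum>B\<in>terms (wt a). P a B * ximon B \<nu>) \<in> carrier R"
    unfolding carrier_real_series
  proof (intro allI impI sum.neutral ballI)
    fix \<nu> B assume "\<nu> \<notin> Exps" "B \<in> terms (wt a)"
    then show "P a B * ximon B \<nu> = 0"
      using indicator_exponent_Exps[OF terms_subset] by (auto simp: monomial_def)
  qed
  moreover have "(\<Sum>B\<in>terms (wt a). P a B * ximon B \<nu>) = 0" if "dg \<nu> \<noteq> deg a" for \<nu>
    using that monomial_degree_indicator by (intro sum.neutral) (auto simp: monomial_def terms_def)
  ultimately show "homogeneous (deg a) (\<lambda>\<nu>. \<Sum>B\<in>terms (wt a). P a B * ximon B \<nu>)"
    by (simp add: homogeneous_def)
  show "vanishes_below 1 (\<lambda>\<nu>. \<Sum>B\<in>terms (wt a). P a B * ximon B \<nu>)"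
    unfolding vanishes_below_def
  proof (intro allI impI sum.neutral ballI)
    fix \<nu> B assume \<nu>: "sz \<nu> < 1" and B: "B \<in> terms (wt a)"
    have "B \<noteq> {}" using B wt_nonzero[OF a] by (auto simp: terms_def)
    then obtain b where "b \<in> B" "b < q" using terms_subset[OF B] by blast
    then have "\<nu> b \<noteq> indicator_exponent B b" using \<nu> by (auto simp: indicator_exponent_def)
    then show "P a B * ximon B \<nu> = 0" by (auto simp: monomial_def)
  qed
qed

lemma power_ximon:
  assumes k: "k < q" and m: "(\<lambda>a. if a = k then m else 0) \<in> Exps"
  shows "ximon {k} [^]\<^bsub>R\<^esub> m = monomial (\<lambda>a. if a = k then m else 0)"
  using m
proof (induction m)
  case 0
  then show ?case by (simp add: monomial_zero)
next
  case (Suc m)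
  have eq: "(\<lambda>a. (if a = k then m else 0) + indicator_exponent {k} a) = (\<lambda>a. if a = k then Suc m else 0)"
    by (auto simp: indicator_exponent_def)
  have "sg (\<lambda>a. if a = k then m else 0) (indicator_exponent {k}) = 1"
    unfolding monomial_sign_def by (intro prod.neutral ballI) (auto simp: indicator_exponent_def)
  moreover have "(\<lambda>a. if a = k then m else 0) \<in> Exps"
    by (rule exponents_add_left[of _ "indicator_exponent {k}"]) (use Suc.prems eq in simp)
  ultimately show ?case
    using Suc.IH Suc.prems monomial_mult[of "\<lambda>a. if a = k then m else 0" "indicator_exponent {k}"]
    by (simp add: eq)
qed

text \<open>The variables are multiplied in increasing order, so no factor has to be moved and all
  signs are 1.\<close>

lemma powers_ximon:
  assumes \<mu>: "\<mu> \<in> Exps" and Z: "substitutable (\<lambda>a. ximon {a})"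
  shows "powers (\<lambda>a. ximon {a}) q \<mu> = monomial \<mu>"
proof -
  have "powers (\<lambda>a. ximon {a}) k \<mu> = monomial (\<lambda>a. if a < k then \<mu> a else 0)" if "k \<le> q" for k
    using that
  proof (induction k)
    case 0
    then show ?case by (simp add: powers_0 monomial_zero)
  next
    case (Suc k)
    have eq: "(\<lambda>a. (if a < k then \<mu> a else 0) + (if a = k then \<mu> k else 0)) = (\<lambda>a. if a < Suc k then \<mu> a else 0)"
      by auto
    have le: "(\<lambda>a. if a < Suc k then \<mu> a else 0) \<in> Exps" "(\<lambda>a. if a = k then \<mu> k else 0) \<in> Exps"
      by (rule exponents_le[OF \<mu>]; simp add: le_fun_def)+
    have "sg (\<lambda>a. if a < k then \<mu> a else 0) (\<lambda>a. if a = k then \<mu> k else 0) = 1"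
      unfolding monomial_sign_def by (intro prod.neutral ballI) auto
    then show ?case
      using Suc le monomial_mult[of "\<lambda>a. if a < k then \<mu> a else 0" "\<lambda>a. if a = k then \<mu> k else 0"]
      by (simp add: powers_Suc[OF Z] power_ximon eq)
  qed
  from this[of q] have "powers (\<lambda>a. ximon {a}) q \<mu> = monomial (\<lambda>a. if a < q then \<mu> a else 0)" by simp
  moreover have "(\<lambda>a. if a < q then \<mu> a else 0) = \<mu>" using \<mu> by (auto simp: exponents_def fun_eq_iff)
  ultimately show ?thesis by simp
qed

lemma substitutable_ximon: "substitutable (\<lambda>a. ximon {a})"
proof -
  \<comment> \<open>A variable is itself a sum over terms, with coefficient 1 at {a} and 0
    elsewhere, so \<open>substitutable_sum_terms\<close> covers it.\<close>
  have "(\<Sum>B\<in>terms (wt a). (if B = {a} then 1 else 0) * ximon B \<nu>) = ximon {a} \<nu>" if "a < q" for a \<nu>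
    using singleton_terms[OF that] by (simp add: if_distrib[of "\<lambda>x. x * _"] cong: if_cong)
  then show ?thesis
    using substitutable_sum_terms[of "\<lambda>a B. if B = {a} then 1 else 0"]
    by (simp add: substitutable_def)
qed

lemma subst_series_ximon:
  assumes s: "s \<in> carrier R"
  shows "subst_series (\<lambda>a. ximon {a}) s = s"
proof
  fix \<nu>
  have "subst_series (\<lambda>a. ximon {a}) s \<nu> = (\<Sum>\<mu>\<in>Exps_upto (sz \<nu>). if \<mu> = \<nu> then s \<nu> else 0)"
    unfolding subst_series_def[OF substitutable_ximon]
  proof (rule sum.cong[OF refl])
    fix \<mu> assume "\<mu> \<in> Exps_upto (sz \<nu>)"
    then have "powers (\<lambda>a. ximon {a}) q \<mu> = monomial \<mu>"
      by (intro powers_ximon substitutable_ximon) (simp add: Exps_upto_def)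
    then show "s \<mu> * powers (\<lambda>a. ximon {a}) q \<mu> \<nu> = (if \<mu> = \<nu> then s \<nu> else 0)"
      by (simp only: monomial_def) auto
  qed
  moreover have "\<nu> \<in> Exps_upto (sz \<nu>) \<longleftrightarrow> \<nu> \<in> Exps" by (simp add: Exps_upto_def)
  ultimately show "subst_series (\<lambda>a. ximon {a}) s \<nu> = s \<nu>"
    using s by (simp add: carrier_real_series)
qed

end


section \<open>The charts of an \<open>n\<close>-vector bundle\<close>

locale vector_bundle =
  fixes E :: "('e, 'm, 'i, 'n::{finite,linorder}) bundle_atlas"
  assumes n_vector_bundle: "n_vector_bundle E"
begin

abbreviation "I \<equiv> bundle_charts E"
abbreviation "p \<equiv> base_dim E"
abbreviation "q \<equiv> fibre_dim E"
abbreviation "U \<equiv> base_domain E"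
abbreviation "\<psi> \<equiv> base_map E"
abbreviation "ov \<equiv> base_overlap E"
abbreviation "\<phi> \<equiv> base_change E"
abbreviation "cf \<equiv> fibre_coefficients E"

section \<open>The data of the bundle and its base charts\<close>

lemma base_manifold:
  "Hausdorff_space (base_space E)" "second_countable (base_space E)"
  "\<alpha> \<in> I \<Longrightarrow> open_chart p (base_space E) (U \<alpha>) (\<psi> \<alpha>)"
  "topspace (base_space E) = (\<Union>\<alpha>\<in>I. \<psi> \<alpha> ` U \<alpha>)"
  "\<alpha> \<in> I \<Longrightarrow> \<beta> \<in> I \<Longrightarrow> i < p \<Longrightarrow> smooth_on p (ov \<beta> \<alpha>) (\<lambda>x. \<phi> \<beta> \<alpha> x i)"
  using n_vector_bundle by (simp_all add: n_vector_bundle_def Let_def)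

lemma total_manifold:
  "\<alpha> \<in> I \<Longrightarrow> open_chart (p + q) (total_space E) (total_domain E \<alpha>) (total_map E \<alpha>)"
  "\<alpha> \<in> I \<Longrightarrow> total_map E \<alpha> ` total_domain E \<alpha> =
     {e \<in> topspace (total_space E). projection E e \<in> \<psi> \<alpha> ` U \<alpha>}"
  "\<alpha> \<in> I \<Longrightarrow> z \<in> total_domain E \<alpha> \<Longrightarrow> projection E (total_map E \<alpha> z) = \<psi> \<alpha> (base_part p z)"
  "\<alpha> \<in> I \<Longrightarrow> \<beta> \<in> I \<Longrightarrow> \<exists>c. fibre_change_coefficients E \<beta> \<alpha> c"
  using n_vector_bundle by (simp_all add: n_vector_bundle_def Let_def)

lemma weights:
  "a < q \<Longrightarrow> weight E a \<noteq> 0" "a < q \<Longrightarrow> weight E a $ k \<in> {0, 1}"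
  using n_vector_bundle unfolding n_vector_bundle_def Let_def by blast+

lemma weight_le_1: "a < q \<Longrightarrow> weight E a $ k \<le> 1"
  using weights(2)[of a k] by auto

sublocale weighted_variables q "weight_degree E" "weight E"
  by unfold_locales (simp_all add: weights weight_le_1[simplified] weight_degree_def)

lemma weight_terms_eq: "weight_terms E a = terms (weight E a)"
  by (simp add: weight_terms_def terms_def)

lemma open_U: "\<alpha> \<in> I \<Longrightarrow> openin (Euclidean_space p) (U \<alpha>)"
  and open_image: "\<alpha> \<in> I \<Longrightarrow> openin (base_space E) (\<psi> \<alpha> ` U \<alpha>)"
  using base_manifold(3) by (auto simp: open_chart_def)

lemma inj_chart:
  assumes "open_chart m M V f"
  shows "inj_on f V"
  using assms openin_subset[of "Euclidean_space m" V]
  by (auto simp: open_chart_def Int_absorb1 dest!: homeomorphic_imp_injective_map)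

lemma inj_\<psi>: "\<alpha> \<in> I \<Longrightarrow> inj_on (\<psi> \<alpha>) (U \<alpha>)"
  by (rule inj_chart[OF base_manifold(3)])

lemma inj_total: "\<alpha> \<in> I \<Longrightarrow> inj_on (total_map E \<alpha>) (total_domain E \<alpha>)"
  by (rule inj_chart[OF total_manifold(1)])

lemma U_Euclidean: "\<alpha> \<in> I \<Longrightarrow> x \<in> U \<alpha> \<Longrightarrow> i \<ge> p \<Longrightarrow> x i = 0"
  using openin_subset[OF open_U] by (auto simp: topspace_Euclidean_space)

lemma ov_iff: "x \<in> ov \<beta> \<alpha> \<longleftrightarrow> x \<in> U \<alpha> \<and> \<psi> \<alpha> x \<in> \<psi> \<beta> ` U \<beta>"
  by (simp add: overlap_in_def)

lemma open_ov:
  assumes "\<alpha> \<in> I" "\<beta> \<in> I"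
  shows "openin (Euclidean_space p) (ov \<beta> \<alpha>)"
proof -
  have "continuous_map (subtopology (Euclidean_space p) (U \<alpha>)) (base_space E) (\<psi> \<alpha>)"
    using base_manifold(3)[OF assms(1)] unfolding open_chart_def
    by (blast intro: continuous_map_into_fulltopology homeomorphic_imp_continuous_map)
  from openin_continuous_map_preimage[OF this open_image[OF assms(2)]]
  have "openin (subtopology (Euclidean_space p) (U \<alpha>)) (ov \<beta> \<alpha>)"
    using openin_subset[OF open_U[OF assms(1)]]
    by (simp only: topspace_subtopology Int_absorb1) (simp add: overlap_in_def)
  then show ?thesis by (simp add: openin_open_subtopology[OF open_U[OF assms(1)]])
qed

lemma \<phi>_props:
  assumes "x \<in> ov \<beta> \<alpha>"
  shows "\<phi> \<beta> \<alpha> x \<in> U \<beta>" "\<psi> \<beta> (\<phi> \<beta> \<alpha> x) = \<psi> \<alpha> x" "\<phi> \<beta> \<alpha> x \<in> ov \<alpha> \<beta>"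
proof -
  show 1: "\<phi> \<beta> \<alpha> x \<in> U \<beta>" and 2: "\<psi> \<beta> (\<phi> \<beta> \<alpha> x) = \<psi> \<alpha> x"
    using assms by (auto simp: coordinate_change_def ov_iff inv_into_into f_inv_into_f)
  show "\<phi> \<beta> \<alpha> x \<in> ov \<alpha> \<beta>" using 1 2 assms by (auto simp: ov_iff)
qed

text \<open>\<open>coordinate_change\<close> sees a point only through its image in the base, and
  the two arguments have the same image.\<close>

lemma \<phi>_\<phi>:
  assumes "x \<in> ov \<gamma> \<alpha>"
  shows "\<phi> \<beta> \<gamma> (\<phi> \<gamma> \<alpha> x) = \<phi> \<beta> \<alpha> x"
  using \<phi>_props(2)[OF assms] by (simp add: coordinate_change_def)

lemma \<phi>_self: "\<alpha> \<in> I \<Longrightarrow> x \<in> U \<alpha> \<Longrightarrow> \<phi> \<alpha> \<alpha> x = x"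
  by (simp add: coordinate_change_def inv_into_f_f inj_\<psi>)

lemma fibre_coefficients:
  assumes "\<alpha> \<in> I" "\<beta> \<in> I"
  shows "fibre_change_coefficients E \<beta> \<alpha> (cf \<beta> \<alpha>)"
  unfolding fibre_coefficients_def using total_manifold(4)[OF assms] by (rule someI_ex)

text \<open>Here y ranges over all sequences, as in \<open>represents\<close>; only its first q
  entries enter.\<close>

definition join :: "(nat \<Rightarrow> real) \<Rightarrow> (nat \<Rightarrow> real) \<Rightarrow> nat \<Rightarrow> real" where
  "join x y i = (if i < p then x i else if i < p + q then y (i - p) else 0)"

definition fibre_change :: "'i \<Rightarrow> 'i \<Rightarrow> (nat \<Rightarrow> real) \<Rightarrow> nat \<Rightarrow> (nat \<Rightarrow> real) \<Rightarrow> real" where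
  "fibre_change \<beta> \<alpha> x a y = (\<Sum>B\<in>terms (weight E a). cf \<beta> \<alpha> a B x * (\<Prod>b\<in>B. y b))"

lemma join_total_domain:
  assumes "\<alpha> \<in> I" "x \<in> U \<alpha>"
  shows "base_part p (join x y) = x" "join x y \<in> total_domain E \<alpha>"
proof -
  show eq: "base_part p (join x y) = x"
    using U_Euclidean[OF assms] by (auto simp: base_part_def join_def fun_eq_iff)
  show "join x y \<in> total_domain E \<alpha>"
    unfolding total_domain_def using eq assms(2) by (simp add: topspace_Euclidean_space join_def)
qed

text \<open>The projection is compatible with both charts, which determines the base part by
  injectivity of the chart. The fibre part is read off from the chosen coefficients.\<close>

lemma total_change_join:
  assumes \<alpha>: "\<alpha> \<in> I" and \<beta>: "\<beta> \<in> I" and x: "x \<in> ov \<beta> \<alpha>"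
  shows "total_map E \<beta> (total_change E \<beta> \<alpha> (join x y)) = total_map E \<alpha> (join x y)"
    and "total_change E \<beta> \<alpha> (join x y) = join (\<phi> \<beta> \<alpha> x) (\<lambda>a. fibre_change \<beta> \<alpha> x a y)"
proof -
  have xU: "x \<in> U \<alpha>" using x by (simp add: ov_iff)
  note z = join_total_domain[OF \<alpha> xU, of y]
  let ?z = "join x y" and ?z' = "total_change E \<beta> \<alpha> (join x y)"
  have "total_map E \<alpha> ?z \<in> topspace (total_space E)"
    using total_manifold(2)[OF \<alpha>] z(2) by blast
  moreover have "projection E (total_map E \<alpha> ?z) = \<psi> \<alpha> x"
    using total_manifold(3)[OF \<alpha> z(2)] z(1) by simp
  ultimately have e: "total_map E \<alpha> ?z \<in> total_map E \<beta> ` total_domain E \<beta>"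
    unfolding total_manifold(2)[OF \<beta>] using x by (simp add: ov_iff)
  show z': "total_map E \<beta> ?z' = total_map E \<alpha> ?z"
    using e by (simp add: coordinate_change_def f_inv_into_f)
  have z'_dom: "?z' \<in> total_domain E \<beta>"
    using e by (simp add: coordinate_change_def inv_into_into)
  have eq: "\<psi> \<beta> (base_part p ?z') = \<psi> \<alpha> x"
    using total_manifold(3)[OF \<beta> z'_dom] z' total_manifold(3)[OF \<alpha> z(2)] z(1) by simp
  have "base_part p ?z' \<in> U \<beta>" using z'_dom by (simp add: total_domain_def)
  from inv_into_f_f[OF inj_\<psi>[OF \<beta>] this] have base: "base_part p ?z' = \<phi> \<beta> \<alpha> x"
    unfolding eq coordinate_change_def[of U \<psi>] ..
  have fibre: "?z' (p + a) = fibre_change \<beta> \<alpha> x a y" if a: "a < q" for a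
  proof -
    have "?z' (p + a) = (\<Sum>B\<in>weight_terms E a. cf \<beta> \<alpha> a B x * (\<Prod>b\<in>B. ?z (p + b)))"
      using fibre_coefficients[OF \<alpha> \<beta>] z a x unfolding fibre_change_coefficients_def by auto
    also have "\<dots> = fibre_change \<beta> \<alpha> x a y"
      unfolding fibre_change_def weight_terms_eq
      by (intro sum.cong prod.cong refl arg_cong2[where f = "(*)"])
        (use terms_subset in \<open>auto simp: join_def\<close>)
    finally show ?thesis .
  qed
  show "?z' = join (\<phi> \<beta> \<alpha> x) (\<lambda>a. fibre_change \<beta> \<alpha> x a y)"
  proof
    fix i
    consider "i < p" | "p \<le> i" "i < p + q" | "p + q \<le> i" by linarith
    then show "?z' i = join (\<phi> \<beta> \<alpha> x) (\<lambda>a. fibre_change \<beta> \<alpha> x a y) i"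
    proof cases
      case 1
      then have "?z' i = base_part p ?z' i" by (simp add: base_part_def)
      with 1 base show ?thesis by (simp add: join_def)
    next
      case 2
      then show ?thesis using fibre[of "i - p"] by (simp add: join_def)
    next
      case 3
      then show ?thesis using z'_dom by (simp add: join_def total_domain_def topspace_Euclidean_space)
    qed
  qed
qed

lemma join_component: "a < q \<Longrightarrow> join x y (p + a) = y a"
  by (simp add: join_def)

text \<open>The total charts satisfy the cocycle identity as maps, since
  \<open>coordinate_change\<close> depends only on the image in the total space. The claim is its
  component p + a.\<close>

lemma fibre_change_fibre_change:
  assumes "\<alpha> \<in> I" "\<beta> \<in> I" "\<gamma> \<in> I" and x: "x \<in> ov \<gamma> \<alpha>" "x \<in> ov \<beta> \<alpha>" and a: "a < q"
  shows "fibre_change \<beta> \<gamma> (\<phi> \<gamma> \<alpha> x) a (\<lambda>b. fibre_change \<gamma> \<alpha> x b y) = fibre_change \<beta> \<alpha> x a y"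
proof -
  have x': "\<phi> \<gamma> \<alpha> x \<in> ov \<beta> \<gamma>"
    using \<phi>_props[OF x(1)] x(2) by (simp add: ov_iff)
  have "total_change E \<beta> \<gamma> (total_change E \<gamma> \<alpha> (join x y)) = total_change E \<beta> \<alpha> (join x y)"
    using total_change_join(1)[OF assms(1,3) x(1)] by (simp add: coordinate_change_def)
  then have "join (\<phi> \<beta> \<gamma> (\<phi> \<gamma> \<alpha> x)) (\<lambda>a. fibre_change \<beta> \<gamma> (\<phi> \<gamma> \<alpha> x) a (\<lambda>b. fibre_change \<gamma> \<alpha> x b y)) =
      join (\<phi> \<beta> \<alpha> x) (\<lambda>a. fibre_change \<beta> \<alpha> x a y)"
    unfolding total_change_join(2)[OF assms(1,3) x(1)] total_change_join(2)[OF assms(3,2) x']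
      total_change_join(2)[OF assms(1,2) x(2)] .
  from fun_cong[OF this, of "p + a"] show ?thesis using a by (simp add: join_component)
qed

lemma fibre_change_self:
  assumes "\<alpha> \<in> I" "x \<in> U \<alpha>" "a < q"
  shows "fibre_change \<alpha> \<alpha> x a y = y a"
proof -
  have x: "x \<in> ov \<alpha> \<alpha>" using assms by (simp add: ov_iff)
  have "total_change E \<alpha> \<alpha> (join x y) = join x y"
    using inv_into_f_f[OF inj_total[OF assms(1)] join_total_domain(2)[OF assms(1,2)]]
    by (simp add: coordinate_change_def)
  from fun_cong[OF this, of "p + a"] show ?thesis
    using assms unfolding total_change_join(2)[OF assms(1,1) x] by (simp add: join_component)
qed


section \<open>The coordinate transformations of the superization\<close>

definition super_change :: "'i \<Rightarrow> 'i \<Rightarrow> (nat \<Rightarrow> real) \<Rightarrow> nat \<Rightarrow> (nat \<Rightarrow> nat) \<Rightarrow> real" where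
  "super_change \<beta> \<alpha> x a = (\<lambda>\<nu>. \<Sum>B\<in>terms (weight E a). cf \<beta> \<alpha> a B x * ximon B \<nu>)"

lemma substitutable_super_change: "substitutable (super_change \<beta> \<alpha> x)"
  unfolding super_change_def[abs_def] by (rule substitutable_sum_terms)

lemma represents_super_change:
  "represents (weight E a) (fibre_change \<beta> \<alpha> x a) (super_change \<beta> \<alpha> x a)"
  unfolding super_change_def fibre_change_def[abs_def] by (rule representsI)

text \<open>The coefficients for the three pairs of charts were chosen independently. The two sides
  agree because they represent the same polynomial function of y.\<close>

lemma super_change_super_change:
  assumes "\<alpha> \<in> I" "\<beta> \<in> I" "\<gamma> \<in> I" and x: "x \<in> ov \<gamma> \<alpha>" "x \<in> ov \<beta> \<alpha>" and a: "a < q"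
  shows "subst_series (super_change \<gamma> \<alpha> x) (super_change \<beta> \<gamma> (\<phi> \<gamma> \<alpha> x) a) = super_change \<beta> \<alpha> x a"
proof -
  have "represents (weight E a)
      (\<lambda>y. fibre_change \<beta> \<gamma> (\<phi> \<gamma> \<alpha> x) a (\<lambda>b. fibre_change \<gamma> \<alpha> x b y))
      (subst_series (super_change \<gamma> \<alpha> x) (super_change \<beta> \<gamma> (\<phi> \<gamma> \<alpha> x) a))"
    by (rule represents_subst[OF squarefree_weight_wt[OF a] represents_super_change
          substitutable_super_change represents_super_change])
  then show ?thesis
    unfolding fibre_change_fibre_change[OF assms]
    by (rule represents_unique[OF _ represents_super_change])
qed

lemma super_change_self:
  assumes "\<alpha> \<in> I" "x \<in> U \<alpha>" "a < q"
  shows "super_change \<alpha> \<alpha> x a = ximon {a}"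
proof (rule represents_unique)
  show "represents (weight E a) (\<lambda>y. y a) (ximon {a})" by (rule represents_variable[OF assms(3)])
  show "represents (weight E a) (\<lambda>y. y a) (super_change \<alpha> \<alpha> x a)"
  proof -
    have "fibre_change \<alpha> \<alpha> x a = (\<lambda>y. y a)" by (rule ext) (rule fibre_change_self[OF assms])
    with represents_super_change[of a \<alpha> \<alpha> x] show ?thesis by simp
  qed
qed

text \<open>Two elements of B with the same weight would give a component of at least 2. So the
  weights are distinct, and the lexicographic order is total on B.\<close>

lemma lex_list_props:
  assumes "B \<in> terms (weight E a)" "a < q"
  shows "set (lex_list E B) = B" "distinct (lex_list E B)"
proof -
  let ?r = "\<lambda>a b. lex_less (weight E a) (weight E b)"
  have "?r b c \<or> ?r c b" if bc: "b \<in> B" "c \<in> B" "b \<noteq> c" for b c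
  proof (rule lex_less_total, rule notI)
    assume eq: "weight E b = weight E c"
    have "b < q" using bc terms_subset[OF assms(1)] by blast
    then obtain k where k: "weight E b $ k = 1" using wt_component_positive by blast
    have "(\<Sum>d\<in>{b, c}. weight E d $ k) \<le> (\<Sum>d\<in>B. weight E d $ k)"
      using bc terms_finite[OF assms(1)] by (intro sum_mono2) auto
    also have "\<dots> = weight E a $ k" using terms_weight[OF assms(1)] by (simp flip: sum_component)
    also have "\<dots> \<le> 1" by (rule weight_le_1[OF assms(2)])
    finally show False using bc(3) k eq by simp
  qed
  then obtain bs where bs: "set bs = B \<and> distinct bs \<and> sorted_wrt ?r bs"
    using ex_sorted_wrt[of ?r B] lex_less_trans lex_less_irrefl terms_finite[OF assms(1)] by blast
  have "cs = bs" if "set cs = B \<and> distinct cs \<and> sorted_wrt ?r cs" for cs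
    using that bs sorted_wrt_unique[of ?r cs bs] lex_less_trans lex_less_irrefl by blast
  with bs have "lex_list E B = bs" unfolding lex_list_def by (intro the_equality) blast+
  with bs show "set (lex_list E B) = B" "distinct (lex_list E B)" by auto
qed

section \<open>The coordinate formulas over an open set\<close>

lemma variable_section_eq:
  "variable_section W b = (\<lambda>\<mu> x. if x \<in> W then ximon {b} \<mu> else 0)"
proof -
  have "indicator_exponent {b} = (\<lambda>c. if c = b then 1 else 0)"
    by (simp add: indicator_exponent_def fun_eq_iff)
  then show ?thesis by (auto simp: variable_section_def monomial_def fun_eq_iff)
qed

text \<open>The expression formed in the algebra over W becomes the restriction of a family that
  does not depend on W, as \<open>pullback\<close> requires.\<close>

lemma super_coordinate_eq:
  assumes \<alpha>: "\<alpha> \<in> I" and \<beta>: "\<beta> \<in> I" and W: "openin (Euclidean_space p) W" "W \<subseteq> ov \<beta> \<alpha>" and a: "a < q"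
  shows "super_coordinate E \<beta> \<alpha> W a \<mu> x = (if x \<in> W then super_change \<beta> \<alpha> x a \<mu> else 0)"
proof -
  let ?A = "series_algebra p q (weight_degree E) W"
  interpret S: ring ?A by (rule ring_series_algebra[OF W(1)])
  let ?T = "terms (weight E a)"
  let ?t = "\<lambda>B. function_section W (cf \<beta> \<alpha> a B) \<otimes>\<^bsub>?A\<^esub>
    ordered_product ?A (map (variable_section W) (lex_list E B))"
  have var: "variable_section W b \<in> carrier ?A" if "b < q" for b
  proof -
    have "smooth_on p W (\<lambda>x. if x \<in> W then ximon {b} \<mu> else 0)" for \<mu>
      by (rule smooth_on_cong[OF W(1) smooth_on_const[OF W(1)]]) simp
    moreover have "ximon {b} \<mu> = 0" if "\<mu> \<notin> Exps" for \<mu>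
      using that indicator_exponent_Exps[of "{b}"] \<open>b < q\<close> by (auto simp: monomial_def)
    ultimately show ?thesis unfolding carrier_series_algebra variable_section_eq by auto
  qed
  have prod: "ordered_product ?A (map (variable_section W) (lex_list E B)) \<in> carrier ?A"
    "x \<in> W \<Longrightarrow> (\<lambda>\<nu>. ordered_product ?A (map (variable_section W) (lex_list E B)) \<nu> x) = ximon B"
    if B: "B \<in> ?T" for B x
  proof -
    have sub: "set (map (variable_section W) (lex_list E B)) \<subseteq> carrier ?A"
      using var terms_subset[OF B] lex_list_props(1)[OF B a] by auto
    show "ordered_product ?A (map (variable_section W) (lex_list E B)) \<in> carrier ?A"
      by (rule S.ordered_product_closed[OF sub])
    assume x: "x \<in> W"
    have "map (\<lambda>F \<nu>. F \<nu> x) (map (variable_section W) (lex_list E B)) = map (\<lambda>b. ximon {b}) (lex_list E B)"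
      using x by (simp add: variable_section_eq)
    then have "(\<lambda>\<nu>. ordered_product ?A (map (variable_section W) (lex_list E B)) \<nu> x) =
        ordered_product R (map (\<lambda>b. ximon {b}) (lex_list E B))"
      using ring_hom_ordered_product[OF ring_series_algebra[OF W(1)] evaluation_hom[OF W(1) x] sub]
      by (simp only:)
    also have "\<dots> = ximon B"
      using ordered_product_ximon[of "lex_list E B"] lex_list_props[OF B a] terms_subset[OF B]
        terms_weight[OF B] squarefree_weight_wt[OF a] by simp
    finally show "(\<lambda>\<nu>. ordered_product ?A (map (variable_section W) (lex_list E B)) \<nu> x) = ximon B" .
  qed
  have fn: "function_section W (cf \<beta> \<alpha> a B) \<in> carrier ?A" if B: "B \<in> ?T" for B
  proof -
    have "smooth_on p (ov \<beta> \<alpha>) (cf \<beta> \<alpha> a B)"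
      using fibre_coefficients[OF \<alpha> \<beta>] a B unfolding fibre_change_coefficients_def weight_terms_eq by blast
    then have c: "smooth_on p W (cf \<beta> \<alpha> a B)"
      by (rule smooth_on_subset[OF open_ov[OF \<alpha> \<beta>] _ W])
    have "smooth_on p W (function_section W (cf \<beta> \<alpha> a B) \<mu>)" for \<mu>
    proof (cases "\<mu> = (\<lambda>_. 0)")
      case True
      show ?thesis
        by (rule smooth_on_cong[OF W(1) c]) (simp add: function_section_def True)
    next
      case False
      show ?thesis
        by (rule smooth_on_cong[OF W(1) smooth_on_const[OF W(1), of 0]]) (simp add: function_section_def False)
    qed
    moreover have "function_section W (cf \<beta> \<alpha> a B) \<mu> x = 0" if "\<mu> \<notin> Exps \<or> x \<notin> W" for \<mu> x
      using that by (auto simp: function_section_def)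
    ultimately show ?thesis by (simp add: carrier_series_algebra)
  qed
  have t: "?t \<in> ?T \<rightarrow> carrier ?A"
    using fn prod(1) by auto
  have sc: "super_coordinate E \<beta> \<alpha> W a = (\<Oplus>\<^bsub>?A\<^esub>B\<in>?T. ?t B)"
    by (simp add: super_coordinate_def Let_def weight_terms_eq)
  show ?thesis
  proof (cases "x \<in> W")
    case x: True
    have "?t B \<mu> x = cf \<beta> \<alpha> a B x * ximon B \<mu>" if B: "B \<in> ?T" for B
    proof -
      have "(\<lambda>\<nu>. function_section W (cf \<beta> \<alpha> a B) \<nu> x) = (\<lambda>\<nu>. cf \<beta> \<alpha> a B x * \<one>\<^bsub>R\<^esub> \<nu>)"
        using x by (simp add: function_section_def one_real_series fun_eq_iff)
      then have "?t B \<mu> x = ((\<lambda>\<nu>. cf \<beta> \<alpha> a B x * \<one>\<^bsub>R\<^esub> \<nu>) \<otimes>\<^bsub>R\<^esub> ximon B) \<mu>"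
        unfolding mult_series_algebra by (simp only: prod(2)[OF B x])
      then show ?thesis
        using monomial_closed[OF indicator_exponent_Exps[OF terms_subset[OF B]]]
        by (simp add: mult_real_series_scale_left one_mult_real_series)
    qed
    then show ?thesis
      unfolding sc finsum_series_algebra[OF W(1) finite_terms t] by (simp add: x super_change_def)
  next
    case False
    have "super_coordinate E \<beta> \<alpha> W a \<in> carrier ?A"
      unfolding sc by (rule S.finsum_closed[OF t])
    with False show ?thesis by (simp add: carrier_series_algebra)
  qed
qed

lemma transformation_super_change:
  assumes \<alpha>: "\<alpha> \<in> I" and \<beta>: "\<beta> \<in> I"
  shows "transformation p (ov \<beta> \<alpha>) (ov \<alpha> \<beta>) (\<phi> \<beta> \<alpha>) (super_change \<beta> \<alpha>)"
  unfolding transformation_def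
proof (intro conjI allI ballI impI)
  show "openin (Euclidean_space p) (ov \<beta> \<alpha>)" "openin (Euclidean_space p) (ov \<alpha> \<beta>)"
    using open_ov \<alpha> \<beta> by blast+
  show "\<phi> \<beta> \<alpha> \<in> ov \<beta> \<alpha> \<rightarrow> ov \<alpha> \<beta>" using \<phi>_props(3) by blast
  show "smooth_on p (ov \<beta> \<alpha>) (\<lambda>x. \<phi> \<beta> \<alpha> x j)" if "j < p" for j
    by (rule base_manifold(5)[OF \<alpha> \<beta> that])
  show "smooth_on p (ov \<beta> \<alpha>) (\<lambda>x. super_change \<beta> \<alpha> x a \<mu>)" if "a < q" for a \<mu>
    unfolding super_change_def
  proof (rule smooth_on_sum[OF open_ov[OF \<alpha> \<beta>]])
    fix B assume "B \<in> terms (weight E a)"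
    then have "smooth_on p (ov \<beta> \<alpha>) (cf \<beta> \<alpha> a B)"
      using fibre_coefficients[OF \<alpha> \<beta>] that unfolding fibre_change_coefficients_def weight_terms_eq by blast
    then show "smooth_on p (ov \<beta> \<alpha>) (\<lambda>x. cf \<beta> \<alpha> a B x * ximon B \<mu>)"
      by (rule smooth_on_mult[OF open_ov[OF \<alpha> \<beta>] _ smooth_on_const[OF open_ov[OF \<alpha> \<beta>]]])
  qed
qed (rule substitutable_super_change)

abbreviation "\<Psi> \<equiv> transition (superization E)"

lemma transition_eq_pullback:
  assumes \<alpha>: "\<alpha> \<in> I" and \<beta>: "\<beta> \<in> I" and W: "openin (Euclidean_space p) W" "W \<subseteq> ov \<alpha> \<beta>"
  shows "\<Psi> \<beta> \<alpha> W s = pullback (ov \<beta> \<alpha>) (\<phi> \<beta> \<alpha>) (super_change \<beta> \<alpha>) W s"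
proof -
  let ?W = "{x \<in> ov \<beta> \<alpha>. \<phi> \<beta> \<alpha> x \<in> W}"
  note T = transformation_super_change[OF \<alpha> \<beta>]
  have o: "openin (Euclidean_space p) ?W" by (rule open_preimage[OF T W])
  have "substitute p q (weight_degree E) ?W (\<phi> \<beta> \<alpha>) (super_coordinate E \<beta> \<alpha> ?W) s =
      pullback (ov \<beta> \<alpha>) (\<phi> \<beta> \<alpha>) (super_change \<beta> \<alpha>) W s"
    by (rule substitute_eq_pullback[OF T o _ super_coordinate_eq[OF \<alpha> \<beta> o] refl]) auto
  then show ?thesis by (simp add: superization_def Let_def)
qed

section \<open>The cocycle condition and inverse transformations\<close>

lemma cocycle:
  assumes I: "\<alpha> \<in> I" "\<beta> \<in> I" "\<gamma> \<in> I"
    and W: "openin (Euclidean_space p) W" "W \<subseteq> ov \<alpha> \<beta>" "W \<subseteq> ov \<gamma> \<beta>"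
  shows "\<Psi> \<gamma> \<alpha> {y \<in> ov \<beta> \<gamma>. \<phi> \<beta> \<gamma> y \<in> W} (\<Psi> \<beta> \<gamma> W s) = \<Psi> \<beta> \<alpha> W s"
proof -
  let ?V = "{y \<in> ov \<beta> \<gamma>. \<phi> \<beta> \<gamma> y \<in> W}"
  have V: "openin (Euclidean_space p) ?V"
    by (rule open_preimage[OF transformation_super_change[OF I(3,2)] W(1,3)])
  have V_sub: "?V \<subseteq> ov \<alpha> \<gamma>"
  proof
    fix y assume y: "y \<in> ?V"
    then have "\<phi> \<beta> \<gamma> y \<in> ov \<alpha> \<beta>" using W(2) by blast
    then show "y \<in> ov \<alpha> \<gamma>" using \<phi>_props(2)[of y \<beta> \<gamma>] y by (simp add: ov_iff)
  qed
  \<comment> \<open>Both sides are cut off to the same set, so outside it they are both 0.\<close>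
  have dom: "x \<in> ov \<gamma> \<alpha> \<and> \<phi> \<gamma> \<alpha> x \<in> ?V \<longleftrightarrow> x \<in> ov \<beta> \<alpha> \<and> \<phi> \<beta> \<alpha> x \<in> W" for x
  proof
    assume x: "x \<in> ov \<gamma> \<alpha> \<and> \<phi> \<gamma> \<alpha> x \<in> ?V"
    then have "\<phi> \<beta> \<alpha> x \<in> W" using \<phi>_\<phi>[of x \<gamma> \<alpha> \<beta>] by simp
    moreover have "x \<in> ov \<beta> \<alpha>" using x \<phi>_props(2)[of x \<gamma> \<alpha>] by (simp add: ov_iff)
    ultimately show "x \<in> ov \<beta> \<alpha> \<and> \<phi> \<beta> \<alpha> x \<in> W" by blast
  next
    assume x: "x \<in> ov \<beta> \<alpha> \<and> \<phi> \<beta> \<alpha> x \<in> W"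
    then have "\<phi> \<beta> \<alpha> x \<in> ov \<gamma> \<beta>" using W(3) by blast
    then have x': "x \<in> ov \<gamma> \<alpha>" using \<phi>_props(2)[of x \<beta> \<alpha>] x by (simp add: ov_iff)
    then have "\<phi> \<gamma> \<alpha> x \<in> ov \<beta> \<gamma>" using \<phi>_props[OF x'] x by (simp add: ov_iff)
    with x x' show "x \<in> ov \<gamma> \<alpha> \<and> \<phi> \<gamma> \<alpha> x \<in> ?V" using \<phi>_\<phi>[OF x', of \<beta>] by simp
  qed
  show ?thesis
    unfolding transition_eq_pullback[OF I(3,2) W(1,3)] transition_eq_pullback[OF I(1,3) V V_sub]
      transition_eq_pullback[OF I(1,2) W(1,2)]
  proof (intro ext)
    fix \<nu> x
    show "pullback (ov \<gamma> \<alpha>) (\<phi> \<gamma> \<alpha>) (super_change \<gamma> \<alpha>) ?V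
          (pullback (ov \<beta> \<gamma>) (\<phi> \<beta> \<gamma>) (super_change \<beta> \<gamma>) W s) \<nu> x =
        pullback (ov \<beta> \<alpha>) (\<phi> \<beta> \<alpha>) (super_change \<beta> \<alpha>) W s \<nu> x"
    proof (cases "x \<in> ov \<beta> \<alpha> \<and> \<phi> \<beta> \<alpha> x \<in> W")
      case True
      with dom have x: "x \<in> ov \<gamma> \<alpha>" "\<phi> \<gamma> \<alpha> x \<in> ?V" by blast+
      let ?y = "\<phi> \<gamma> \<alpha> x"
      have "(\<lambda>\<mu>. pullback (ov \<beta> \<gamma>) (\<phi> \<beta> \<gamma>) (super_change \<beta> \<gamma>) W s \<mu> ?y) =
          subst_series (super_change \<beta> \<gamma> ?y) (\<lambda>\<mu>. s \<mu> (\<phi> \<beta> \<alpha> x))"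
        using x by (simp add: pullback_def \<phi>_\<phi>[OF x(1)])
      then have "pullback (ov \<gamma> \<alpha>) (\<phi> \<gamma> \<alpha>) (super_change \<gamma> \<alpha>) ?V
          (pullback (ov \<beta> \<gamma>) (\<phi> \<beta> \<gamma>) (super_change \<beta> \<gamma>) W s) \<nu> x =
          subst_series (super_change \<gamma> \<alpha> x) (subst_series (super_change \<beta> \<gamma> ?y) (\<lambda>\<mu>. s \<mu> (\<phi> \<beta> \<alpha> x))) \<nu>"
        using x by (simp only: pullback_def[of "ov \<gamma> \<alpha>"] simp_thms if_True)
      \<comment> \<open>From here on only the composed coordinate formulas matter, and for these the
        identity is \<open>super_change_super_change\<close>.\<close>
      also have "\<dots> = subst_series (\<lambda>a. subst_series (super_change \<gamma> \<alpha> x) (super_change \<beta> \<gamma> ?y a))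
          (\<lambda>\<mu>. s \<mu> (\<phi> \<beta> \<alpha> x)) \<nu>"
        by (simp only: subst_series_subst_series[OF substitutable_super_change substitutable_super_change])
      also have "\<dots> = subst_series (super_change \<beta> \<alpha> x) (\<lambda>\<mu>. s \<mu> (\<phi> \<beta> \<alpha> x)) \<nu>"
        using True super_change_super_change[OF I x(1)]
        by (subst subst_series_cong[OF substitutable_subst_series[OF substitutable_super_change
                substitutable_super_change] substitutable_super_change[of \<beta> \<alpha> x]]) auto
      finally show ?thesis using True by (simp add: pullback_def)
    next
      case False
      with dom show ?thesis by (auto simp: pullback_def)
    qed
  qed
qed

text \<open>Together with the cocycle condition this provides inverses. On the total space the
  change of a chart to itself is the identity, which by uniqueness makes the superized coordinates
  the variables themselves.\<close>

lemma transition_self: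
  assumes \<alpha>: "\<alpha> \<in> I" and W: "openin (Euclidean_space p) W" "W \<subseteq> U \<alpha>"
    and s: "s \<in> carrier (series_algebra p q (weight_degree E) W)"
  shows "\<Psi> \<alpha> \<alpha> W s = s"
proof -
  have ov: "ov \<alpha> \<alpha> = U \<alpha>" by (auto simp: ov_iff)
  show ?thesis
    unfolding transition_eq_pullback[OF \<alpha> \<alpha> W(1), unfolded ov, OF W(2)]
  proof (intro ext)
    fix \<nu> x
    show "pullback (U \<alpha>) (\<phi> \<alpha> \<alpha>) (super_change \<alpha> \<alpha>) W s \<nu> x = s \<nu> x"
    proof (cases "x \<in> W")
      case True
      then have x: "x \<in> U \<alpha>" using W by blast
      have "subst_series (super_change \<alpha> \<alpha> x) (\<lambda>\<mu>. s \<mu> x) =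
          subst_series (\<lambda>a. ximon {a}) (\<lambda>\<mu>. s \<mu> x)"
        using super_change_self[OF \<alpha> x]
        by (intro subst_series_cong substitutable_super_change substitutable_ximon) auto
      also have "\<dots> = (\<lambda>\<mu>. s \<mu> x)" by (rule subst_series_ximon[OF carrier_at[OF s]])
      finally show ?thesis using True x by (simp add: pullback_def \<phi>_self[OF \<alpha> x])
    next
      case False
      with s show ?thesis
        using \<phi>_self[OF \<alpha>, of x] by (auto simp: pullback_def carrier_series_algebra)
    qed
  qed
qed

lemma transition_morphism:
  assumes "\<alpha> \<in> I" "\<beta> \<in> I"
  shows "Z2n_morphism (series_space p q (weight_degree E) (ov \<beta> \<alpha>))
    (series_space p q (weight_degree E) (ov \<alpha> \<beta>)) (\<phi> \<beta> \<alpha>) (\<Psi> \<beta> \<alpha>)"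
  by (rule pullback_morphism[OF transformation_super_change[OF assms] transition_eq_pullback[OF assms]])

text \<open>The cocycle condition for \<alpha>, \<alpha>, \<beta>: passing to \<beta> and back is
  the transition of \<alpha> to itself.\<close>

lemma transition_inverse:
  assumes "\<alpha> \<in> I" "\<beta> \<in> I" and V: "openin (Euclidean_space p) V" "V \<subseteq> ov \<beta> \<alpha>"
    and s: "s \<in> carrier (series_algebra p q (weight_degree E) V)"
  shows "\<Psi> \<beta> \<alpha> {y \<in> ov \<alpha> \<beta>. \<phi> \<alpha> \<beta> y \<in> V} (\<Psi> \<alpha> \<beta> V s) = s"
proof -
  have "V \<subseteq> U \<alpha>" "V \<subseteq> ov \<alpha> \<alpha>" using V(2) by (auto simp: ov_iff)
  then show ?thesis
    using cocycle[OF assms(1,1,2) V(1) _ V(2)] transition_self[OF assms(1) V(1) _ s] by simp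
qed

lemma transition_isomorphism:
  assumes I: "\<alpha> \<in> I" "\<beta> \<in> I"
  shows "Z2n_isomorphism (series_space p q (weight_degree E) (ov \<beta> \<alpha>))
    (series_space p q (weight_degree E) (ov \<alpha> \<beta>)) (\<phi> \<beta> \<alpha>) (\<Psi> \<beta> \<alpha>)"
  unfolding Z2n_isomorphism_def
proof (intro conjI exI[of _ "\<phi> \<alpha> \<beta>"] exI[of _ "\<Psi> \<alpha> \<beta>"] ballI allI impI)
  note pts = topspace_points[OF open_ov[OF I]] topspace_points[OF open_ov[OF I(2,1)]]
  note opn = openin_points[OF open_ov[OF I]] openin_points[OF open_ov[OF I(2,1)]]
  show "\<phi> \<alpha> \<beta> (\<phi> \<beta> \<alpha> x) = x" if "x \<in> topspace (points (series_space p q (weight_degree E) (ov \<beta> \<alpha>)))" for x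
    using that \<phi>_\<phi>[of x \<beta> \<alpha> \<alpha>] \<phi>_self[OF I(1), of x] by (simp add: pts ov_iff)
  show "\<phi> \<beta> \<alpha> (\<phi> \<alpha> \<beta> y) = y" if "y \<in> topspace (points (series_space p q (weight_degree E) (ov \<alpha> \<beta>)))" for y
    using that \<phi>_\<phi>[of y \<alpha> \<beta> \<beta>] \<phi>_self[OF I(2), of y] by (simp add: pts ov_iff)
  show "\<Psi> \<beta> \<alpha> (preimage_in (series_space p q (weight_degree E) (ov \<alpha> \<beta>)) (\<phi> \<alpha> \<beta>) V) (\<Psi> \<alpha> \<beta> V s) = s"
    if "openin (points (series_space p q (weight_degree E) (ov \<beta> \<alpha>))) V"
      "s \<in> carrier (sections (series_space p q (weight_degree E) (ov \<beta> \<alpha>)) V)" for V s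
    using that transition_inverse[OF I, of V s] unfolding preimage_in_def pts opn series_space_simps(2) by blast
  show "\<Psi> \<alpha> \<beta> (preimage_in (series_space p q (weight_degree E) (ov \<beta> \<alpha>)) (\<phi> \<beta> \<alpha>) V) (\<Psi> \<beta> \<alpha> V s) = s"
    if "openin (points (series_space p q (weight_degree E) (ov \<alpha> \<beta>))) V"
      "s \<in> carrier (sections (series_space p q (weight_degree E) (ov \<alpha> \<beta>)) V)" for V s
    using that transition_inverse[OF I(2,1), of V s] unfolding preimage_in_def pts opn series_space_simps(2) by blast
qed (rule transition_morphism; use I in blast)+

text \<open>Reduction mod 2 loses nothing, as the entries of a weight are 0 or 1.\<close>

lemma weight_degree_nonzero:
  assumes "a < q"
  shows "weight_degree E a \<noteq> 0"
proof -
  obtain k where "weight E a $ k = 1" using wt_component_positive[OF assms] by blast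
  then have "weight_degree E a $ k = 1" by (simp add: weight_degree_def)
  then show ?thesis by auto
qed

section \<open>Assembly of the atlas\<close>

lemma superization_simps:
  "body (superization E) = base_space E" "body_dim (superization E) = p"
  "formal_dim (superization E) = q" "formal_degree (superization E) = weight_degree E"
  "charts (superization E) = I" "chart_domain (superization E) = U" "chart_map (superization E) = \<psi>"
  by (simp_all add: superization_def)

lemma chart_space_superization:
  "chart_space (superization E) \<alpha> = series_space p q (weight_degree E) (U \<alpha>)"
  by (simp add: chart_space_def superization_simps)

lemma open_subspace_chart:
  "open_subspace (chart_space (superization E) \<alpha>) (ov \<beta> \<alpha>) = series_space p q (weight_degree E) (ov \<beta> \<alpha>)"
proof -
  have "U \<alpha> \<inter> ov \<beta> \<alpha> = ov \<beta> \<alpha>" by (auto simp: ov_iff)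
  then show ?thesis by (simp add: chart_space_superization open_subspace_series_space)
qed

lemma supermanifold: "Z2n_supermanifold (superization E)"
  unfolding Z2n_supermanifold_def Let_def superization_simps
proof (intro conjI allI impI ballI)
  show "locally_Z2n_ringed_space (chart_space (superization E) \<alpha>)" if "\<alpha> \<in> I" for \<alpha>
    unfolding chart_space_superization by (rule locally_Z2n_ringed_series_space[OF open_U[OF that]])
  show "Z2n_isomorphism (open_subspace (chart_space (superization E) \<alpha>) (ov \<beta> \<alpha>))
      (open_subspace (chart_space (superization E) \<beta>) (ov \<alpha> \<beta>)) (\<phi> \<beta> \<alpha>) (\<Psi> \<beta> \<alpha>)"
    if "\<alpha> \<in> I" "\<beta> \<in> I" for \<alpha> \<beta>
    unfolding open_subspace_chart by (rule transition_isomorphism[OF that])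
  fix \<alpha> \<beta> \<gamma> W s
  assume "\<alpha> \<in> I" "\<beta> \<in> I" "\<gamma> \<in> I" "openin (Euclidean_space p) W \<and> W \<subseteq> overlap_in U \<psi> {\<alpha>, \<gamma>} \<beta>"
  moreover have "overlap_in U \<psi> {\<alpha>, \<gamma>} \<beta> = ov \<alpha> \<beta> \<inter> ov \<gamma> \<beta>" by (auto simp: overlap_in_def)
  ultimately show "\<Psi> \<gamma> \<alpha> {y \<in> ov \<beta> \<gamma>. \<phi> \<beta> \<gamma> y \<in> W} (\<Psi> \<beta> \<gamma> W s) = \<Psi> \<beta> \<alpha> W s"
    by (intro cocycle) auto
qed (use base_manifold weight_degree_nonzero in auto)

end

theorem proposition5p5:
  fixes E :: "('e, 'm, 'i, 'n::{finite,linorder}) bundle_atlas"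
  assumes "n_vector_bundle E"
  shows "Z2n_supermanifold (superization E)"
proof -
  interpret vector_bundle E by unfold_locales (rule assms)
  show ?thesis by (rule supermanifold)
qed

end
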